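(* Let $s>c\ge0$ be integers. For every integer $n$ in the range $$s\le n\le(c+1)(s-c)$$ there exists a bi-Cohen-Macaulay simplicial complex of type $(n,c,s)$ which is not a cone.
   Context: Let $k$ be a field. A simplicial complex on $[n]=\{1,\dots,n\}$ is a family of subsets of $[n]$ (faces) closed under taking subsets; a face of cardinality $r$ has dimension $r-1$. $\Delta$ is Cohen-Macaulay (over $k$) if its Stanley-Reisner ring $k[\Delta]=k[x_1,\dots,x_n]/(x_{i_1}\cdots x_{i_r} : \{i_1,\dots,i_r\}\notin\Delta)$ is a Cohen-Macaulay ring. The Alexander dual is $\Delta^*=\{F\subseteq[n] : [n]\setminus F\notin\Delta\}$. $\Delta$ is bi-Cohen-Macaulay if both $\Delta$ and $\Delta^*$ are Cohen-Macaulay. A bi-Cohen-Macaulay complex $\Delta$ on $[n]$ is of type $(n,c,s)$ (has invariants $n,c,s$) if $c$ is the largest integer such that all subsets of $[n]$ of cardinality $c$ are in $\Delta$, and the $f$-polynomial $f_\Delta(t)=1+f_0t+\cdots+f_{d-1}t^d$ ($f_i$ the number of $i$-dimensional faces, $d-1=\dim\Delta$) equals $(1+t)^{n-s}\left(1+st+\binom s2t^2+\cdots+\binom sct^c\right)$. $\Delta$ is a cone if there is a vertex $i\in[n]$ such that $F\in\Delta$ implies $F\cup\{i\}\in\Delta$. *)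

theory Defs
  imports
    "HOL-Algebra.Ring_Divisibility"
    "HOL-Library.Poly_Mapping"
    "HOL-Library.Extended_Nat"
    "HOL-Computational_Algebra.Polynomial"
begin

section \<open>Cohen-Macaulay rings\<close>

text \<open>
  The elements \<open>x\<^sub>1, \<dots>, x\<^sub>r\<close> form a regular sequence if each \<open>x\<^sub>i\<close> is a nonzerodivisor modulo
  \<open>(x\<^sub>1, \<dots>, x\<^sub>i\<^sub>-\<^sub>1)\<close> and \<open>(x\<^sub>1, \<dots>, x\<^sub>r)\<close> is a proper ideal.
\<close>

definition regular_seq :: "('a, 'b) ring_scheme \<Rightarrow> 'a list \<Rightarrow> bool" where
  "regular_seq R xs \<longleftrightarrow>
     set xs \<subseteq> carrier R \<and>
     (\<forall>i < length xs. \<forall>r \<in> carrier R.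
        (xs ! i) \<otimes>\<^bsub>R\<^esub> r \<in> genideal R (set (take i xs)) \<longrightarrow> r \<in> genideal R (set (take i xs))) \<and>
     genideal R (set xs) \<noteq> carrier R"

definition ideal_depth :: "('a, 'b) ring_scheme \<Rightarrow> 'a set \<Rightarrow> enat" where
  "ideal_depth R I = Sup {enat (length xs) |xs. set xs \<subseteq> I \<and> regular_seq R xs}"

definition prime_height :: "('a, 'b) ring_scheme \<Rightarrow> 'a set \<Rightarrow> enat" where
  "prime_height R P =
     Sup {enat r |r Ps. length Ps = Suc r \<and> last Ps = P \<and>
            sorted_wrt (\<subset>) Ps \<and> (\<forall>Q \<in> set Ps. primeideal Q R)}"

text \<open>
  This is the definition of Eisenbud's \<^emph>\<open>Commutative Algebra\<close>, Section 18.2: \<open>R\<close> is Noetherian and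
  depth equals codimension for every maximal ideal.  No localization is needed, as
  the depth of \<open>M\<close> on \<open>R\<close> is the depth of the local ring at the maximal ideal \<open>M\<close>.
\<close>

definition cohen_macaulay_ring :: "('a, 'b) ring_scheme \<Rightarrow> bool" where
  "cohen_macaulay_ring R \<longleftrightarrow>
     cring R \<and> noetherian_ring R \<and>
     (\<forall>M. maximalideal M R \<longrightarrow> ideal_depth R M = prime_height R M)"

section \<open>Simplicial complexes and Stanley-Reisner rings\<close>

text \<open>
  Complexes on \<open>{1..n}\<close>; a vertex \<open>i\<close> need not satisfy \<open>{i} \<in> \<Delta>\<close>.
\<close>

definition simplicial_complex :: "nat \<Rightarrow> nat set set \<Rightarrow> bool" where
  "simplicial_complex n \<Delta> \<longleftrightarrow> \<Delta> \<subseteq> Pow {1..n} \<and> (\<forall>F \<in> \<Delta>. \<forall>G. G \<subseteq> F \<longrightarrow> G \<in> \<Delta>)"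

text \<open>
  A polynomial is a finitely supported map from exponent vectors \<open>nat \<Rightarrow>\<^sub>0 nat\<close> to coefficients;
  \<open>k[x\<^sub>1, \<dots>, x\<^sub>n]\<close> consists of those involving only variables with index in \<open>{1..n}\<close>.
\<close>

type_synonym 'k mpolynomial = "(nat \<Rightarrow>\<^sub>0 nat) \<Rightarrow>\<^sub>0 'k"

definition mpoly_ring :: "nat \<Rightarrow> ('k::field) mpolynomial ring" where
  "mpoly_ring n =
     \<lparr>carrier = {p. \<forall>m \<in> Poly_Mapping.keys p. Poly_Mapping.keys m \<subseteq> {1..n}},
      mult = (*), one = 1, zero = 0, add = (+)\<rparr>"

definition mvar :: "nat \<Rightarrow> ('k::field) mpolynomial" where
  "mvar i = Poly_Mapping.single (Poly_Mapping.single i 1) 1"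

definition stanley_reisner_ideal :: "nat \<Rightarrow> nat set set \<Rightarrow> ('k::field) mpolynomial set" where
  "stanley_reisner_ideal n \<Delta> =
     genideal (mpoly_ring n) {\<Prod>i\<in>F. mvar i |F. F \<subseteq> {1..n} \<and> F \<notin> \<Delta>}"

definition stanley_reisner_ring :: "nat \<Rightarrow> nat set set \<Rightarrow> ('k::field) mpolynomial set ring" where
  "stanley_reisner_ring n \<Delta> = mpoly_ring n Quot stanley_reisner_ideal n \<Delta>"

definition cohen_macaulay_complex :: "('k::field) itself \<Rightarrow> nat \<Rightarrow> nat set set \<Rightarrow> bool" where
  "cohen_macaulay_complex (_ :: 'k itself) n \<Delta> \<longleftrightarrow>
     cohen_macaulay_ring (stanley_reisner_ring n \<Delta> :: 'k mpolynomial set ring)"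

definition alexander_dual :: "nat \<Rightarrow> nat set set \<Rightarrow> nat set set" where
  "alexander_dual n \<Delta> = {F. F \<subseteq> {1..n} \<and> {1..n} - F \<notin> \<Delta>}"

definition bi_cohen_macaulay :: "('k::field) itself \<Rightarrow> nat \<Rightarrow> nat set set \<Rightarrow> bool" where
  "bi_cohen_macaulay K n \<Delta> \<longleftrightarrow>
     simplicial_complex n \<Delta> \<and>
     cohen_macaulay_complex K n \<Delta> \<and>
     cohen_macaulay_complex K n (alexander_dual n \<Delta>)"

section \<open>Face numbers and type\<close>

definition face_number :: "nat set set \<Rightarrow> nat \<Rightarrow> nat" where
  "face_number \<Delta> i = card {F \<in> \<Delta>. card F = i + 1}"

text \<open>
  The sum runs up to \<open>f\<^sub>n\<^sub>-\<^sub>1\<close>; the terms beyond the dimension of \<open>\<Delta>\<close> vanish.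
\<close>

definition f_polynomial :: "nat \<Rightarrow> nat set set \<Rightarrow> int poly" where
  "f_polynomial n \<Delta> = 1 + (\<Sum>i<n. of_nat (face_number \<Delta> i) * [:0, 1:] ^ (i + 1))"

text \<open>
  In the maximality of \<open>c\<close> only cardinalities up to \<open>n\<close> count: above \<open>n\<close> the condition on
  subsets is vacuous.
\<close>

definition has_type :: "nat set set \<Rightarrow> nat \<Rightarrow> nat \<Rightarrow> nat \<Rightarrow> bool" where
  "has_type \<Delta> n c s \<longleftrightarrow>
     s \<le> n \<and>
     c \<le> n \<and> (\<forall>F \<subseteq> {1..n}. card F = c \<longrightarrow> F \<in> \<Delta>) \<and>
     (\<forall>r. c < r \<and> r \<le> n \<longrightarrow> \<not> (\<forall>F \<subseteq> {1..n}. card F = r \<longrightarrow> F \<in> \<Delta>)) \<and>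
     f_polynomial n \<Delta> =
       [:1, 1:] ^ (n - s) * (\<Sum>j\<le>c. of_nat (s choose j) * [:0, 1:] ^ j)"

definition is_cone :: "nat \<Rightarrow> nat set set \<Rightarrow> bool" where
  "is_cone n \<Delta> \<longleftrightarrow> (\<exists>i \<in> {1..n}. \<forall>F \<in> \<Delta>. insert i F \<in> \<Delta>)"

end

theory Submission
  imports Defs
begin

text \<open>
  For \<open>n = (c + 1)(s - c)\<close> the complex is given by a polarization of the \<open>(c + 1)\<close>-st power of the
  maximal ideal in \<open>s - c\<close> variables: its minimal nonfaces are the monotone paths in a
  \<open>(c + 1) \<times> (s - c)\<close> grid.  For smaller \<open>n\<close>, cells on a common antidiagonal are identified.
  Alexander duality transposes the grid.  For the corner cell \<open>v\<close>, both \<open>(I : x\<^sub>v)\<close> and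
  \<open>I + (x\<^sub>v)\<close> belong to grids with one row or one column less, so the Stanley-Reisner ring is an
  iterated extension of polynomial rings in \<open>d = n - (s - c)\<close> of the variables, and the face numbers
  follow by Pascal's rule.

  For a maximal ideal \<open>M\<close>, let \<open>U\<close> be the set of the \<open>i\<close> with \<open>x\<^sub>i \<notin> M\<close>.  By Zariski's lemma,
  \<open>M\<close> contains some \<open>f\<^sub>i(x\<^sub>i)\<close> with \<open>f\<^sub>i(0) \<noteq> 0\<close> for each \<open>i \<in> U\<close>.  These elements, followed by the
  elementary symmetric functions of degrees \<open>d - |U|, \<dots>, 1\<close> in the other variables, form a
  regular sequence of length \<open>d\<close> on each of these polynomial rings (possibly with zero quotient),
  hence on the Stanley-Reisner ring.  The height of \<open>M\<close> is at most \<open>d\<close> because every prime chain lives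
  in a polynomial ring in at most \<open>d\<close> variables, where any \<open>d + 1\<close> elements are algebraically
  dependent.
\<close>

section \<open>Ideals and weakly regular sequences\<close>

text \<open>Why antidiagonals: along a monotone path the sum of the coordinates strictly increases,
  so the path meets each antidiagonal at most once and its monomial stays squarefree of degree
  \<open>c + 1\<close>. The corner is alone on its antidiagonal, so its variable occurs in neither
  of the two smaller grids; this computes the colon ideals. The bounds on \<open>n\<close> are the
  possible numbers of labels: at least one for each of the \<open>s\<close> antidiagonals, at most
  one for each of the \<open>(c + 1)(s - c)\<close> cells. There is no cone point because every
  label lies on a path, and paths are minimal nonfaces.

  The Cohen-Macaulay condition is demanded at every maximal ideal and over any field, so homogeneous
  parameters at the origin do not suffice; this brings in the polynomials \<open>f_i\<close>. One
  sequence has to serve all pieces of the filtration at once, so it may depend on \<open>M\<close>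
  and \<open>d\<close> but not on the piece. Regularity is carried along without properness, so that
  zero quotients are harmless; properness returns at the end because the sequence lies in
  \<open>M\<close>. The conclusion is the squeeze \<open>d \<le> depth \<le> height \<le> d\<close>,
  whose middle inequality comes from a chain of primes built along a regular sequence.\<close>

interpretation rmod: Modules.module "(*) :: 'a::comm_ring_1 \<Rightarrow> 'a \<Rightarrow> 'a"
  by unfold_locales (simp_all add: algebra_simps)

text \<open>The ring acts on itself, so \<open>rmod.subspace\<close> means ideal and
  \<open>rmod.span\<close> generated ideal. For this action \<open>scale_scale\<close> would
  reassociate every product to the left.\<close>

declare rmod.scale_scale [simp del]

lemma in_span_insert_subspace:
  "rmod.subspace J \<Longrightarrow> x \<in> rmod.span (insert g J) \<longleftrightarrow> (\<exists>k. x - k * g \<in> J)"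
  by (metis rmod.span_breakdown_eq rmod.span_eq_iff)

lemma span_Un_span: "rmod.span (X \<union> rmod.span Y) = rmod.span (X \<union> Y)"
proof (rule rmod.span_eq[THEN iffD2], intro conjI)
  show "X \<union> rmod.span Y \<subseteq> rmod.span (X \<union> Y)"
    using rmod.span_superset[of "X \<union> Y"] rmod.span_mono[of Y "X \<union> Y"] by auto
  show "X \<union> Y \<subseteq> rmod.span (X \<union> rmod.span Y)"
    using rmod.span_superset[of "X \<union> rmod.span Y"] rmod.span_superset[of Y] by auto
qed

lemma span_insert_span: "rmod.span (insert x (rmod.span Y)) = rmod.span (insert x Y)"
  using span_Un_span[of "{x}" Y] by simp

section \<open>Prime ideals, and primes that avoid a multiplicative set\<close>

definition prime_id :: "'a::comm_ring_1 set \<Rightarrow> bool" where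
  "prime_id M \<longleftrightarrow> rmod.subspace M \<and> 1 \<notin> M \<and> (\<forall>a b. a * b \<in> M \<longrightarrow> a \<in> M \<or> b \<in> M)"

lemma prime_id_subspace: "prime_id M \<Longrightarrow> rmod.subspace M"
  by (simp add: prime_id_def)

lemma prime_id_mult_iff: "prime_id M \<Longrightarrow> a * b \<in> M \<longleftrightarrow> a \<in> M \<or> b \<in> M"
  unfolding prime_id_def using rmod.subspace_scale by (metis mult.commute)

lemma prime_id_one: "prime_id M \<Longrightarrow> 1 \<notin> M"
  by (simp add: prime_id_def)

lemma prime_id_power_iff: "prime_id M \<Longrightarrow> a ^ n \<in> M \<longleftrightarrow> a \<in> M \<and> n > 0"
  by (induction n) (auto simp: prime_id_mult_iff prime_id_one)

lemma prime_id_prod_iff: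
  "finite A \<Longrightarrow> prime_id M \<Longrightarrow> prod f A \<in> M \<longleftrightarrow> (\<exists>x\<in>A. f x \<in> M)"
  by (induction A rule: finite_induct) (simp_all add: prime_id_mult_iff prime_id_one)

text \<open>By Zorn's lemma some ideal is maximal among those containing \<open>J\<close> and
  missing \<open>S\<close>. It is prime: enlarging it by \<open>a\<close> or by \<open>b\<close>
  makes it meet \<open>S\<close>, and the product of the two elements met would lie in it if
  \<open>a * b\<close> did.\<close>

lemma exists_prime_id_avoiding:
  fixes J S :: "'a::comm_ring_1 set"
  assumes J: "rmod.subspace J" and disj: "J \<inter> S = {}"
    and one: "1 \<in> S" and mult: "\<And>a b. a \<in> S \<Longrightarrow> b \<in> S \<Longrightarrow> a * b \<in> S"
  obtains M where "prime_id M" "J \<subseteq> M" "M \<inter> S = {}"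
proof -
  define \<A> where "\<A> = {I. rmod.subspace I \<and> J \<subseteq> I \<and> I \<inter> S = {}}"
  have "\<exists>M\<in>\<A>. \<forall>X\<in>\<A>. M \<subseteq> X \<longrightarrow> X = M"
  proof (rule subset_Zorn_nonempty)
    show "\<A> \<noteq> {}" using J disj by (auto simp: \<A>_def)
  next
    fix \<C> assume ne: "\<C> \<noteq> {}" and ch: "subset.chain \<A> \<C>"
    have sub: "\<C> \<subseteq> \<A>" and lin: "\<And>X Y. X \<in> \<C> \<Longrightarrow> Y \<in> \<C> \<Longrightarrow> X \<subseteq> Y \<or> Y \<subseteq> X"
      using ch by (auto simp: subset_chain_def)
    have "rmod.subspace (\<Union>\<C>)"
    proof (rule rmod.subspaceI)
      show "0 \<in> \<Union>\<C>" using ne sub by (auto simp: \<A>_def rmod.subspace_0 subset_eq)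
    next
      fix x y assume "x \<in> \<Union>\<C>" "y \<in> \<Union>\<C>"
      then obtain X Y where XY: "X \<in> \<C>" "Y \<in> \<C>" "x \<in> X" "y \<in> Y" by blast
      then have "\<exists>Z\<in>\<C>. x \<in> Z \<and> y \<in> Z" using lin[OF XY(1,2)] by blast
      then show "x + y \<in> \<Union>\<C>" using sub by (auto simp: \<A>_def subset_eq intro: rmod.subspace_add)
    next
      fix c x assume "x \<in> \<Union>\<C>"
      then show "c * x \<in> \<Union>\<C>" using sub by (auto simp: \<A>_def subset_eq intro: rmod.subspace_scale)
    qed
    then show "\<Union>\<C> \<in> \<A>" using ne sub by (auto simp: \<A>_def)
  qed
  then obtain M where M: "rmod.subspace M" "J \<subseteq> M" "M \<inter> S = {}"
    and max: "\<And>X. rmod.subspace X \<Longrightarrow> M \<subseteq> X \<Longrightarrow> X \<inter> S = {} \<Longrightarrow> X = M"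
    by (auto simp: \<A>_def)
  have ext: "\<exists>s\<in>S. \<exists>k. s - k * a \<in> M" if "a \<notin> M" for a
  proof -
    have "M \<subseteq> rmod.span (insert a M)" "a \<in> rmod.span (insert a M)"
      by (auto intro: rmod.span_base)
    then have "rmod.span (insert a M) \<inter> S \<noteq> {}"
      using max[of "rmod.span (insert a M)"] that by auto
    then show ?thesis
      using M(1) by (auto simp: in_span_insert_subspace)
  qed
  have "prime_id M" unfolding prime_id_def
  proof (intro conjI allI impI)
    show "1 \<notin> M" using M one by auto
    fix a b assume ab: "a * b \<in> M"
    show "a \<in> M \<or> b \<in> M"
    proof (rule ccontr)
      assume "\<not> ?thesis"
      then obtain s t k l where st: "s \<in> S" "t \<in> S" "s - k * a \<in> M" "t - l * b \<in> M"
        using ext[of a] ext[of b] by blast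
      have "s * t = t * (s - k * a) + k * a * (t - l * b) + k * l * (a * b)"
        by (simp add: algebra_simps)
      also have "\<dots> \<in> M"
        using rmod.subspace_scale[OF M(1) ab] rmod.subspace_scale[OF M(1) st(3)]
          rmod.subspace_scale[OF M(1) st(4)] by (intro rmod.subspace_add M(1)) blast+
      finally show False using M(3) mult[OF st(1,2)] by auto
    qed
  qed (fact M)
  then show ?thesis using that M by blast
qed

text \<open>Regularity without the demand that the final ideal be proper. In the filtrations below
  some colon and sum ideals are the whole ring, and there every list must count as regular.\<close>

fun weakly_regular :: "'a::comm_ring_1 set \<Rightarrow> 'a list \<Rightarrow> bool" where
  "weakly_regular J [] \<longleftrightarrow> True"
| "weakly_regular J (y # ys) \<longleftrightarrow>
     (\<forall>r. y * r \<in> J \<longrightarrow> r \<in> J) \<and> weakly_regular (rmod.span (insert y J)) ys"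

declare weakly_regular.simps(2) [simp del]

lemma weakly_regularD:
  assumes "weakly_regular J (y # ys)"
  shows "y * r \<in> J \<Longrightarrow> r \<in> J" "weakly_regular (rmod.span (insert y J)) ys"
  using assms by (auto simp only: weakly_regular.simps)

lemma weakly_regular_ConsI:
  assumes "\<And>r. y * r \<in> J \<Longrightarrow> r \<in> J" "weakly_regular (rmod.span (insert y J)) ys"
  shows "weakly_regular J (y # ys)"
  using assms by (auto simp only: weakly_regular.simps)

lemma all_less_Suc_split0: "(\<forall>i<Suc n. P i) \<longleftrightarrow> P 0 \<and> (\<forall>i<n. P (Suc i))"
  by (auto simp: less_Suc_eq_0_disj)

lemma weakly_regular_iff_nth:
  "rmod.subspace J \<Longrightarrow> weakly_regular J ys \<longleftrightarrow>
     (\<forall>i < length ys. \<forall>r. ys ! i * r \<in> rmod.span (set (take i ys) \<union> J)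
        \<longrightarrow> r \<in> rmod.span (set (take i ys) \<union> J))"
proof (induction ys arbitrary: J)
  case (Cons y ys)
  have eq: "rmod.span (X \<union> rmod.span (insert y J)) = rmod.span (insert y X \<union> J)" for X
    by (simp add: span_Un_span)
  have "rmod.span J = J" using Cons.prems by simp
  then show ?case
    using Cons.IH[of "rmod.span (insert y J)"]
    by (simp only: weakly_regular.simps length_Cons all_less_Suc_split0 nth_Cons_0 nth_Cons_Suc
        take_0 take_Suc_Cons list.set Un_empty_left eq rmod.subspace_span simp_thms)
qed simp

lemma weakly_regular_UNIV: "weakly_regular UNIV ys"
  by (induction ys) (auto intro!: weakly_regular_ConsI simp: rmod.span_UNIV insert_absorb)

lemma subspace_colon: "rmod.subspace J \<Longrightarrow> rmod.subspace {r. g * r \<in> J}"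
  by (rule rmod.subspaceI)
    (auto simp: distrib_left rmod.subspace_0 rmod.subspace_add mult.left_commute[of g] rmod.subspace_scale)

text \<open>From the exact sequence \<open>0 \<rightarrow> R/(J : g) \<rightarrow> R/J \<rightarrow> R/(J + (g)) \<rightarrow> 0\<close>.\<close>

lemma weakly_regular_colon_sum:
  assumes "rmod.subspace J"
    and "weakly_regular {r. g * r \<in> J} ys" and "weakly_regular (rmod.span (insert g J)) ys"
  shows "weakly_regular J ys"
  using assms
proof (induction ys arbitrary: J)
  case (Cons y ys)
  note J = Cons.prems(1)
  have c1: "g * r \<in> J" if "g * (y * r) \<in> J" for r
    using weakly_regularD(1)[OF Cons.prems(2), of r] that by simp
  have c2: "r \<in> rmod.span (insert g J)" if "y * r \<in> rmod.span (insert g J)" for r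
    using weakly_regularD(1)[OF Cons.prems(3), of r] that by simp
  \<comment> \<open>Regularity modulo \<open>J + (g)\<close> gives \<open>r = k g\<close> modulo
    \<open>J\<close>; then \<open>g (y k)\<close> lies in \<open>J\<close>, and regularity modulo
    \<open>(J : g)\<close> puts \<open>g k\<close>, hence \<open>r\<close>, into
    \<open>J\<close>.\<close>
  have nzd: "r \<in> J" if r: "y * r \<in> J" for r
  proof -
    have "r \<in> rmod.span (insert g J)" using c2[OF rmod.span_base] r by blast
    then obtain k where k: "r - k * g \<in> J" using J by (auto simp: in_span_insert_subspace)
    have "g * (y * k) = y * r - y * (r - k * g)" by (simp add: algebra_simps)
    also have "\<dots> \<in> J" using rmod.subspace_diff[OF J r rmod.subspace_scale[OF J k]] by simp
    finally have "g * k \<in> J" by (rule c1)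
    then have "(r - k * g) + g * k \<in> J" using J k by (intro rmod.subspace_add)
    then show ?thesis by (simp add: algebra_simps)
  qed
  let ?J = "rmod.span (insert y J)"
  \<comment> \<open>Adding \<open>y\<close> commutes with the colon because \<open>y\<close> is
    regular modulo \<open>J + (g)\<close>: from \<open>g s = r y\<close> modulo \<open>J\<close>
    follows \<open>r = t g\<close> modulo \<open>J\<close>, and then \<open>s - t y\<close> lies in
    \<open>(J : g)\<close>.\<close>
  have "{r. g * r \<in> ?J} = rmod.span (insert y {r. g * r \<in> J})"
  proof (rule Set.set_eqI, rule iffI)
    fix s assume "s \<in> {r. g * r \<in> ?J}"
    then obtain r where r: "g * s - r * y \<in> J" using J by (auto simp: in_span_insert_subspace)
    have "y * r = s * g - (g * s - r * y)" by (simp add: algebra_simps)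
    also have "\<dots> \<in> rmod.span (insert g J)"
      using rmod.span_diff[OF rmod.span_scale[OF rmod.span_base, of g "insert g J" s]
          rmod.span_base[of "g * s - r * y" "insert g J"]] r by blast
    finally obtain t where t: "r - t * g \<in> J" using c2 J by (auto simp: in_span_insert_subspace)
    have "g * (s - t * y) = (g * s - r * y) + y * (r - t * g)" by (simp add: algebra_simps)
    also have "\<dots> \<in> J" using rmod.subspace_add[OF J r rmod.subspace_scale[OF J t]] by simp
    finally show "s \<in> rmod.span (insert y {r. g * r \<in> J})"
      by (auto simp: in_span_insert_subspace[OF subspace_colon[OF J]])
  next
    fix s assume "s \<in> rmod.span (insert y {r. g * r \<in> J})"
    then obtain t where t: "g * (s - t * y) \<in> J"
      by (auto simp: in_span_insert_subspace[OF subspace_colon[OF J]])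
    then have "g * s - (g * t) * y \<in> J" by (simp add: algebra_simps)
    then show "s \<in> {r. g * r \<in> ?J}" using J by (auto simp: in_span_insert_subspace)
  qed
  moreover have "rmod.span (insert g ?J) = rmod.span (insert y (rmod.span (insert g J)))"
    by (simp only: span_insert_span insert_commute[of g])
  ultimately have "weakly_regular ?J ys"
    using Cons.IH[of ?J] weakly_regularD(2)[OF Cons.prems(2)] weakly_regularD(2)[OF Cons.prems(3)]
    by (simp only: rmod.subspace_span)
  then show ?case using nzd by (intro weakly_regular_ConsI)
qed simp

text \<open>The primes of the chain are found from the top: \<open>P\<^sub>k\<^sub>-\<^sub>1\<close> contains the first \<open>k - 1\<close> elements
  and avoids the multiplicative set \<open>{a x\<^sub>k\<^sup>i | a \<notin> P\<^sub>k}\<close>.\<close>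

lemma prime_chain_of_weakly_regular:
  assumes "rmod.subspace J" "weakly_regular J ys" "prime_id M" "J \<subseteq> M" "set ys \<subseteq> M"
  shows "\<exists>Ps. length Ps = Suc (length ys) \<and> last Ps = M \<and> sorted_wrt (\<subset>) Ps \<and>
           (\<forall>Q\<in>set Ps. prime_id Q \<and> J \<subseteq> Q)"
  using assms
proof (induction ys arbitrary: J)
  case Nil
  then show ?case by (intro exI[of _ "[M]"]) auto
next
  case (Cons y ys)
  let ?J = "rmod.span (insert y J)"
  have "?J \<subseteq> M"
    using Cons.prems by (intro rmod.span_minimal) (auto simp: prime_id_def)
  then obtain Ps where Ps: "length Ps = Suc (length ys)" "last Ps = M" "sorted_wrt (\<subset>) Ps"
    "\<forall>Q\<in>set Ps. prime_id Q \<and> ?J \<subseteq> Q"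
    using Cons.IH[of ?J] weakly_regularD(2)[OF Cons.prems(2)] Cons.prems(3,5) by auto
  then obtain P Qs where PQ: "Ps = P # Qs" by (cases Ps) auto
  have P: "prime_id P" "?J \<subseteq> P" using Ps PQ by auto
  have yP: "y \<in> P" "J \<subseteq> P" using P(2) by (auto intro: rmod.span_base)
  \<comment> \<open>Powers of \<open>y\<close> are regular too. So \<open>a y^i\<close> in
    \<open>J\<close> forces \<open>a\<close> into \<open>J\<close>, hence into \<open>P\<close>,
    which shows that \<open>J\<close> misses \<open>S\<close>.\<close>
  have nzd: "r \<in> J" if "y ^ i * r \<in> J" for r i
    using that
  proof (induction i)
    case (Suc i)
    have "y * (y ^ i * r) \<in> J" using Suc.prems by (simp only: power_Suc mult.assoc)
    then show ?case using weakly_regularD(1)[OF Cons.prems(2)] Suc.IH by blast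
  qed simp
  define S where "S = {a * y ^ i |a i. a \<notin> P}"
  obtain Q where Q: "prime_id Q" "J \<subseteq> Q" "Q \<inter> S = {}"
  proof (rule exists_prime_id_avoiding[OF Cons.prems(1)])
    show "J \<inter> S = {}"
      using nzd yP by (auto simp: S_def) (metis mult.commute subsetD)
    have "1 * y ^ 0 \<in> S" using prime_id_one[OF P(1)] unfolding S_def by blast
    then show "1 \<in> S" by simp
  next
    fix a b assume "a \<in> S" "b \<in> S"
    then obtain a' b' i j where ab: "a = a' * y ^ i" "b = b' * y ^ j" "a' \<notin> P" "b' \<notin> P"
      by (auto simp: S_def)
    have "a * b = (a' * b') * y ^ (i + j)"
      unfolding ab(1,2) by (simp only: power_add ac_simps)
    moreover have "a' * b' \<notin> P" using P(1) ab by (simp add: prime_id_mult_iff)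
    ultimately show "a * b \<in> S" unfolding S_def by blast
  qed
  have "a \<in> S" if "a \<notin> P" for a
    unfolding S_def by (rule CollectI, rule exI[of _ a], rule exI[of _ 0]) (use that in simp)
  then have "Q \<subseteq> P" using Q(3) by blast
  moreover have "1 * y ^ 1 \<in> S" using P(1) unfolding S_def prime_id_def by blast
  then have "y \<notin> Q" using Q(3) by auto
  ultimately have "Q \<subset> P" using yP by auto
  then have "sorted_wrt (\<subset>) (Q # Ps)"
    using Ps(3) PQ by (auto intro: psubset_trans)
  moreover have "\<forall>Q\<in>set Ps. prime_id Q \<and> J \<subseteq> Q"
    using Ps(4) by (auto intro: rmod.span_base)
  ultimately show ?case
    using Q Ps by (intro exI[of _ "Q # Ps"]) auto
qed

section \<open>Subrings as sets, polynomials over them, and adjoining one element\<close>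

definition subring_of :: "'a::comm_ring_1 set \<Rightarrow> bool" where
  "subring_of A \<longleftrightarrow> 1 \<in> A \<and> (\<forall>a\<in>A. \<forall>b\<in>A. a + b \<in> A \<and> a * b \<in> A \<and> - a \<in> A)"

lemma subring_ofD:
  assumes "subring_of A"
  shows "1 \<in> A" "0 \<in> A" "a \<in> A \<Longrightarrow> b \<in> A \<Longrightarrow> a + b \<in> A" "a \<in> A \<Longrightarrow> b \<in> A \<Longrightarrow> a * b \<in> A"
    "a \<in> A \<Longrightarrow> - a \<in> A" "a \<in> A \<Longrightarrow> b \<in> A \<Longrightarrow> a - b \<in> A" "a \<in> A \<Longrightarrow> a ^ n \<in> A"
proof -
  show 1: "1 \<in> A" "a \<in> A \<Longrightarrow> b \<in> A \<Longrightarrow> a + b \<in> A" "a \<in> A \<Longrightarrow> b \<in> A \<Longrightarrow> a * b \<in> A"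
    "a \<in> A \<Longrightarrow> - a \<in> A" for a b using assms by (auto simp: subring_of_def)
  show "0 \<in> A" using 1(2)[OF 1(1) 1(4)[OF 1(1)]] by simp
  show "a - b \<in> A" if "a \<in> A" "b \<in> A" using 1(2)[OF that(1) 1(4)[OF that(2)]] by simp
  show "a ^ n \<in> A" if "a \<in> A" using that by (induction n) (auto intro: 1)
qed

lemma subring_of_sum: "subring_of A \<Longrightarrow> (\<And>x. x \<in> X \<Longrightarrow> f x \<in> A) \<Longrightarrow> sum f X \<in> A"
  by (induction X rule: infinite_finite_induct) (auto intro: subring_ofD)

lemma subring_of_prod: "subring_of A \<Longrightarrow> (\<And>x. x \<in> X \<Longrightarrow> f x \<in> A) \<Longrightarrow> prod f X \<in> A"
  by (induction X rule: infinite_finite_induct) (auto intro: subring_ofD)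

definition coeffs_in :: "'a::comm_ring_1 set \<Rightarrow> 'a poly \<Rightarrow> bool" where
  "coeffs_in A f \<longleftrightarrow> (\<forall>i. coeff f i \<in> A)"

lemma coeffs_inD: "coeffs_in A f \<Longrightarrow> coeff f i \<in> A"
  by (simp add: coeffs_in_def)

context
  fixes A :: "'a::comm_ring_1 set"
  assumes A: "subring_of A"
begin

lemma coeffs_in_0: "coeffs_in A 0"
  using A by (auto simp: coeffs_in_def intro: subring_ofD)

lemma coeffs_in_pCons: "a \<in> A \<Longrightarrow> coeffs_in A f \<Longrightarrow> coeffs_in A (pCons a f)"
  by (auto simp: coeffs_in_def coeff_pCons split: nat.split)

lemma coeffs_in_const: "a \<in> A \<Longrightarrow> coeffs_in A [:a:]"
  by (intro coeffs_in_pCons coeffs_in_0)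

lemma coeffs_in_monom: "a \<in> A \<Longrightarrow> coeffs_in A (monom a n)"
  using A by (auto simp: coeffs_in_def intro: subring_ofD)

lemma coeffs_in_add: "coeffs_in A f \<Longrightarrow> coeffs_in A g \<Longrightarrow> coeffs_in A (f + g)"
  using A by (auto simp: coeffs_in_def intro: subring_ofD)

lemma coeffs_in_diff: "coeffs_in A f \<Longrightarrow> coeffs_in A g \<Longrightarrow> coeffs_in A (f - g)"
  using A by (auto simp: coeffs_in_def intro: subring_ofD)

lemma coeffs_in_uminus: "coeffs_in A f \<Longrightarrow> coeffs_in A (- f)"
  using A by (auto simp: coeffs_in_def intro: subring_ofD)

lemma coeffs_in_smult: "a \<in> A \<Longrightarrow> coeffs_in A f \<Longrightarrow> coeffs_in A (smult a f)"
  using A by (auto simp: coeffs_in_def intro: subring_ofD)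

lemma coeffs_in_mult: "coeffs_in A f \<Longrightarrow> coeffs_in A g \<Longrightarrow> coeffs_in A (f * g)"
  using A by (auto simp: coeffs_in_def coeff_mult intro!: subring_of_sum subring_ofD(4))

lemma coeffs_in_sum: "(\<And>x. x \<in> X \<Longrightarrow> coeffs_in A (f x)) \<Longrightarrow> coeffs_in A (sum f X)"
  by (induction X rule: infinite_finite_induct) (auto intro: coeffs_in_0 coeffs_in_add)

lemma coeffs_in_cutoff: "coeffs_in A f \<Longrightarrow> coeffs_in A (poly_cutoff n f)"
  using A by (auto simp: coeffs_in_def coeff_poly_cutoff intro: subring_ofD)

lemmas coeffs_in_intros = coeffs_in_0 coeffs_in_pCons coeffs_in_monom coeffs_in_add
  coeffs_in_diff coeffs_in_smult coeffs_in_mult coeffs_in_sum coeffs_in_cutoff coeffs_in_uminus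

end

text \<open>The ring \<open>A[x]\<close> inside the ambient type. As \<open>x\<close> may be
  algebraic over \<open>A\<close>, an element can have many representing polynomials; all degree
  arguments concern representatives.\<close>

definition adjoin :: "'a::comm_ring_1 set \<Rightarrow> 'a \<Rightarrow> 'a set" where
  "adjoin A x = {poly f x |f. coeffs_in A f}"

lemma adjoinI: "coeffs_in A f \<Longrightarrow> poly f x \<in> adjoin A x"
  by (auto simp: adjoin_def)

lemma subset_adjoin: "subring_of A \<Longrightarrow> A \<subseteq> adjoin A x"
  using adjoinI[OF coeffs_in_const] by fastforce

lemma adjoin_self: "subring_of A \<Longrightarrow> x \<in> adjoin A x"
  using adjoinI[of A "[:0, 1:]" x] by (auto intro: coeffs_in_intros subring_ofD)

lemma subring_of_adjoin: assumes "subring_of A" shows "subring_of (adjoin A x)"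
  unfolding subring_of_def
proof (intro conjI ballI)
  show "1 \<in> adjoin A x" using subset_adjoin[OF assms] subring_ofD(1)[OF assms] by auto
  fix a b assume "a \<in> adjoin A x" "b \<in> adjoin A x"
  then obtain f g where fg: "a = poly f x" "b = poly g x" "coeffs_in A f" "coeffs_in A g"
    by (auto simp: adjoin_def)
  show "a + b \<in> adjoin A x" using adjoinI[OF coeffs_in_add[OF assms fg(3,4)]] fg by simp
  show "a * b \<in> adjoin A x" using adjoinI[OF coeffs_in_mult[OF assms fg(3,4)]] fg by simp
  show "- a \<in> adjoin A x" using adjoinI[OF coeffs_in_uminus[OF assms fg(3)]] fg by simp
qed

section \<open>The Hilbert basis theorem\<close>

definition ideal_in :: "'a::comm_ring_1 set \<Rightarrow> 'a set \<Rightarrow> bool" where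
  "ideal_in A J \<longleftrightarrow> J \<subseteq> A \<and> 0 \<in> J \<and> (\<forall>x\<in>J. \<forall>y\<in>J. x + y \<in> J) \<and> (\<forall>a\<in>A. \<forall>x\<in>J. a * x \<in> J)"

lemma ideal_inD:
  assumes "ideal_in A J"
  shows "J \<subseteq> A" "0 \<in> J" "x \<in> J \<Longrightarrow> y \<in> J \<Longrightarrow> x + y \<in> J" "a \<in> A \<Longrightarrow> x \<in> J \<Longrightarrow> a * x \<in> J"
  using assms by (auto simp: ideal_in_def)

lemma ideal_in_sum: "ideal_in A J \<Longrightarrow> (\<And>x. x \<in> X \<Longrightarrow> f x \<in> J) \<Longrightarrow> sum f X \<in> J"
  by (induction X rule: infinite_finite_induct) (auto intro: ideal_inD)

definition combinations :: "'a::comm_ring_1 set \<Rightarrow> 'a set \<Rightarrow> 'a set" where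
  "combinations A X = {\<Sum>x\<in>X. u x * x |u. \<forall>x\<in>X. u x \<in> A}"

definition noetherian_subring :: "'a::comm_ring_1 set \<Rightarrow> bool" where
  "noetherian_subring A \<longleftrightarrow> (\<forall>J. ideal_in A J \<longrightarrow> (\<exists>X\<subseteq>J. finite X \<and> J \<subseteq> combinations A X))"

lemma combinations_add:
  assumes "subring_of A" "x \<in> combinations A X" "y \<in> combinations A X"
  shows "x + y \<in> combinations A X"
proof -
  obtain u v where "x = (\<Sum>z\<in>X. u z * z)" "y = (\<Sum>z\<in>X. v z * z)" "\<forall>z\<in>X. u z \<in> A" "\<forall>z\<in>X. v z \<in> A"
    using assms(2,3) by (auto simp: combinations_def)
  then show ?thesis using subring_ofD(3)[OF assms(1)]
    by (auto simp: combinations_def distrib_right sum.distrib intro!: exI[of _ "\<lambda>z. u z + v z"])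
qed

lemma combinations_scale:
  assumes "subring_of A" "a \<in> A" "x \<in> combinations A X"
  shows "a * x \<in> combinations A X"
proof -
  obtain u where "x = (\<Sum>z\<in>X. u z * z)" "\<forall>z\<in>X. u z \<in> A"
    using assms(3) by (auto simp: combinations_def)
  then show ?thesis using subring_ofD(4)[OF assms(1,2)]
    by (auto simp: combinations_def sum_distrib_left mult.assoc intro!: exI[of _ "\<lambda>z. a * u z"])
qed

lemma combinations_base:
  assumes "subring_of A" "finite X" "x \<in> X"
  shows "x \<in> combinations A X"
proof -
  have "x = (\<Sum>z\<in>X. (if z = x then 1 else 0) * z)"
    using assms(2,3) by (simp add: if_distrib[of "\<lambda>c. c * _"] sum.delta cong: if_cong)
  then show ?thesis using subring_ofD(1,2)[OF assms(1)]
    unfolding combinations_def by (intro CollectI exI[of _ "\<lambda>z. if z = x then 1 else 0"]) auto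
qed

lemma combinations_0: "subring_of A \<Longrightarrow> 0 \<in> combinations A X"
  by (auto simp: combinations_def intro!: exI[of _ "\<lambda>_. 0"] subring_ofD)

lemma combinations_sum:
  "subring_of A \<Longrightarrow> (\<And>x. x \<in> Y \<Longrightarrow> f x \<in> combinations A X) \<Longrightarrow> sum f Y \<in> combinations A X"
  by (induction Y rule: infinite_finite_induct) (auto intro: combinations_0 combinations_add)

lemma combinations_subset: "ideal_in A J \<Longrightarrow> X \<subseteq> J \<Longrightarrow> combinations A X \<subseteq> J"
  by (auto simp: combinations_def intro!: ideal_in_sum ideal_inD(4))

text \<open>Hilbert's argument with leading coefficients, applied to all polynomials that represent
  elements of \<open>J\<close>.\<close>

lemma noetherian_adjoin:
  assumes A: "subring_of A" and noeth: "noetherian_subring A"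
  shows "noetherian_subring (adjoin A x)"
  unfolding noetherian_subring_def
proof (intro allI impI)
  let ?B = "adjoin A x"
  fix J assume J: "ideal_in ?B J"
  \<comment> \<open>The coefficient at \<open>d\<close> may be zero. Thus \<open>L d\<close> is
    closed under addition, and multiplication by \<open>x\<close> gives
    \<open>L d \<subseteq> L (Suc d)\<close>.\<close>
  define L where "L d = {coeff f d |f. coeffs_in A f \<and> (\<forall>i>d. coeff f i = 0) \<and> poly f x \<in> J}" for d
  have L: "ideal_in A (L d)" for d
    unfolding ideal_in_def
  proof (intro conjI ballI)
    show "L d \<subseteq> A" by (auto simp: L_def coeffs_in_def)
    show "0 \<in> L d" using ideal_inD(2)[OF J] coeffs_in_0[OF A]
      by (auto simp: L_def intro!: exI[of _ 0])
  next
    fix a b assume "a \<in> L d" "b \<in> L d"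
    then obtain f g where "a = coeff f d" "b = coeff g d" "coeffs_in A f" "coeffs_in A g"
      "\<forall>i>d. coeff f i = 0" "\<forall>i>d. coeff g i = 0" "poly f x \<in> J" "poly g x \<in> J"
      by (auto simp: L_def)
    then show "a + b \<in> L d" using coeffs_in_add[OF A] ideal_inD(3)[OF J]
      by (auto simp: L_def intro!: exI[of _ "f + g"])
  next
    fix c a assume c: "c \<in> A" and "a \<in> L d"
    then obtain f where "a = coeff f d" "coeffs_in A f" "\<forall>i>d. coeff f i = 0" "poly f x \<in> J"
      by (auto simp: L_def)
    moreover have "c \<in> ?B" using c subset_adjoin[OF A] by auto
    ultimately show "c * a \<in> L d" using c coeffs_in_smult[OF A] ideal_inD(4)[OF J]
      by (auto simp: L_def intro!: exI[of _ "smult c f"])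
  qed
  have L_Suc: "L d \<subseteq> L (Suc d)" for d
  proof
    fix a assume "a \<in> L d"
    then obtain f where "a = coeff f d" "coeffs_in A f" "\<forall>i>d. coeff f i = 0" "poly f x \<in> J"
      by (auto simp: L_def)
    moreover have "x * poly f x \<in> J"
      using calculation ideal_inD(4)[OF J adjoin_self[OF A]] by auto
    ultimately show "a \<in> L (Suc d)" using coeffs_in_pCons[OF A subring_ofD(2)[OF A]]
      by (auto simp: L_def coeff_pCons intro!: exI[of _ "pCons 0 f"] split: nat.split)
  qed
  have L_mono: "d \<le> e \<Longrightarrow> L d \<subseteq> L e" for d e
    using lift_Suc_mono_le[of L d e] L_Suc by blast
  have "ideal_in A (\<Union>d. L d)"
    unfolding ideal_in_def
  proof (intro conjI ballI)
    show "(\<Union>d. L d) \<subseteq> A" "0 \<in> (\<Union>d. L d)" using ideal_inD(1,2)[OF L] by auto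
    fix a b assume "a \<in> (\<Union>d. L d)" "b \<in> (\<Union>d. L d)"
    then obtain d e where "a \<in> L d" "b \<in> L e" by auto
    then have "a \<in> L (max d e)" "b \<in> L (max d e)" using L_mono by (meson max.cobounded1 max.cobounded2 subsetD)+
    then show "a + b \<in> (\<Union>d. L d)" using ideal_inD(3)[OF L] by auto
  next
    fix c a assume "c \<in> A" "a \<in> (\<Union>d. L d)"
    then show "c * a \<in> (\<Union>d. L d)" using ideal_inD(4)[OF L] by auto
  qed
  then obtain X where X: "X \<subseteq> (\<Union>d. L d)" "finite X" "(\<Union>d. L d) \<subseteq> combinations A X"
    using noeth by (auto simp: noetherian_subring_def)
  have "\<exists>D. X \<subseteq> L D"
    using X(2,1)
  proof (induction X rule: finite_induct)
    case (insert y X)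
    then obtain D d where "X \<subseteq> L D" "y \<in> L d" by auto
    then have "insert y X \<subseteq> L (max D d)" using L_mono[of D "max D d"] L_mono[of d "max D d"] by auto
    then show ?case by blast
  qed simp
  then obtain D where D: "X \<subseteq> L D" by blast
  \<comment> \<open>Finitely many generators of the union all occur at stage \<open>D\<close>, so
    the increasing chain is constant from there on.\<close>
  then have LD: "L d \<subseteq> L D" for d
    using X(3) combinations_subset[OF L D] by blast
  have "\<forall>d. \<exists>Y\<subseteq>L d. finite Y \<and> L d \<subseteq> combinations A Y"
    using noeth L by (auto simp: noetherian_subring_def)
  then obtain Y where Y: "\<And>d. Y d \<subseteq> L d" "\<And>d. finite (Y d)" "\<And>d. L d \<subseteq> combinations A (Y d)"
    by metis
  have "\<forall>d a. \<exists>f. a \<in> L d \<longrightarrow> coeffs_in A f \<and> (\<forall>i>d. coeff f i = 0) \<and> poly f x \<in> J \<and> coeff f d = a"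
    by (auto simp: L_def)
  then obtain F where F: "\<And>d a. a \<in> L d \<Longrightarrow> coeffs_in A (F d a)"
    "\<And>d a i. a \<in> L d \<Longrightarrow> i > d \<Longrightarrow> coeff (F d a) i = 0"
    "\<And>d a. a \<in> L d \<Longrightarrow> poly (F d a) x \<in> J" "\<And>d a. a \<in> L d \<Longrightarrow> coeff (F d a) d = a"
    by metis
  \<comment> \<open>Degrees above \<open>D\<close> need no generators of their own: those of degree
    \<open>D\<close> are multiplied by powers of \<open>x\<close>.\<close>
  define G where "G = (\<Union>d\<in>{..D}. (\<lambda>a. poly (F d a) x) ` Y d)"
  have G: "G \<subseteq> J" "finite G" using F(3) Y(1,2) by (auto simp: G_def)
  note B = subring_of_adjoin[OF A, of x]
  \<comment> \<open>The number \<open>d\<close> is a strict degree bound, so the induction starts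
    with the zero polynomial.\<close>
  have red: "poly f x \<in> combinations ?B G"
    if "coeffs_in A f" "\<forall>i\<ge>d. coeff f i = 0" "poly f x \<in> J" for d f
    using that
  proof (induction d arbitrary: f)
    case 0
    then have "f = 0" by (auto simp: poly_eq_iff)
    then show ?case using combinations_0[OF B] by simp
  next
    case (Suc d)
    define e where "e = min d D"
    have "coeff f d \<in> L d" using Suc.prems by (auto simp: L_def Suc_le_eq)
    then have "coeff f d \<in> L e" using LD by (auto simp: e_def min_def)
    then obtain u where u: "coeff f d = (\<Sum>b\<in>Y e. u b * b)" "\<forall>b\<in>Y e. u b \<in> A"
      using Y(3)[of e] by (auto simp: combinations_def)
    define h where "h = (\<Sum>b\<in>Y e. monom (u b) (d - e) * F e b)"
    have bL: "b \<in> L e" if "b \<in> Y e" for b using Y(1) that by auto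
    have ed: "e \<le> d" "e \<le> D" by (auto simp: e_def)
    have h_in: "coeffs_in A h"
      unfolding h_def using u(2) F(1) bL by (intro coeffs_in_intros[OF A]) auto
    have h_zero: "coeff h i = 0" if "i > d" for i
      unfolding h_def using that F(2) bL ed
      by (auto simp: coeff_sum coeff_monom_mult intro!: sum.neutral)
    have h_d: "coeff h d = coeff f d"
      unfolding h_def u(1) using F(4) bL ed by (auto simp: coeff_sum coeff_monom_mult intro!: sum.cong)
    have hx: "poly h x = (\<Sum>b\<in>Y e. (u b * x ^ (d - e)) * poly (F e b) x)"
      by (simp add: h_def poly_sum poly_monom)
    have ux: "u b * x ^ (d - e) \<in> ?B" if "b \<in> Y e" for b
      using u(2) that subset_adjoin[OF A] adjoin_self[OF A] B by (auto intro!: subring_ofD(4,7))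
    have hJ: "poly h x \<in> J"
      unfolding hx using ux F(3) bL by (intro ideal_in_sum[OF J] ideal_inD(4)[OF J]) auto
    have "(u b * x ^ (d - e)) * poly (F e b) x \<in> combinations ?B G" if "b \<in> Y e" for b
      using that ux ed G(2) by (intro combinations_scale[OF B] combinations_base[OF B]) (auto simp: G_def)
    then have hG: "poly h x \<in> combinations ?B G"
      unfolding hx by (intro combinations_sum[OF B])
    have "poly (f - h) x = poly f x + (- 1) * poly h x" by simp
    also have "\<dots> \<in> J"
      using Suc.prems(3) hJ B by (intro ideal_inD(3,4)[OF J] subring_ofD(1,5)) auto
    finally have "poly (f - h) x \<in> J" .
    moreover have "coeff (f - h) i = 0" if "i \<ge> d" for i
      using that Suc.prems(2) h_d h_zero[of i] by (cases "i = d") auto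
    ultimately have "poly (f - h) x \<in> combinations ?B G"
      using Suc.prems(1) h_in by (intro Suc.IH coeffs_in_diff[OF A]) auto
    then have "poly (f - h) x + poly h x \<in> combinations ?B G"
      using hG by (intro combinations_add[OF B])
    then show ?case by simp
  qed
  have "J \<subseteq> combinations ?B G"
  proof
    fix y assume "y \<in> J"
    then obtain f where "y = poly f x" "coeffs_in A f" "poly f x \<in> J"
      using ideal_inD(1)[OF J] by (auto simp: adjoin_def)
    then show "y \<in> combinations ?B G"
      using red[of f "Suc (degree f)"] by (auto simp: coeff_eq_0)
  qed
  then show "\<exists>X\<subseteq>J. finite X \<and> J \<subseteq> combinations ?B X" using G by blast
qed

section \<open>Zariski's lemma\<close>

text \<open>The number \<open>u\<close> is the degree of \<open>f\<close> over the quotient by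
  \<open>M\<close>. The quotient is never formed; coefficients are read modulo
  \<open>M\<close>.\<close>

definition top_mod :: "'a::comm_ring_1 set \<Rightarrow> 'a poly \<Rightarrow> nat \<Rightarrow> bool" where
  "top_mod M f u \<longleftrightarrow> coeff f u \<notin> M \<and> (\<forall>i>u. coeff f i \<in> M)"

lemma top_mod_exists:
  assumes "rmod.subspace M" "coeff f i \<notin> M"
  obtains u where "top_mod M f u"
proof -
  let ?S = "{i. coeff f i \<notin> M}"
  have "?S \<subseteq> {..degree f}"
    using rmod.subspace_0[OF assms(1)] by (auto intro!: le_degree)
  then have fin: "finite ?S" by (rule finite_subset) simp
  have "Max ?S \<in> ?S" using fin assms(2) by (intro Max_in) auto
  moreover have "coeff f i \<in> M" if "i > Max ?S" for i
    using Max_ge[OF fin, of i] that leD by blast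
  ultimately show ?thesis using that[of "Max ?S"] unfolding top_mod_def by blast
qed

text \<open>The quotient by a prime is a domain, so degrees add: in the coefficient at
  \<open>u + v\<close> every term but one has a factor in \<open>M\<close>.\<close>

lemma top_mod_mult:
  assumes M: "prime_id M" and f: "top_mod M f u" and g: "top_mod M g v"
  shows "top_mod M (f * g) (u + v)"
proof -
  note Ms = prime_id_subspace[OF M]
  have out: "coeff f i * coeff g (k - i) \<in> M" if "i \<le> k" "k \<ge> u + v" "i \<noteq> u \<or> k \<noteq> u + v" for i k
  proof (cases "i > u")
    case True
    then show ?thesis using f M by (auto simp: top_mod_def prime_id_mult_iff)
  next
    case False
    then have "k - i > v" using that by auto
    then show ?thesis using g M by (auto simp: top_mod_def prime_id_mult_iff)
  qed
  have "coeff (f * g) (u + v) = (\<Sum>i\<in>{..u+v} - {u}. coeff f i * coeff g (u + v - i)) + coeff f u * coeff g v"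
    by (simp add: coeff_mult sum.remove[of "{..u+v}" u])
  moreover have "(\<Sum>i\<in>{..u+v} - {u}. coeff f i * coeff g (u + v - i)) \<in> M"
    by (intro rmod.subspace_sum[OF Ms] out) auto
  moreover have "coeff f u * coeff g v \<notin> M"
    using M f g by (auto simp: top_mod_def prime_id_mult_iff)
  ultimately have "coeff (f * g) (u + v) \<notin> M"
    using rmod.subspace_diff[OF Ms] by (metis add_diff_cancel_left')
  moreover have "coeff (f * g) k \<in> M" if "k > u + v" for k
    unfolding coeff_mult using that by (intro rmod.subspace_sum[OF Ms] out) auto
  ultimately show ?thesis by (simp add: top_mod_def)
qed

lemma coeffs_mult_mod:
  assumes "rmod.subspace M" "\<And>i. coeff f i \<in> M"
  shows "coeff (f * g) i \<in> M"
  unfolding coeff_mult using assms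
  by (intro rmod.subspace_sum) (auto simp: mult.commute[of "coeff f _"] intro: rmod.subspace_scale)

lemma poly_mod:
  assumes "rmod.subspace M" "\<And>i. coeff f i \<in> M"
  shows "poly f x \<in> M"
  unfolding poly_altdef using assms
  by (intro rmod.subspace_sum) (auto simp: mult.commute[of "coeff f _"] intro: rmod.subspace_scale)

text \<open>Pseudo-division needs coefficients that really vanish above \<open>u\<close>. Those
  dropped lie in \<open>M\<close>, so the value changes only by an element of
  \<open>M\<close>.\<close>

lemma top_mod_truncate:
  assumes A: "subring_of A" and M: "rmod.subspace M" and f: "coeffs_in A f" "top_mod M f u"
  obtains g where "coeffs_in A g" "coeff g u \<notin> M" "\<And>i. i > u \<Longrightarrow> coeff g i = 0"
    "poly f x - poly g x \<in> M"
proof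
  let ?g = "poly_cutoff (Suc u) f"
  show "coeffs_in A ?g" by (intro coeffs_in_cutoff A f)
  show "coeff ?g u \<notin> M" using f by (simp add: coeff_poly_cutoff top_mod_def)
  show "\<And>i. i > u \<Longrightarrow> coeff ?g i = 0" by (simp add: coeff_poly_cutoff)
  have "coeff (f - ?g) i \<in> M" for i
    using f(2) rmod.subspace_0[OF M] by (auto simp: coeff_poly_cutoff top_mod_def)
  then show "poly f x - poly ?g x \<in> M" using poly_mod[OF M, of "f - ?g"] by simp
qed

text \<open>The leading coefficient need not be invertible, so each division step is paid for by a
  factor \<open>coeff f t\<close>.\<close>

lemma pseudo_division_in:
  assumes A: "subring_of A" and h: "coeffs_in A h" and f: "coeffs_in A f" "\<And>i. i > t \<Longrightarrow> coeff f i = 0"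
  obtains L q r where "coeffs_in A q" "coeffs_in A r" "\<And>i. i \<ge> t \<Longrightarrow> coeff r i = 0"
    "smult (coeff f t ^ L) h = q * f + r"
proof -
  have "\<exists>L q r. coeffs_in A q \<and> coeffs_in A r \<and> (\<forall>i\<ge>t. coeff r i = 0) \<and>
      smult (coeff f t ^ L) h = q * f + r" if "\<forall>i\<ge>D. coeff h i = 0" for D
    using that h
  proof (induction D arbitrary: h)
    case 0
    then show ?case
      by (intro exI[of _ 0] exI[of _ "0::'a poly"] exI[of _ h]) (simp add: coeffs_in_0[OF A])
  next
    case (Suc D)
    show ?case
    proof (cases "D < t")
      case True
      then show ?thesis using Suc.prems
        by (intro exI[of _ 0] exI[of _ "0::'a poly"] exI[of _ h]) (auto simp: coeffs_in_0[OF A])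
    next
      case False
      let ?m = "monom (coeff h D) (D - t)"
      let ?h = "smult (coeff f t) h - ?m * f"
      have m: "coeffs_in A ?m" using Suc.prems by (intro coeffs_in_monom A coeffs_inD)
      have "coeff ?h i = 0" if "i \<ge> D" for i
        using that False Suc.prems(1) f(2)[of "i - (D - t)"]
        by (cases "i = D") (auto simp: coeff_monom_mult)
      moreover have "coeffs_in A ?h"
        using Suc.prems(2) f(1) m by (intro coeffs_in_intros[OF A] coeffs_inD)
      ultimately obtain L q r where IH: "coeffs_in A q" "coeffs_in A r" "\<forall>i\<ge>t. coeff r i = 0"
        "smult (coeff f t ^ L) ?h = q * f + r"
        using Suc.IH[of ?h] by blast
      have "smult (coeff f t ^ Suc L) h = (q + smult (coeff f t ^ L) ?m) * f + r"
        using IH(4) by (simp add: smult_diff_right algebra_simps)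
      moreover have "coeffs_in A (q + smult (coeff f t ^ L) ?m)"
        using IH(1) m coeffs_inD[OF f(1)] by (intro coeffs_in_add[OF A] coeffs_in_smult[OF A] subring_ofD(7)[OF A])
      ultimately show ?thesis using IH by blast
    qed
  qed
  from this[of "Suc (degree h)"] show ?thesis using that by (auto simp: coeff_eq_0)
qed

lemma poly_eq_const:
  assumes "\<And>i. i > 0 \<Longrightarrow> coeff f i = 0"
  shows "poly f x = coeff f 0"
proof -
  have "f = [:coeff f 0:]" using assms by (intro poly_eqI) (auto simp: coeff_pCons split: nat.split)
  from arg_cong[OF this, of "\<lambda>p. poly p x"] show ?thesis by simp
qed

text \<open>The domain \<open>A / (A \<inter> M)\<close> becomes a field after inverting one element.\<close>

definition almost_field_mod :: "'a::comm_ring_1 set \<Rightarrow> 'a set \<Rightarrow> bool" where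
  "almost_field_mod M A \<longleftrightarrow> (\<exists>g\<in>A - M. \<forall>b\<in>A - M. \<exists>r\<in>A. \<exists>N. g ^ N - r * b \<in> M)"

text \<open>If \<open>x\<close> were transcendental modulo \<open>M\<close>, then \<open>1 + x g\<close> would be a nonconstant unit of a
  polynomial ring over a domain, as it divides a power of \<open>g\<close> and is coprime to \<open>g\<close>.\<close>

lemma algebraic_if_almost_field_adjoin:
  assumes M: "prime_id M" and A: "subring_of A" and fld: "almost_field_mod M (adjoin A x)"
  shows "\<exists>p i. coeffs_in A p \<and> poly p x \<in> M \<and> coeff p i \<notin> M"
proof (rule ccontr)
  note Ms = prime_id_subspace[OF M]
  assume "\<not> ?thesis"
  then have trans: "coeff p i \<in> M" if "coeffs_in A p" "poly p x \<in> M" for p i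
    using that by blast
  note B = subring_of_adjoin[OF A, of x]
  obtain g where g: "g \<in> adjoin A x" "g \<notin> M"
    and inv: "\<And>b. b \<in> adjoin A x \<Longrightarrow> b \<notin> M \<Longrightarrow> \<exists>r\<in>adjoin A x. \<exists>N. g ^ N - r * b \<in> M"
    using fld by (auto simp: almost_field_mod_def)
  obtain \<gamma> where \<gamma>: "coeffs_in A \<gamma>" "g = poly \<gamma> x" using g by (auto simp: adjoin_def)
  let ?b = "1 + pCons 0 \<gamma>"
  have one: "coeffs_in A 1" using coeffs_in_const[OF A subring_ofD(1)[OF A]] by (simp add: one_pCons)
  have b: "coeffs_in A ?b"
    using \<gamma> one by (intro coeffs_in_intros[OF A] subring_ofD(2)[OF A])
  have "poly ?b x \<notin> M"
  proof
    assume "poly ?b x \<in> M"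
    then have "coeff ?b 0 \<in> M" using trans b by blast
    then show False using M by (simp add: prime_id_def)
  qed
  then obtain r N where r: "r \<in> adjoin A x" "g ^ N - r * poly ?b x \<in> M"
    using inv adjoinI[OF b] by blast
  obtain \<rho> where \<rho>: "coeffs_in A \<rho>" "r = poly \<rho> x" using r by (auto simp: adjoin_def)
  have "\<exists>\<tau>. coeffs_in A \<tau> \<and> poly (\<gamma> ^ N - \<tau> * ?b) x \<in> M"
    using r(2) \<rho> \<gamma> by (intro exI[of _ \<rho>]) (simp add: poly_power)
  then have "\<exists>\<tau>. coeffs_in A \<tau> \<and> poly (1 - \<tau> * ?b) x \<in> M"
  proof (induction N)
    case (Suc N)
    then obtain \<tau> where \<tau>: "coeffs_in A \<tau>" "poly (\<gamma> ^ Suc N - \<tau> * ?b) x \<in> M" by blast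
    \<comment> \<open>Here coprimality enters: with \<open>?b = 1 + X \<gamma>\<close> one has
      \<open>\<gamma>^N = \<gamma>^N ?b - X \<gamma>^(N+1)\<close>, so divisibility by
      \<open>?b\<close> descends from \<open>\<gamma>^(N+1)\<close> to \<open>\<gamma>^N\<close> and
      finally to 1.\<close>
    let ?\<tau> = "\<gamma> ^ N - pCons 0 \<tau>"
    have "poly (\<gamma> ^ N - ?\<tau> * ?b) x = - x * poly (\<gamma> ^ Suc N - \<tau> * ?b) x"
      by (simp add: algebra_simps)
    also have "\<dots> \<in> M" by (rule rmod.subspace_scale[OF Ms \<tau>(2)])
    finally have "poly (\<gamma> ^ N - ?\<tau> * ?b) x \<in> M" .
    moreover have "coeffs_in A (\<gamma> ^ N)"
      using \<gamma>(1) one by (induction N) (auto intro: coeffs_in_intros[OF A])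
    then have "coeffs_in A ?\<tau>" using \<tau> by (intro coeffs_in_intros[OF A] subring_ofD(2)[OF A])
    ultimately show ?case using Suc.IH by blast
  qed simp
  then obtain \<tau> where \<tau>: "coeffs_in A \<tau>" "poly (1 - \<tau> * ?b) x \<in> M" by blast
  have cong: "coeff (1 - \<tau> * ?b) i \<in> M" for i
    by (intro trans[OF coeffs_in_diff[OF A one coeffs_in_mult[OF A \<tau>(1) b]]] \<tau>(2))
  obtain u where "coeff \<gamma> u \<notin> M"
    using poly_mod[OF Ms, of \<gamma> x] g(2) \<gamma>(2) by blast
  then obtain u where u: "top_mod M \<gamma> u" using top_mod_exists[OF Ms] by blast
  then have bu: "top_mod M ?b (Suc u)"
    by (auto simp: top_mod_def coeff_pCons split: nat.split)
  have "\<exists>i. coeff \<tau> i \<notin> M"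
  proof (rule ccontr)
    assume "\<nexists>i. coeff \<tau> i \<notin> M"
    then have "coeff (\<tau> * ?b) 0 \<in> M" by (intro coeffs_mult_mod[OF Ms]) auto
    from rmod.subspace_add[OF Ms cong[of 0] this] show False using M by (simp add: prime_id_def)
  qed
  then obtain v where v: "top_mod M \<tau> v" using top_mod_exists[OF Ms] by blast
  \<comment> \<open>The product has the positive degree \<open>v + u + 1\<close> modulo
    \<open>M\<close>, although it should be congruent to 1.\<close>
  have "coeff (\<tau> * ?b) (v + Suc u) \<notin> M" using top_mod_mult[OF M v bu] by (simp add: top_mod_def)
  moreover have "coeff (1 - \<tau> * ?b) (v + Suc u) = - coeff (\<tau> * ?b) (v + Suc u)"
    by simp
  ultimately show False using cong[of "v + Suc u"] rmod.subspace_neg[OF Ms] by fastforce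
qed

text \<open>Let \<open>a\<close> be the leading coefficient of a polynomial of least degree
  \<open>m\<close> that vanishes at \<open>x\<close> modulo \<open>M\<close>. Some \<open>c\<close>
  in \<open>A\<close>, not in \<open>M\<close>, is a multiple of \<open>g\<close> modulo
  \<open>M\<close>. If \<open>g^N = r b\<close>, then \<open>c^N\<close> is \<open>b\<close> times
  an element of \<open>A[x]\<close>; reducing that element by the minimal polynomial and comparing
  constant terms shows that \<open>b\<close> divides \<open>a^L c^N\<close> in \<open>A\<close>
  modulo \<open>M\<close>.\<close>

lemma almost_field_mod_adjoinD:
  assumes M: "prime_id M" and A: "subring_of A" and fld: "almost_field_mod M (adjoin A x)"
  shows "almost_field_mod M A"
proof -
  let ?B = "adjoin A x"
  note Ms = prime_id_subspace[OF M] and B = subring_of_adjoin[OF A, of x]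
  obtain g where g: "g \<in> ?B" "g \<notin> M"
    and inv: "\<And>b. b \<in> ?B \<Longrightarrow> b \<notin> M \<Longrightarrow> \<exists>r\<in>?B. \<exists>N. g ^ N - r * b \<in> M"
    using fld by (auto simp: almost_field_mod_def)
  obtain \<gamma> where \<gamma>: "coeffs_in A \<gamma>" "g = poly \<gamma> x" using g by (auto simp: adjoin_def)
  define P where "P m \<longleftrightarrow> (\<exists>p. coeffs_in A p \<and> poly p x \<in> M \<and> top_mod M p m)" for m
  define m where "m = (LEAST m. P m)"
  obtain p0 i where p0: "coeffs_in A p0" "poly p0 x \<in> M" "coeff p0 i \<notin> M"
    using algebraic_if_almost_field_adjoin[OF assms] by blast
  moreover obtain u where "top_mod M p0 u" using top_mod_exists[OF Ms p0(3)] by blast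
  ultimately have "\<exists>m. P m" by (auto simp: P_def)
  then have "P m" unfolding m_def by (rule LeastI_ex)
  then obtain p1 where p1: "coeffs_in A p1" "poly p1 x \<in> M" "top_mod M p1 m" by (auto simp: P_def)
  obtain p where p: "coeffs_in A p" "coeff p m \<notin> M" "\<And>i. i > m \<Longrightarrow> coeff p i = 0"
    and "poly p1 x - poly p x \<in> M"
    using top_mod_truncate[OF A Ms p1(1,3)] by blast
  from rmod.subspace_diff[OF Ms p1(2) this(4)] have px: "poly p x \<in> M" by simp
  have min: "coeff f i \<in> M" if "coeffs_in A f" "poly f x \<in> M" "\<And>i. i \<ge> m \<Longrightarrow> coeff f i \<in> M" for f i
  proof (rule ccontr)
    assume "coeff f i \<notin> M"
    then obtain u where u: "top_mod M f u" using top_mod_exists[OF Ms] by blast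
    then have "P u" using that by (auto simp: P_def)
    then have "m \<le> u" unfolding m_def by (rule Least_le)
    then have "coeff f u \<in> M" by (rule that(3))
    then show False using u unfolding top_mod_def by simp
  qed
  let ?a = "coeff p m"
  have aA: "?a \<in> A" by (rule coeffs_inD[OF p(1)])
  have "m > 0"
  proof (rule ccontr)
    assume "\<not> m > 0"
    then show False using px p(2,3) poly_eq_const[of p x] by auto
  qed
  \<comment> \<open>To find \<open>c\<close>, take a multiple of \<open>g\<close> represented by a
    polynomial \<open>f\<close> of least degree \<open>t\<close>; the point is that
    \<open>t = 0\<close>. Such \<open>f\<close> exist because \<open>p\<close> represents the zero
    multiple.\<close>
  define T where "T t \<longleftrightarrow> (\<exists>f. coeffs_in A f \<and> top_mod M f t \<and> (\<exists>w\<in>?B. poly f x - w * g \<in> M))" for t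
  define t where "t = (LEAST t. T t)"
  have "T m" unfolding T_def using p px subring_ofD(2)[OF B] rmod.subspace_0[OF Ms]
    by (intro exI[of _ p]) (auto simp: top_mod_def intro!: bexI[of _ 0])
  then have "T t" unfolding t_def by (rule LeastI)
  then obtain f1 w where f1: "coeffs_in A f1" "top_mod M f1 t" "w \<in> ?B" "poly f1 x - w * g \<in> M"
    by (auto simp: T_def)
  obtain f where f: "coeffs_in A f" "coeff f t \<notin> M" "\<And>i. i > t \<Longrightarrow> coeff f i = 0"
    and "poly f1 x - poly f x \<in> M"
    using top_mod_truncate[OF A Ms f1(1,2)] by blast
  from rmod.subspace_diff[OF Ms f1(4) this(4)] have fx: "poly f x - w * g \<in> M" by simp
  have minT: "coeff h i \<in> M" if "coeffs_in A h" "v \<in> ?B" "poly h x - v * g \<in> M"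
    "\<And>i. i \<ge> t \<Longrightarrow> coeff h i = 0" for h v i
  proof (rule ccontr)
    assume "coeff h i \<notin> M"
    then obtain u where u: "top_mod M h u" using top_mod_exists[OF Ms] by blast
    then have "T u" using that by (auto simp: T_def)
    then have "t \<le> u" unfolding t_def by (rule Least_le)
    then have "coeff h u = 0" by (rule that(4))
    then show False using u rmod.subspace_0[OF Ms] unfolding top_mod_def by simp
  qed
  let ?c = "coeff f t"
  have cA: "?c \<in> A" by (rule coeffs_inD[OF f(1)])
  have powM: "?a ^ L \<notin> M" "?c ^ L \<notin> M" for L
    using M p(2) f(2) by (auto simp: prime_id_power_iff)
  have "t = 0"
  proof (rule ccontr)
    assume "t \<noteq> 0"
    \<comment> \<open>The pseudo-remainder by \<open>f\<close> again represents a multiple of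
      \<open>g\<close>, in degree below \<open>t\<close>, so the choice of \<open>t\<close> makes it
      vanish modulo \<open>M\<close>.\<close>
    have rem: "\<exists>L q r. coeffs_in A q \<and> (\<forall>i. coeff r i \<in> M) \<and> smult (?c ^ L) h = q * f + r"
      if h: "coeffs_in A h" "v \<in> ?B" "poly h x - v * g \<in> M" for h v
    proof -
      obtain q r L where qr: "coeffs_in A q" "coeffs_in A r" "\<And>i. i \<ge> t \<Longrightarrow> coeff r i = 0"
        "smult (?c ^ L) h = q * f + r"
        by (rule pseudo_division_in[where t = t, OF A h(1) f(1)], erule f(3), rule that)
      have "?c ^ L * poly h x = poly q x * poly f x + poly r x"
        using arg_cong[OF qr(4), of "\<lambda>p. poly p x"] by simp
      then have "poly r x - (?c ^ L * v - poly q x * w) * g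
          = ?c ^ L * (poly h x - v * g) - poly q x * (poly f x - w * g)"
        by (simp add: algebra_simps)
      also have "\<dots> \<in> M"
        by (rule rmod.subspace_diff[OF Ms rmod.subspace_scale[OF Ms h(3)] rmod.subspace_scale[OF Ms fx]])
      finally have "poly r x - (?c ^ L * v - poly q x * w) * g \<in> M" .
      moreover have "?c ^ L * v - poly q x * w \<in> ?B"
        using cA subset_adjoin[OF A, of x] h(2) f1(3) adjoinI[OF qr(1), of x]
        by (intro subring_ofD(4,6,7)[OF B]) auto
      ultimately have "coeff r i \<in> M" for i using qr by (intro minT) auto
      then show ?thesis using qr by blast
    qed
    \<comment> \<open>Dividing \<open>\<gamma>\<close> by \<open>f\<close> shows that
      \<open>f\<close> does not vanish at \<open>x\<close> modulo \<open>M\<close>; dividing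
      \<open>p\<close> by \<open>f\<close> then makes the quotient \<open>q\<close> vanish there. As
      \<open>q\<close> has degree at most \<open>m - t < m\<close>, this contradicts the choice of
      \<open>m\<close>.\<close>
    have "poly \<gamma> x - 1 * g \<in> M" using \<gamma>(2) rmod.subspace_0[OF Ms] by simp
    then obtain L q r where qr: "coeffs_in A q" "\<And>i. coeff r i \<in> M" "smult (?c ^ L) \<gamma> = q * f + r"
      using rem[OF \<gamma>(1) subring_ofD(1)[OF B]] by blast
    have fnM: "poly f x \<notin> M"
    proof
      assume "poly f x \<in> M"
      from rmod.subspace_add[OF Ms rmod.subspace_scale[OF Ms this] poly_mod[OF Ms qr(2)]]
      have "poly q x * poly f x + poly r x \<in> M" .
      then have "?c ^ L * g \<in> M"
        using arg_cong[OF qr(3), of "\<lambda>p. poly p x"] \<gamma>(2) by simp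
      then show False using powM g(2) M by (auto simp: prime_id_mult_iff)
    qed
    have "poly p x - 0 * g \<in> M" using px by simp
    then obtain L q r where qr: "coeffs_in A q" "\<And>i. coeff r i \<in> M" "smult (?c ^ L) p = q * f + r"
      using rem[OF p(1) subring_ofD(2)[OF B]] by blast
    have "?c ^ L * poly p x = poly q x * poly f x + poly r x"
      using arg_cong[OF qr(3), of "\<lambda>p. poly p x"] by simp
    then have "poly q x * poly f x = ?c ^ L * poly p x - poly r x" by simp
    also have "\<dots> \<in> M"
      by (rule rmod.subspace_diff[OF Ms rmod.subspace_scale[OF Ms px] poly_mod[OF Ms qr(2)]])
    finally have qx: "poly q x \<in> M" using fnM M by (auto simp: prime_id_mult_iff)
    have qf: "coeff (q * f) i = ?c ^ L * coeff p i - coeff r i" for i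
      using arg_cong[OF qr(3), of "\<lambda>p. coeff p i"] by simp
    have "\<exists>i. coeff q i \<notin> M"
    proof (rule ccontr)
      assume "\<nexists>i. coeff q i \<notin> M"
      then have "coeff (q * f) m \<in> M" by (intro coeffs_mult_mod[OF Ms]) auto
      from rmod.subspace_add[OF Ms this qr(2)[of m]] have "?c ^ L * ?a \<in> M"
        unfolding qf by simp
      then show False using powM p(2) M by (auto simp: prime_id_mult_iff)
    qed
    then obtain u where u: "top_mod M q u" using top_mod_exists[OF Ms] by blast
    have "top_mod M f t" using f rmod.subspace_0[OF Ms] by (auto simp: top_mod_def)
    then have "coeff (q * f) (u + t) \<notin> M"
      using top_mod_mult[OF M u] by (simp add: top_mod_def)
    moreover have "coeff (q * f) (u + t) \<in> M" if "u + t > m"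
      using p(3)[OF that] rmod.subspace_neg[OF Ms qr(2)[of "u + t"]] unfolding qf by simp
    ultimately have "u < m" using \<open>t \<noteq> 0\<close> by linarith
    then have small: "coeff q i \<in> M" if "i \<ge> m" for i
      using that u unfolding top_mod_def by simp
    have "coeff q u \<in> M" by (rule min[OF qr(1) qx small])
    then show False using u by (simp add: top_mod_def)
  qed
  then have "poly f x = ?c"
    using f(3) poly_eq_const[of f x] by auto
  with fx have cw: "?c - w * g \<in> M" by simp
  have powcw: "?c ^ N - (w * g) ^ N \<in> M" for N
  proof (induction N)
    case (Suc N)
    have "?c ^ Suc N - (w * g) ^ Suc N = ?c * (?c ^ N - (w * g) ^ N) + (w * g) ^ N * (?c - w * g)"
      by (simp add: algebra_simps)
    also have "\<dots> \<in> M"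
      by (rule rmod.subspace_add[OF Ms rmod.subspace_scale[OF Ms Suc.IH] rmod.subspace_scale[OF Ms cw]])
    finally show ?case .
  qed (use rmod.subspace_0[OF Ms] in simp)
  show ?thesis unfolding almost_field_mod_def
  \<comment> \<open>The factor \<open>?c\<close> is a multiple of \<open>g\<close> modulo
    \<open>M\<close>, and \<open>?a\<close> pays for the reduction by \<open>p\<close>.\<close>
  proof (rule bexI[of _ "?a * ?c"], rule ballI)
    show "?a * ?c \<in> A - M" using aA cA p(2) f(2) M A by (auto simp: prime_id_mult_iff subring_ofD)
    fix b assume b: "b \<in> A - M"
    then obtain r N where r: "r \<in> ?B" "g ^ N - r * b \<in> M"
      using inv[of b] subset_adjoin[OF A, of x] by blast
    have "r * w ^ N \<in> ?B" using r(1) f1(3) B by (intro subring_ofD(4,7))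
    then obtain h where h: "coeffs_in A h" "r * w ^ N = poly h x" by (auto simp: adjoin_def)
    obtain q e L where qe: "coeffs_in A q" "coeffs_in A e" "\<And>i. i \<ge> m \<Longrightarrow> coeff e i = 0"
      "smult (?a ^ L) h = q * p + e"
      by (rule pseudo_division_in[where t = m, OF A h(1) p(1)], erule p(3), rule that)
    have eq: "?a ^ L * (r * w ^ N) = poly q x * poly p x + poly e x"
      using arg_cong[OF qe(4), of "\<lambda>p. poly p x"] h(2) by simp
    let ?d = "smult b e - [:?a ^ L * ?c ^ N:]"
    have "poly ?d x = b * poly e x - ?a ^ L * ?c ^ N" by simp
    also have "\<dots> = b * (?a ^ L * (r * w ^ N)) - b * poly q x * poly p x - ?a ^ L * ?c ^ N"
      unfolding eq by (simp add: algebra_simps)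
    also have "\<dots> = - (?a ^ L * w ^ N) * (g ^ N - r * b) - ?a ^ L * (?c ^ N - (w * g) ^ N)
        - (b * poly q x) * poly p x"
      by (simp add: algebra_simps power_mult_distrib)
    also have "\<dots> \<in> M"
      by (rule rmod.subspace_diff[OF Ms rmod.subspace_diff[OF Ms
            rmod.subspace_scale[OF Ms r(2)] rmod.subspace_scale[OF Ms powcw]] rmod.subspace_scale[OF Ms px]])
    finally have dx: "poly ?d x \<in> M" .
    have dA: "coeffs_in A ?d"
      using b qe(2) aA cA by (intro coeffs_in_diff[OF A] coeffs_in_smult[OF A] coeffs_in_const[OF A]
          subring_ofD(4,7)[OF A]) auto
    \<comment> \<open>As \<open>m > 0\<close>, the constant subtracted in \<open>?d\<close> sits
      below degree \<open>m\<close>.\<close>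
    have small: "coeff ?d i \<in> M" if "i \<ge> m" for i
      using that \<open>m > 0\<close> qe(3) rmod.subspace_0[OF Ms] by (cases i) auto
    have "coeff ?d 0 \<in> M" by (rule min[OF dA dx small])
    then have d0: "b * coeff e 0 - ?a ^ L * ?c ^ N \<in> M" by simp
    have "(?a * ?c) ^ (L + N) - (coeff e 0 * ?a ^ N * ?c ^ L) * b
        = - (?a ^ N * ?c ^ L) * (b * coeff e 0 - ?a ^ L * ?c ^ N)"
      by (simp add: algebra_simps power_mult_distrib power_add)
    also have "\<dots> \<in> M" by (rule rmod.subspace_scale[OF Ms d0])
    finally have "(?a * ?c) ^ (L + N) - (coeff e 0 * ?a ^ N * ?c ^ L) * b \<in> M" .
    moreover have "coeff e 0 * ?a ^ N * ?c ^ L \<in> A"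
      by (intro subring_ofD(4,7)[OF A] coeffs_inD[OF qe(2)] aA cA)
    ultimately show "\<exists>r\<in>A. \<exists>N. (?a * ?c) ^ N - r * b \<in> M" by blast
  qed
qed

section \<open>Polynomials in several variables\<close>

definition mconst :: "'k \<Rightarrow> ('k::field) mpolynomial" where
  "mconst c = Poly_Mapping.single 0 c"

lemma mconst_0: "mconst 0 = 0" by (simp add: mconst_def)
lemma mconst_1: "mconst 1 = 1" by (simp add: mconst_def)
lemma mconst_add: "mconst (a + b) = mconst a + mconst b" by (simp add: mconst_def single_add)
lemma mconst_mult: "mconst (a * b) = mconst a * mconst b" by (simp add: mconst_def mult_single)
lemma mconst_uminus: "mconst (- a) = - mconst a" by (simp add: mconst_def single_uminus)

lemma mconst_inverse: "c \<noteq> 0 \<Longrightarrow> mconst (inverse c) * mconst c = 1"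
  by (simp flip: mconst_mult mconst_1)

lemma sum_single_lookup: "(\<Sum>m\<in>Poly_Mapping.keys p. Poly_Mapping.single m (Poly_Mapping.lookup p m)) = p"
  by (rule poly_mapping_eqI)
    (auto simp: lookup_sum lookup_single when_def in_keys_iff sum.delta cong: if_cong)

definition polys_in :: "nat set \<Rightarrow> ('k::field) mpolynomial set" where
  "polys_in V = {p. \<forall>m\<in>Poly_Mapping.keys p. Poly_Mapping.keys m \<subseteq> V}"

lemma keys_uminus_mpoly: "Poly_Mapping.keys (- p) = Poly_Mapping.keys p"
  by (auto simp: in_keys_iff)

lemma subring_of_polys_in: "subring_of (polys_in V)"
  unfolding subring_of_def
proof (intro conjI ballI)
  show "1 \<in> polys_in V" by (simp add: polys_in_def)
  fix p q :: "'a mpolynomial" assume pq: "p \<in> polys_in V" "q \<in> polys_in V"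
  show "p + q \<in> polys_in V" using pq keys_add[of p q] by (auto simp: polys_in_def)
  show "- p \<in> polys_in V" using pq by (auto simp: polys_in_def keys_uminus_mpoly)
  show "p * q \<in> polys_in V" unfolding polys_in_def
  proof (intro CollectI ballI)
    fix m assume "m \<in> Poly_Mapping.keys (p * q)"
    then obtain a b where "m = a + b" "a \<in> Poly_Mapping.keys p" "b \<in> Poly_Mapping.keys q"
      using keys_mult[of p q] by blast
    moreover from this have "Poly_Mapping.keys a \<subseteq> V" "Poly_Mapping.keys b \<subseteq> V"
      using pq by (auto simp: polys_in_def)
    ultimately show "Poly_Mapping.keys m \<subseteq> V" using keys_add[of a b] by blast
  qed
qed

lemma mconst_in: "mconst c \<in> polys_in V"
  by (cases "c = 0") (auto simp: polys_in_def mconst_def)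

lemma mvar_in: "i \<in> V \<Longrightarrow> mvar i \<in> polys_in V"
  by (auto simp: polys_in_def mvar_def)

lemma polys_in_mono: "V \<subseteq> W \<Longrightarrow> polys_in V \<subseteq> polys_in W"
  by (auto simp: polys_in_def)

lemma polys_in_UNIV: "polys_in UNIV = UNIV"
  by (auto simp: polys_in_def)

lemma mvar_power: "mvar i ^ n = Poly_Mapping.single (Poly_Mapping.single i n) 1"
  by (induction n) (auto simp: mvar_def mult_single single_add[symmetric])

lemma prod_single_one:
  "finite A \<Longrightarrow> (\<Prod>i\<in>A. Poly_Mapping.single (f i) (1::'k::field)) = Poly_Mapping.single (\<Sum>i\<in>A. f i) 1"
  by (induction A rule: finite_induct) (auto simp: mult_single)

lemma single_eq_monomial:
  "Poly_Mapping.single m c = mconst c * (\<Prod>i\<in>Poly_Mapping.keys m. mvar i ^ Poly_Mapping.lookup m i)"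
  by (simp add: mvar_power prod_single_one sum_single_lookup mconst_def mult_single)

lemma polys_in_induct [consumes 1, case_names const var add mult]:
  assumes "p \<in> polys_in V" and c: "\<And>c. Q (mconst c)" and v: "\<And>i. i \<in> V \<Longrightarrow> Q (mvar i)"
    and a: "\<And>p q. Q p \<Longrightarrow> Q q \<Longrightarrow> Q (p + q)" and m: "\<And>p q. Q p \<Longrightarrow> Q q \<Longrightarrow> Q (p * q)"
  shows "Q p"
proof -
  have pow: "Q (p ^ n)" if "Q p" for p n
    using that by (induction n) (auto intro: m simp: c[of 1, unfolded mconst_1])
  have prod: "Q (prod f A)" if "\<And>i. i \<in> A \<Longrightarrow> Q (f i)" for f :: "nat \<Rightarrow> 'a mpolynomial" and A
    using that by (induction A rule: infinite_finite_induct) (auto intro: m simp: c[of 1, unfolded mconst_1])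
  have sum: "Q (sum f A)" if "\<And>i. i \<in> A \<Longrightarrow> Q (f i)" for f :: "(nat \<Rightarrow>\<^sub>0 nat) \<Rightarrow> 'a mpolynomial" and A
    using that by (induction A rule: infinite_finite_induct) (auto intro: a simp: c[of 0, unfolded mconst_0])
  have "Q (\<Sum>m\<in>Poly_Mapping.keys p. Poly_Mapping.single m (Poly_Mapping.lookup p m))"
    using assms(1) unfolding single_eq_monomial polys_in_def
    by (intro sum m c prod pow v) auto
  then show ?thesis by (simp add: sum_single_lookup)
qed

lemma mpoly_induct [case_names const var add mult]:
  assumes "\<And>c. Q (mconst c)" and "\<And>i. Q (mvar i)"
    and "\<And>p q. Q p \<Longrightarrow> Q q \<Longrightarrow> Q (p + q)" and "\<And>p q. Q p \<Longrightarrow> Q q \<Longrightarrow> Q (p * q)"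
  shows "Q p"
  using assms polys_in_induct[of p UNIV Q] by (simp add: polys_in_UNIV)

lemma polys_in_insert: "(polys_in (insert v V) :: ('k::field) mpolynomial set) = adjoin (polys_in V) (mvar v)"
proof
  note B = subring_of_adjoin[OF subring_of_polys_in, of V "mvar v"]
  have sub: "(polys_in V :: 'k mpolynomial set) \<subseteq> adjoin (polys_in V) (mvar v)" by (rule subset_adjoin[OF subring_of_polys_in])
  show "(polys_in (insert v V) :: 'k mpolynomial set) \<subseteq> adjoin (polys_in V) (mvar v)"
  proof
    fix p :: "'k mpolynomial" assume "p \<in> polys_in (insert v V)"
    then show "p \<in> adjoin (polys_in V) (mvar v)"
    proof (induction rule: polys_in_induct)
      case (const c) then show ?case using sub mconst_in by blast
    next
      case (var i) then show ?case using sub mvar_in adjoin_self[OF subring_of_polys_in] by blast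
    qed (auto intro: subring_ofD(3,4)[OF B])
  qed
  note S = subring_of_polys_in[of "insert v V"]
  show "adjoin (polys_in V) (mvar v) \<subseteq> (polys_in (insert v V) :: 'k mpolynomial set)"
  proof
    fix p :: "'k mpolynomial" assume "p \<in> adjoin (polys_in V) (mvar v)"
    then obtain f where f: "p = poly f (mvar v)" "coeffs_in (polys_in V) f" by (auto simp: adjoin_def)
    show "p \<in> polys_in (insert v V)"
      unfolding f(1) poly_altdef
      using coeffs_inD[OF f(2)] polys_in_mono[of V "insert v V"] mvar_in[of v "insert v V"]
      by (intro subring_of_sum[OF S] subring_ofD(4,7)[OF S]) auto
  qed
qed

lemma polys_in_empty: "polys_in {} = (range mconst :: ('k::field) mpolynomial set)"
proof -
  have "p \<in> range mconst" if "p \<in> polys_in {}" for p :: "'k mpolynomial"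
    using that by (induction rule: polys_in_induct) (auto simp flip: mconst_add mconst_mult)
  then show ?thesis by (auto intro: mconst_in)
qed

lemma noetherian_polys_in: "finite V \<Longrightarrow> noetherian_subring (polys_in V)"
proof (induction V rule: finite_induct)
  case empty
  show ?case unfolding noetherian_subring_def polys_in_empty
  proof (intro allI impI)
    fix J :: "'a mpolynomial set" assume J: "ideal_in (range mconst) J"
    note D = ideal_inD[OF J]
    show "\<exists>X\<subseteq>J. finite X \<and> J \<subseteq> combinations (range mconst) X"
    proof (cases "J = {0}")
      case True
      then show ?thesis by (intro exI[of _ "{}"]) (auto simp: combinations_def)
    next
      case False
      then obtain c where c: "mconst c \<in> J" "mconst c \<noteq> 0" using D(1,2) by blast
      then have "mconst (inverse c) * mconst c \<in> J" by (intro D(4)) auto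
      then have "1 \<in> J" using c by (metis mconst_inverse mconst_0)
      then show ?thesis using D(1)
        by (intro exI[of _ "{1}"]) (auto simp: combinations_def)
    qed
  qed
next
  case (insert v V)
  then show ?case unfolding polys_in_insert
    by (intro noetherian_adjoin subring_of_polys_in)
qed

subsection \<open>Evaluation homomorphisms\<close>

definition mon_eval :: "(nat \<Rightarrow> 'b::comm_ring_1) \<Rightarrow> (nat \<Rightarrow>\<^sub>0 nat) \<Rightarrow> 'b" where
  "mon_eval v m = (\<Prod>i\<in>Poly_Mapping.keys m. v i ^ Poly_Mapping.lookup m i)"

definition mp_eval :: "('k \<Rightarrow> 'b) \<Rightarrow> (nat \<Rightarrow> 'b) \<Rightarrow> ('k::field) mpolynomial \<Rightarrow> 'b::comm_ring_1" where
  "mp_eval h v p = (\<Sum>m\<in>Poly_Mapping.keys p. h (Poly_Mapping.lookup p m) * mon_eval v m)"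

definition scalar_hom :: "('k::field \<Rightarrow> 'b::comm_ring_1) \<Rightarrow> bool" where
  "scalar_hom h \<longleftrightarrow> h 0 = 0 \<and> h 1 = 1 \<and> (\<forall>a b. h (a + b) = h a + h b) \<and> (\<forall>a b. h (a * b) = h a * h b)"

lemma mon_eval_superset:
  assumes "finite S" "Poly_Mapping.keys m \<subseteq> S"
  shows "mon_eval v m = (\<Prod>i\<in>S. v i ^ Poly_Mapping.lookup m i)"
  unfolding mon_eval_def using assms
  by (intro prod.mono_neutral_left) (auto simp: in_keys_iff)

lemma mon_eval_add: "mon_eval v (a + b) = mon_eval v a * mon_eval v b"
proof -
  let ?S = "Poly_Mapping.keys a \<union> Poly_Mapping.keys b"
  have "Poly_Mapping.keys (a + b) \<subseteq> ?S" by (rule keys_add)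
  then show ?thesis
    by (simp add: mon_eval_superset[of ?S] lookup_add power_add prod.distrib)
qed

context
  fixes h :: "'k::field \<Rightarrow> 'b::comm_ring_1" and v :: "nat \<Rightarrow> 'b"
  assumes h: "scalar_hom h"
begin

lemma mp_eval_superset:
  assumes "finite S" "Poly_Mapping.keys p \<subseteq> S"
  shows "mp_eval h v p = (\<Sum>m\<in>S. h (Poly_Mapping.lookup p m) * mon_eval v m)"
  unfolding mp_eval_def using assms h
  by (intro sum.mono_neutral_left) (auto simp: in_keys_iff scalar_hom_def)

lemma mp_eval_add: "mp_eval h v (p + q) = mp_eval h v p + mp_eval h v q"
proof -
  let ?S = "Poly_Mapping.keys p \<union> Poly_Mapping.keys q"
  have "Poly_Mapping.keys (p + q) \<subseteq> ?S" by (rule keys_add)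
  then show ?thesis using h
    by (simp add: mp_eval_superset[of ?S] lookup_add scalar_hom_def distrib_right sum.distrib)
qed

lemma mp_eval_single: "mp_eval h v (Poly_Mapping.single m c) = h c * mon_eval v m"
  using h by (simp add: mp_eval_superset[of "{m}"] keys_single)

lemma mp_eval_0: "mp_eval h v 0 = 0"
  by (simp add: mp_eval_def)

lemma mp_eval_sum: "mp_eval h v (sum f A) = (\<Sum>x\<in>A. mp_eval h v (f x))"
  by (induction A rule: infinite_finite_induct) (auto simp: mp_eval_0 mp_eval_add)

lemma mp_eval_mult: "mp_eval h v (p * q) = mp_eval h v p * mp_eval h v q"
proof -
  have "p * q = (\<Sum>a\<in>Poly_Mapping.keys p. \<Sum>b\<in>Poly_Mapping.keys q.
      Poly_Mapping.single (a + b) (Poly_Mapping.lookup p a * Poly_Mapping.lookup q b))"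
    by (subst (1) sum_single_lookup[symmetric, of p], subst (1) sum_single_lookup[symmetric, of q])
      (simp add: sum_product mult_single)
  then have "mp_eval h v (p * q) = (\<Sum>a\<in>Poly_Mapping.keys p. \<Sum>b\<in>Poly_Mapping.keys q.
      (h (Poly_Mapping.lookup p a) * mon_eval v a) * (h (Poly_Mapping.lookup q b) * mon_eval v b))"
    using h by (simp add: mp_eval_sum mp_eval_single mon_eval_add scalar_hom_def mult_ac)
  then show ?thesis by (simp add: mp_eval_def sum_product)
qed

lemma mp_eval_mconst: "mp_eval h v (mconst c) = h c"
  by (simp add: mconst_def mp_eval_single mon_eval_def)

lemma mp_eval_mvar: "mp_eval h v (mvar i) = v i"
  using h by (simp add: mvar_def mp_eval_single mon_eval_def scalar_hom_def)

lemma mp_eval_1: "mp_eval h v 1 = 1"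
  using mp_eval_mconst[of 1] h by (simp add: mconst_1 scalar_hom_def)

lemma mp_eval_uminus: "mp_eval h v (- p) = - mp_eval h v p"
  using mp_eval_add[of p "- p"] mp_eval_0 by (simp add: eq_neg_iff_add_eq_0 add.commute)

lemma mp_eval_diff: "mp_eval h v (p - q) = mp_eval h v p - mp_eval h v q"
  using mp_eval_add[of p "- q"] by (simp add: mp_eval_uminus)

end

definition restrict_vars :: "nat set \<Rightarrow> ('k::field) mpolynomial \<Rightarrow> 'k mpolynomial" where
  "restrict_vars V = mp_eval mconst (\<lambda>i. if i \<in> V then mvar i else 0)"

lemma scalar_hom_mconst: "scalar_hom mconst"
  by (simp add: scalar_hom_def mconst_0 mconst_1 mconst_add mconst_mult)

lemmas restrict_vars_simps =
  mp_eval_add[OF scalar_hom_mconst, of "\<lambda>i. if i \<in> V then mvar i else 0" for V, folded restrict_vars_def]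
  mp_eval_mult[OF scalar_hom_mconst, of "\<lambda>i. if i \<in> V then mvar i else 0" for V, folded restrict_vars_def]
  mp_eval_diff[OF scalar_hom_mconst, of "\<lambda>i. if i \<in> V then mvar i else 0" for V, folded restrict_vars_def]
  mp_eval_0[OF scalar_hom_mconst, of "\<lambda>i. if i \<in> V then mvar i else 0" for V, folded restrict_vars_def]
  mp_eval_1[OF scalar_hom_mconst, of "\<lambda>i. if i \<in> V then mvar i else 0" for V, folded restrict_vars_def]
  mp_eval_mconst[OF scalar_hom_mconst, of "\<lambda>i. if i \<in> V then mvar i else 0" for V, folded restrict_vars_def]
  mp_eval_mvar[OF scalar_hom_mconst, of "\<lambda>i. if i \<in> V then mvar i else 0" for V, folded restrict_vars_def]

lemma restrict_vars_in: "restrict_vars V p \<in> polys_in V"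
  by (induction p rule: mpoly_induct)
    (auto simp: restrict_vars_simps mconst_in mvar_in intro: subring_ofD[OF subring_of_polys_in])

lemma restrict_vars_ident: "p \<in> polys_in V \<Longrightarrow> restrict_vars V p = p"
  by (induction p rule: polys_in_induct) (auto simp: restrict_vars_simps)

text \<open>All polynomials live in one type with infinitely many variables. Modulo an ideal
  containing the variables outside \<open>V\<close>, setting these to zero changes nothing, which
  reduces questions to finitely many variables.\<close>

lemma diff_restrict_vars:
  assumes J: "rmod.subspace J" and "\<And>i. i \<notin> V \<Longrightarrow> mvar i \<in> J"
  shows "p - restrict_vars V p \<in> J"
proof (induction p rule: mpoly_induct)
  case (var i)
  then show ?case using assms(2) rmod.subspace_0[OF J] by (auto simp: restrict_vars_simps)
next
  case (add p q)
  from rmod.subspace_add[OF J add] show ?case by (simp add: restrict_vars_simps algebra_simps)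
next
  case (mult p q)
  have "p * q - restrict_vars V (p * q)
      = q * (p - restrict_vars V p) + restrict_vars V p * (q - restrict_vars V q)"
    by (simp add: restrict_vars_simps algebra_simps)
  also have "\<dots> \<in> J"
    by (rule rmod.subspace_add[OF J rmod.subspace_scale[OF J mult(1)] rmod.subspace_scale[OF J mult(2)]])
  finally show ?case .
qed (simp add: restrict_vars_simps rmod.subspace_0[OF J])

text \<open>The polynomial read as one in \<open>x_i\<close> alone, with coefficients in the other
  variables.\<close>

definition single_out :: "nat \<Rightarrow> ('k::field) mpolynomial \<Rightarrow> 'k mpolynomial poly" where
  "single_out i = mp_eval (\<lambda>c. [:mconst c:]) (\<lambda>j. if j = i then [:0, 1:] else [:mvar j:])"

lemma scalar_hom_mconst_poly: "scalar_hom (\<lambda>c. [:mconst c:])"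
  by (simp add: scalar_hom_def mconst_0 mconst_1 mconst_add mconst_mult one_pCons)

lemmas single_out_simps =
  mp_eval_add[OF scalar_hom_mconst_poly, of "\<lambda>j. if j = i then [:0, 1:] else [:mvar j:]" for i, folded single_out_def]
  mp_eval_mult[OF scalar_hom_mconst_poly, of "\<lambda>j. if j = i then [:0, 1:] else [:mvar j:]" for i, folded single_out_def]
  mp_eval_0[OF scalar_hom_mconst_poly, of "\<lambda>j. if j = i then [:0, 1:] else [:mvar j:]" for i, folded single_out_def]
  mp_eval_mconst[OF scalar_hom_mconst_poly, of "\<lambda>j. if j = i then [:0, 1:] else [:mvar j:]" for i, folded single_out_def]
  mp_eval_mvar[OF scalar_hom_mconst_poly, of "\<lambda>j. if j = i then [:0, 1:] else [:mvar j:]" for i, folded single_out_def]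

lemma poly_single_out: "poly (single_out i p) (mvar i) = p"
  by (induction p rule: mpoly_induct) (auto simp: single_out_simps)

lemma single_out_free: "p \<in> polys_in (- {i}) \<Longrightarrow> single_out i p = [:p:]"
  by (induction p rule: polys_in_induct) (auto simp: single_out_simps)

definition uni :: "('k::field) poly \<Rightarrow> nat \<Rightarrow> 'k mpolynomial" where
  "uni f i = poly (map_poly mconst f) (mvar i)"

lemma uni_pCons: "uni (pCons c f) i = mconst c + mvar i * uni f i"
  by (simp add: uni_def map_poly_pCons mconst_0)

lemma uni_0: "uni 0 i = 0"
  by (simp add: uni_def)

lemma uni_X: "uni [:0, 1:] i = mvar i"
  by (simp add: uni_pCons mconst_0 mconst_1 uni_0)

lemma single_out_uni: "single_out i (uni f i) = map_poly mconst f"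
  by (induction f) (auto simp: uni_pCons uni_0 single_out_simps map_poly_pCons mconst_0)

lemma uni_in: "i \<in> V \<Longrightarrow> uni f i \<in> polys_in V"
  by (induction f) (auto simp: uni_pCons uni_0 mconst_in mvar_in intro!: subring_ofD[OF subring_of_polys_in])

text \<open>Compare the top coefficients in \<open>x\<^sub>i\<close>.\<close>

lemma uni_nonzerodivisor:
  assumes X: "X \<subseteq> polys_in (- {i})" and f: "f \<noteq> 0" and r: "uni f i * r \<in> rmod.span X"
  shows "r \<in> rmod.span X"
proof (rule ccontr)
  let ?J = "rmod.span X"
  have J: "rmod.subspace ?J" by simp
  \<comment> \<open>Generators free of \<open>x_i\<close> are constants in this variable, so
    membership passes to the single coefficients.\<close>
  have co: "\<forall>l. coeff (single_out i p) l \<in> ?J" if "p \<in> ?J" for p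
    using that
  proof (induction rule: rmod.span_induct_alt)
    case base
    then show ?case by (simp add: single_out_simps rmod.span_zero)
  next
    case (step c x y)
    have "single_out i x = [:x:]" using step(1) X by (intro single_out_free) auto
    then have "coeff (single_out i x) l \<in> ?J" for l
      using step(1) by (cases l) (auto intro: rmod.span_base rmod.span_zero)
    then have "coeff (single_out i x * single_out i c) l \<in> ?J" for l
      by (intro coeffs_mult_mod) auto
    then show ?case using step(2)
      by (auto simp: single_out_simps mult.commute[of "single_out i c"] intro: rmod.span_add)
  qed
  assume nr: "r \<notin> ?J"
  have "\<exists>l. coeff (single_out i r) l \<notin> ?J"
    using poly_mod[OF J, of "single_out i r" "mvar i"] nr by (auto simp: poly_single_out)
  \<comment> \<open>The ideal \<open>?J\<close> need not be prime. The leading terms still do not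
    cancel, because the leading coefficient of \<open>f\<close> is a nonzero scalar.\<close>
  then obtain u where u: "top_mod ?J (single_out i r) u" using top_mod_exists[OF J] by blast
  define d where "d = degree f"
  have co_f: "coeff (map_poly mconst f) j = mconst (coeff f j)" for j
    by (simp add: coeff_map_poly mconst_0)
  have out: "coeff (map_poly mconst f) j * coeff (single_out i r) (d + u - j) \<in> ?J"
    if "j \<noteq> d" "j \<le> d + u" for j
  proof (cases "j > d")
    case True
    then show ?thesis by (simp add: co_f d_def coeff_eq_0 mconst_0 rmod.span_zero)
  next
    case False
    then have "d + u - j > u" using that by auto
    then show ?thesis using u by (auto simp: top_mod_def intro: rmod.span_scale)
  qed
  have S: "(\<Sum>j\<in>{..d+u} - {d}. coeff (map_poly mconst f) j * coeff (single_out i r) (d + u - j)) \<in> ?J"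
    using out by (intro rmod.span_sum) auto
  have T: "coeff (single_out i (uni f i * r)) (d + u) \<in> ?J" using co[OF r] by blast
  have eq: "coeff (single_out i (uni f i * r)) (d + u)
      = (\<Sum>j\<in>{..d+u} - {d}. coeff (map_poly mconst f) j * coeff (single_out i r) (d + u - j))
        + coeff (map_poly mconst f) d * coeff (single_out i r) u"
    by (simp add: single_out_simps single_out_uni coeff_mult sum.remove[of "{..d+u}" d])
  from rmod.span_diff[OF T S] have "mconst (coeff f d) * coeff (single_out i r) u \<in> ?J"
    unfolding eq co_f[of d] by simp
  then have "mconst (inverse (coeff f d)) * (mconst (coeff f d) * coeff (single_out i r) u) \<in> ?J"
    by (rule rmod.span_scale)
  moreover have "coeff f d \<noteq> 0" using f by (simp add: d_def)
  ultimately have "coeff (single_out i r) u \<in> ?J"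
    by (simp add: mult.assoc[symmetric] mconst_inverse)
  then show False using u by (simp add: top_mod_def)
qed

subsection \<open>Maximal ideals\<close>

text \<open>The form of Zariski's lemma used here. Starting from all variables in \<open>V\<close>,
  where the quotient by \<open>M\<close> is a field, \<open>almost_field_mod_adjoinD\<close> strips
  the variables other than \<open>x_i\<close> one by one; then
  \<open>algebraic_if_almost_field_adjoin\<close> makes \<open>x_i\<close> algebraic over the
  scalars modulo \<open>M\<close>.\<close>

lemma uni_in_maximal:
  fixes M :: "('k::field) mpolynomial set"
  assumes M: "prime_id M" and max: "\<And>a. a \<notin> M \<Longrightarrow> \<exists>b. b * a - 1 \<in> M"
    and fin: "finite V" and V: "\<And>i. i \<notin> V \<Longrightarrow> mvar i \<in> M"
  shows "\<exists>f. f \<noteq> 0 \<and> uni f i \<in> M"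
proof -
  note Ms = prime_id_subspace[OF M]
  have step: "almost_field_mod M (polys_in W)" if "W \<subseteq> V" for W
  proof -
    have "finite (V - W)" using fin by simp
    then show ?thesis using that
    proof (induction "V - W" arbitrary: W rule: finite_induct)
      case empty
      then have W: "W = V" by auto
      \<comment> \<open>For a maximal ideal nothing has to be inverted, so \<open>g = 1\<close>
        serves; the inverse only has to be moved into \<open>polys_in V\<close>.\<close>
      have "\<exists>r\<in>polys_in V. \<exists>N. 1 ^ N - r * b \<in> M" if b: "b \<in> polys_in V - M" for b
      proof -
        obtain a where a: "a * b - 1 \<in> M" using max b by blast
        let ?r = "restrict_vars V a"
        have "1 ^ 0 - ?r * b = b * (a - ?r) - (a * b - 1)" by (simp add: algebra_simps)
        also have "\<dots> \<in> M"
          by (rule rmod.subspace_diff[OF Ms rmod.subspace_scale[OF Ms diff_restrict_vars[OF Ms V]] a])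
        finally show ?thesis using restrict_vars_in by blast
      qed
      then show ?case unfolding W almost_field_mod_def
        using subring_ofD(1)[OF subring_of_polys_in] prime_id_one[OF M] by blast
    next
      case (insert v F W)
      then have "almost_field_mod M (polys_in (insert v W))" by (intro insert.hyps(3)) auto
      then show ?case unfolding polys_in_insert
        by (rule almost_field_mod_adjoinD[OF M subring_of_polys_in])
    qed
  qed
  show ?thesis
  proof (cases "i \<in> V")
    case True
    then have "almost_field_mod M (adjoin (polys_in {}) (mvar i))"
      using step[of "{i}"] by (simp add: polys_in_insert)
    from algebraic_if_almost_field_adjoin[OF M subring_of_polys_in this]
    obtain p j where p: "coeffs_in (range mconst) p" "poly p (mvar i) \<in> M" "coeff p j \<notin> M"
      by (auto simp: polys_in_empty)
    define f where "f = map_poly (\<lambda>q. Poly_Mapping.lookup q 0) p"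
    have "mconst (Poly_Mapping.lookup (coeff p l) 0) = coeff p l" for l
      using coeffs_inD[OF p(1), of l] by (auto simp: mconst_def)
    then have "map_poly mconst f = p"
      unfolding f_def by (intro poly_eqI) (simp add: coeff_map_poly mconst_0)
    moreover from this have "f \<noteq> 0" using p(3) rmod.subspace_0[OF Ms] by auto
    ultimately show ?thesis using p(2) by (auto simp: uni_def)
  next
    case False
    then show ?thesis using V by (intro exI[of _ "[:0, 1:]"]) (simp add: uni_X)
  qed
qed

text \<open>Since \<open>x_i\<close> is not in the prime \<open>M\<close>, powers of
  \<open>x_i\<close> can be cancelled. The constant term matters because the element has to become a
  unit wherever \<open>x_i\<close> is set to zero.\<close>

lemma uni_in_maximal_nonzero_const:
  assumes M: "prime_id M" and i: "mvar i \<notin> M" and f: "f \<noteq> 0" "uni f i \<in> M"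
  obtains g where "coeff g 0 \<noteq> 0" "uni g i \<in> M"
proof -
  have "\<exists>g. coeff g 0 \<noteq> 0 \<and> uni g i \<in> M"
    using f
  proof (induction f)
    case (pCons c f)
    show ?case
    proof (cases "c = 0")
      case True
      then have "uni f i \<in> M" using pCons.prems i M by (simp add: uni_pCons mconst_0 prime_id_mult_iff)
      then show ?thesis using pCons.IH pCons.prems True by auto
    next
      case False
      then show ?thesis using pCons.prems by (intro exI[of _ "pCons c f"]) auto
    qed
  qed simp
  then show ?thesis using that by blast
qed

section \<open>The dimension of a polynomial ring\<close>

interpretation mpoly_vs: vector_space "\<lambda>c (p :: ('k::field) mpolynomial). mconst c * p"
  by unfold_locales (simp_all add: algebra_simps mconst_add mconst_mult mconst_1)

declare mpoly_vs.scale_scale [simp del]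

text \<open>There are more vectors than the dimension of the span of \<open>B\<close>. A repeated
  value of \<open>v\<close> is treated apart, because linear dependence is a notion for sets and not
  for families.\<close>

lemma linear_relation_if_few_monomials:
  fixes v :: "'e \<Rightarrow> ('k::field) mpolynomial"
  assumes fin: "finite E" "finite B" and v: "\<And>e. e \<in> E \<Longrightarrow> Poly_Mapping.keys (v e) \<subseteq> B"
    and card: "card B < card E"
  shows "\<exists>c. (\<exists>e\<in>E. c e \<noteq> 0) \<and> (\<Sum>e\<in>E. mconst (c e) * v e) = 0"
proof (cases "inj_on v E")
  case False
  then obtain a b where ab: "a \<in> E" "b \<in> E" "a \<noteq> b" "v a = v b" by (auto simp: inj_on_def)
  let ?c = "\<lambda>e. if e = a then 1 else if e = b then - 1 else (0::'k)"
  have "(\<Sum>e\<in>E. mconst (?c e) * v e) = (\<Sum>e\<in>{a, b}. mconst (?c e) * v e)"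
    using ab fin by (intro sum.mono_neutral_right) (auto simp: mconst_0)
  also have "\<dots> = 0" using ab by (simp add: mconst_1 mconst_uminus)
  finally show ?thesis using ab by (intro exI[of _ ?c]) auto
next
  case True
  let ?T = "(\<lambda>m. Poly_Mapping.single m (1::'k)) ` B"
  have "v ` E \<subseteq> mpoly_vs.span ?T"
  proof
    fix p assume "p \<in> v ` E"
    then have "Poly_Mapping.keys p \<subseteq> B" using v by auto
    then have "(\<Sum>m\<in>Poly_Mapping.keys p. mconst (Poly_Mapping.lookup p m) * Poly_Mapping.single m 1) \<in> mpoly_vs.span ?T"
      by (intro mpoly_vs.span_sum mpoly_vs.span_scale mpoly_vs.span_base imageI) auto
    moreover have "p = (\<Sum>m\<in>Poly_Mapping.keys p. mconst (Poly_Mapping.lookup p m) * Poly_Mapping.single m 1)"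
      using sum_single_lookup[of p] by (simp add: mconst_def mult_single)
    ultimately show "p \<in> mpoly_vs.span ?T" by (simp only:)
  qed
  moreover have "card ?T \<le> card B" by (rule card_image_le[OF fin(2)])
  moreover have "card (v ` E) = card E" by (rule card_image[OF True])
  ultimately have "mpoly_vs.dependent (v ` E)"
    using mpoly_vs.independent_span_bound[of ?T "v ` E"] fin(2) card by auto
  then obtain u where u: "\<exists>p\<in>v ` E. u p \<noteq> 0" "(\<Sum>p\<in>v ` E. mconst (u p) * p) = 0"
    using mpoly_vs.dependent_finite[of "v ` E"] fin(1) by auto
  then show ?thesis using True
    by (intro exI[of _ "\<lambda>e. u (v e)"]) (auto simp: sum.reindex)
qed

section \<open>Algebraic dependence by counting monomials\<close>

definition exp_box :: "nat set \<Rightarrow> nat \<Rightarrow> (nat \<Rightarrow>\<^sub>0 nat) set" where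
  "exp_box V D = {m. Poly_Mapping.keys m \<subseteq> V \<and> (\<forall>i. Poly_Mapping.lookup m i \<le> D)}"

text \<open>Bounding each exponent separately, rather than the total degree, makes the count a plain
  power.\<close>

lemma exp_box_card:
  assumes "finite V"
  shows "finite (exp_box V D)" "card (exp_box V D) \<le> (D + 1) ^ card V"
proof -
  let ?f = "\<lambda>m. restrict (Poly_Mapping.lookup m) V"
  have inj: "inj_on ?f (exp_box V D)"
  proof (rule inj_onI, rule poly_mapping_eqI)
    fix a b i assume ab: "a \<in> exp_box V D" "b \<in> exp_box V D" "?f a = ?f b"
    show "Poly_Mapping.lookup a i = Poly_Mapping.lookup b i"
    proof (cases "i \<in> V")
      case True
      then show ?thesis using fun_cong[OF ab(3), of i] by simp
    next
      case False
      then have "i \<notin> Poly_Mapping.keys a" "i \<notin> Poly_Mapping.keys b" using ab by (auto simp: exp_box_def)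
      then show ?thesis by (simp add: in_keys_iff)
    qed
  qed
  have sub: "?f ` exp_box V D \<subseteq> (\<Pi>\<^sub>E i\<in>V. {..D})" by (auto simp: exp_box_def)
  have fin: "finite (\<Pi>\<^sub>E i\<in>V. {..D})" using assms by (intro finite_PiE) auto
  show "finite (exp_box V D)"
    using inj sub fin by (metis finite_imageD finite_subset)
  have "card (exp_box V D) \<le> card (\<Pi>\<^sub>E i\<in>V. {..D})"
    by (rule card_inj_on_le[OF inj sub fin])
  then show "card (exp_box V D) \<le> (D + 1) ^ card V"
    using assms by (simp add: card_PiE)
qed

lemma keys_mult_exp_box:
  assumes "Poly_Mapping.keys p \<subseteq> exp_box V D" "Poly_Mapping.keys q \<subseteq> exp_box V D'"
  shows "Poly_Mapping.keys (p * q) \<subseteq> exp_box V (D + D')"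
proof
  fix m assume "m \<in> Poly_Mapping.keys (p * q)"
  then obtain a b where m: "m = a + b" "a \<in> exp_box V D" "b \<in> exp_box V D'"
    using keys_mult[of p q] assms by blast
  then show "m \<in> exp_box V (D + D')"
    using keys_add[of a b] by (auto simp: exp_box_def lookup_add intro!: add_mono)
qed

lemma keys_power_exp_box:
  "Poly_Mapping.keys p \<subseteq> exp_box V D \<Longrightarrow> Poly_Mapping.keys (p ^ e) \<subseteq> exp_box V (e * D)"
  for p :: "('k::field) mpolynomial"
proof (induction e)
  case 0
  show ?case by (simp add: exp_box_def)
next
  case (Suc e)
  then show ?case using keys_mult_exp_box[of p V D "p ^ e" "e * D"] by simp
qed

lemma exp_box_mono: "D \<le> D' \<Longrightarrow> exp_box V D \<subseteq> exp_box V D'"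
  by (auto simp: exp_box_def intro: order_trans)

definition power_product :: "'a::comm_ring_1 list \<Rightarrow> nat list \<Rightarrow> 'a" where
  "power_product ys es = prod_list (map2 (^) ys es)"

lemma power_product_simps [simp]:
  "power_product [] [] = 1"
  "power_product (y # ys) (e # es) = y ^ e * power_product ys es"
  by (simp_all add: power_product_def)

definition exponents :: "nat \<Rightarrow> nat \<Rightarrow> nat list set" where
  "exponents N l = {es. set es \<subseteq> {..<N} \<and> length es = l}"

lemma exponents_0: "exponents N 0 = {[]}"
  by (auto simp: exponents_def)

lemma finite_exponents: "finite (exponents N l)"
  by (simp add: exponents_def finite_lists_length_eq)

lemma card_exponents: "card (exponents N l) = N ^ l"
  by (simp add: exponents_def card_lists_length_eq)

lemma sum_exponents_Suc:
  "(\<Sum>es\<in>exponents N (Suc l). f es) = (\<Sum>a<N. \<Sum>es\<in>exponents N l. f (a # es))"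
proof -
  have "exponents N (Suc l) = (\<lambda>x. fst x # snd x) ` ({..<N} \<times> exponents N l)"
    by (auto simp: exponents_def length_Suc_conv image_iff)
  moreover have "inj_on (\<lambda>x. fst x # snd x) ({..<N} \<times> exponents N l)"
    by (auto simp: inj_on_def)
  ultimately show ?thesis
    by (simp add: sum.reindex sum.cartesian_product case_prod_beta comp_def)
qed

lemma keys_power_product:
  fixes ys :: "('k::field) mpolynomial list"
  assumes "\<And>y. y \<in> set ys \<Longrightarrow> Poly_Mapping.keys y \<subseteq> exp_box V D" "es \<in> exponents N (length ys)"
  shows "Poly_Mapping.keys (power_product ys es) \<subseteq> exp_box V (length ys * (N * D))"
  using assms
proof (induction ys arbitrary: es)
  case Nil
  then show ?case by (auto simp: exponents_def exp_box_def)
next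
  case (Cons y ys)
  then obtain e es' where es: "es = e # es'" "e < N" "es' \<in> exponents N (length ys)"
    by (auto simp: exponents_def length_Suc_conv)
  have "Poly_Mapping.keys (y ^ e) \<subseteq> exp_box V (e * D)" using Cons.prems by (intro keys_power_exp_box) auto
  also have "\<dots> \<subseteq> exp_box V (N * D)" using es(2) by (intro exp_box_mono) auto
  finally have "Poly_Mapping.keys (y ^ e) \<subseteq> exp_box V (N * D)" .
  from keys_mult_exp_box[OF this Cons.IH[OF _ es(3)]] Cons.prems(1)
  show ?case by (simp add: es(1))
qed

text \<open>For \<open>l\<close> elements there are \<open>N^l\<close> exponent lists below
  \<open>N\<close>, while the power products involve at most \<open>(l N D + 1)^d\<close> monomials
  if \<open>D\<close> bounds the exponents in \<open>ys\<close>. Since \<open>l > d\<close>, the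
  first number wins for large \<open>N\<close>.\<close>

lemma algebraically_dependent:
  fixes ys :: "('k::field) mpolynomial list"
  assumes fin: "finite V" and ys: "set ys \<subseteq> polys_in V" and len: "length ys > card V"
  shows "\<exists>N c. (\<exists>es\<in>exponents N (length ys). c es \<noteq> 0) \<and>
    (\<Sum>es\<in>exponents N (length ys). mconst (c es) * power_product ys es) = 0"
proof -
  let ?l = "length ys" and ?d = "card V"
  have bnd: "\<exists>D. Poly_Mapping.keys y \<subseteq> exp_box V D" if "y \<in> polys_in V" for y :: "'k mpolynomial"
  proof -
    have "Poly_Mapping.lookup m i \<le> (\<Sum>m\<in>Poly_Mapping.keys y. \<Sum>i\<in>Poly_Mapping.keys m. Poly_Mapping.lookup m i)"
      if "m \<in> Poly_Mapping.keys y" for m i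
    proof (cases "i \<in> Poly_Mapping.keys m")
      case True
      then have "Poly_Mapping.lookup m i \<le> (\<Sum>i\<in>Poly_Mapping.keys m. Poly_Mapping.lookup m i)"
        by (intro member_le_sum) auto
      also have "\<dots> \<le> (\<Sum>m\<in>Poly_Mapping.keys y. \<Sum>i\<in>Poly_Mapping.keys m. Poly_Mapping.lookup m i)"
        using that by (intro member_le_sum) auto
      finally show ?thesis .
    qed (simp add: in_keys_iff)
    then show ?thesis using that unfolding polys_in_def exp_box_def by blast
  qed
  have "\<exists>D. \<forall>y\<in>set ys. Poly_Mapping.keys y \<subseteq> exp_box V D"
    using ys
  proof (induction ys)
    case (Cons y ys)
    then obtain D D' where "\<forall>y\<in>set ys. Poly_Mapping.keys y \<subseteq> exp_box V D" "Poly_Mapping.keys y \<subseteq> exp_box V D'"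
      using bnd[of y] by auto
    then have "\<forall>y\<in>set (y # ys). Poly_Mapping.keys y \<subseteq> exp_box V (max D D')"
      using exp_box_mono[of D "max D D'" V] exp_box_mono[of D' "max D D'" V] by auto
    then show ?case by blast
  qed simp
  then obtain D where D: "\<And>y. y \<in> set ys \<Longrightarrow> Poly_Mapping.keys y \<subseteq> exp_box V D" by blast
  \<comment> \<open>Chosen so that \<open>(l D + 1)^d < N\<close>. As
    \<open>l N D + 1 \<le> (l D + 1) N\<close>, the number of monomials stays below
    \<open>N^(d + 1)\<close>.\<close>
  define N where "N = (?l * D + 1) ^ ?d + 1"
  have N: "N \<ge> 1" by (simp add: N_def)
  have "card (exp_box V (?l * (N * D))) \<le> (?l * (N * D) + 1) ^ ?d"
    by (rule exp_box_card[OF fin])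
  also have "\<dots> \<le> ((?l * D + 1) * N) ^ ?d"
    using N by (intro power_mono) (auto simp: algebra_simps)
  also have "\<dots> = (?l * D + 1) ^ ?d * N ^ ?d" by (rule power_mult_distrib)
  also have "\<dots> < N * N ^ ?d" using N by (intro mult_strict_right_mono) (auto simp: N_def)
  also have "\<dots> = N ^ Suc ?d" by simp
  also have "\<dots> \<le> N ^ ?l" using N len by (intro power_increasing) auto
  finally have "card (exp_box V (?l * (N * D))) < card (exponents N ?l)"
    by (simp add: card_exponents)
  then have "\<exists>c. (\<exists>es\<in>exponents N ?l. c es \<noteq> 0) \<and>
    (\<Sum>es\<in>exponents N ?l. mconst (c es) * power_product ys es) = 0"
    using keys_power_product[OF D] exp_box_card(1)[OF fin] finite_exponents
    by (intro linear_relation_if_few_monomials) auto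
  then show ?thesis by blast
qed

text \<open>The lowest power of \<open>y\<^sub>0\<close> in a relation can be divided out modulo \<open>P\<^sub>0\<close>, and then setting
  \<open>y\<^sub>0 = 0\<close> gives a relation modulo \<open>P\<^sub>1\<close> between the remaining elements.\<close>

lemma no_relation_along_prime_chain:
  fixes ys :: "('k::field) mpolynomial list"
  assumes "length Ps = Suc (length ys)" "\<And>Q. Q \<in> set Ps \<Longrightarrow> prime_id Q"
    and "\<And>i. i < length ys \<Longrightarrow> Ps ! i \<subseteq> Ps ! Suc i \<and> ys ! i \<in> Ps ! Suc i - Ps ! i"
    and "\<exists>es\<in>exponents N (length ys). c es \<noteq> 0"
  shows "(\<Sum>es\<in>exponents N (length ys). mconst (c es) * power_product ys es) \<notin> Ps ! 0"
  using assms
proof (induction ys arbitrary: Ps c)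
  case Nil
  then obtain P where P: "Ps = [P]" "prime_id P" "c [] \<noteq> 0" by (auto simp: exponents_0 length_Suc_conv)
  have "mconst (c []) \<notin> P"
  proof
    assume "mconst (c []) \<in> P"
    from rmod.subspace_scale[OF prime_id_subspace[OF P(2)] this, of "mconst (inverse (c []))"]
    show False using P by (simp add: mconst_inverse prime_id_one)
  qed
  then show ?case using P by (simp add: exponents_0)
next
  case (Cons y ys)
  obtain P Qs where PQ: "Ps = P # Qs" "length Qs = Suc (length ys)"
    using Cons.prems(1) by (auto simp: length_Suc_conv)
  define Q where "Q = Qs ! 0"
  have P: "prime_id P" and Q: "prime_id Q" using Cons.prems(2) PQ by (auto simp: Q_def)
  note Ps = prime_id_subspace[OF P] and Qs = prime_id_subspace[OF Q]
  have y: "P \<subseteq> Q" "y \<in> Q" "y \<notin> P" using Cons.prems(3)[of 0] PQ by (auto simp: Q_def)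
  \<comment> \<open>The coefficient of \<open>y^a\<close>. By induction it avoids even the larger
    prime \<open>Q\<close> unless all its scalars vanish.\<close>
  define G where "G a = (\<Sum>es\<in>exponents N (length ys). mconst (c (a # es)) * power_product ys es)" for a
  have IH: "G a \<notin> Q" if "\<exists>es\<in>exponents N (length ys). c (a # es) \<noteq> 0" for a
    unfolding G_def Q_def
  proof (rule Cons.IH[OF PQ(2) _ _ that])
    show "prime_id Q" if "Q \<in> set Qs" for Q using that Cons.prems(2) PQ(1) by simp
    show "Qs ! i \<subseteq> Qs ! Suc i \<and> ys ! i \<in> Qs ! Suc i - Qs ! i" if "i < length ys" for i
      using Cons.prems(3)[of "Suc i"] PQ(1) that by simp
  qed
  have total: "(\<Sum>es\<in>exponents N (length (y # ys)). mconst (c es) * power_product (y # ys) es)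
      = (\<Sum>a<N. y ^ a * G a)"
    by (simp add: sum_exponents_Suc G_def sum_distrib_left mult_ac)
  define R where "R a \<longleftrightarrow> a < N \<and> (\<exists>es\<in>exponents N (length ys). c (a # es) \<noteq> 0)" for a
  define a0 where "a0 = (LEAST a. R a)"
  have "\<exists>a. R a" using Cons.prems(4) by (fastforce simp: R_def exponents_def length_Suc_conv)
  then have a0: "R a0" unfolding a0_def by (rule LeastI_ex)
  have G0: "G a = 0" if "a < a0" for a
  proof -
    have "\<not> R a" using that not_less_Least unfolding a0_def by blast
    then have "c (a # es) = 0" if "es \<in> exponents N (length ys)" for es
      using that \<open>a < a0\<close> a0 unfolding R_def by auto
    then show ?thesis by (simp add: G_def mconst_0)
  qed
  define H where "H = (\<Sum>a\<in>{Suc a0..<N}. y ^ (a - Suc a0) * G a)"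
  have "(\<Sum>a<N. y ^ a * G a) = (\<Sum>a\<in>{a0..<N}. y ^ a * G a)"
    using G0 by (intro sum.mono_neutral_right) auto
  also have "\<dots> = y ^ a0 * G a0 + (\<Sum>a\<in>{Suc a0..<N}. y ^ a * G a)"
    using a0 by (simp add: R_def sum.atLeast_Suc_lessThan)
  also have "(\<Sum>a\<in>{Suc a0..<N}. y ^ a * G a) = y ^ a0 * (y * H)"
    unfolding H_def sum_distrib_left
    by (intro sum.cong) (auto simp: mult.assoc[symmetric] power_Suc2[symmetric] power_add[symmetric] simp del: power_Suc)
  finally have eq: "(\<Sum>a<N. y ^ a * G a) = y ^ a0 * (G a0 + y * H)"
    by (simp add: distrib_left)
  show ?case
  proof
    assume "(\<Sum>es\<in>exponents N (length (y # ys)). mconst (c es) * power_product (y # ys) es) \<in> Ps ! 0"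
    then have "y ^ a0 * (G a0 + y * H) \<in> P" unfolding total eq PQ by simp
    then have "G a0 + y * H \<in> P" using P y(3) by (auto simp: prime_id_mult_iff prime_id_power_iff)
    then have 1: "G a0 + y * H \<in> Q" using y(1) by blast
    have "H * y \<in> Q" by (rule rmod.subspace_scale[OF Qs y(2)])
    from rmod.subspace_diff[OF Qs 1 this] have "G a0 \<in> Q" by (simp add: mult.commute)
    then show False using IH a0 by (simp add: R_def)
  qed
qed

text \<open>Elements taken from the gaps of the chain, moved into \<open>polys_in V\<close> by
  setting the other variables to zero, satisfy no relation even modulo the smallest prime; but
  \<open>card V + 1\<close> of them are algebraically dependent.\<close>

lemma prime_chain_length:
  fixes Ps :: "('k::field) mpolynomial set list"
  assumes fin: "finite V" and len: "length Ps = Suc r" and sorted: "sorted_wrt (\<subset>) Ps"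
    and prime: "\<And>Q. Q \<in> set Ps \<Longrightarrow> prime_id Q" and V: "\<And>i. i \<notin> V \<Longrightarrow> mvar i \<in> Ps ! 0"
  shows "r \<le> card V"
proof (rule ccontr)
  assume "\<not> ?thesis"
  then have r: "r \<ge> Suc (card V)" by simp
  define l where "l = Suc (card V)"
  have step: "Ps ! i \<subset> Ps ! Suc i" if "i < r" for i
    using sorted_wrt_nth_less[OF sorted, of i "Suc i"] that len by simp
  have "\<exists>y. y \<in> polys_in V \<and> y \<in> Ps ! Suc i - Ps ! i" if i: "i < r" for i
  proof -
    obtain y where y: "y \<in> Ps ! Suc i" "y \<notin> Ps ! i" using step[OF i] by blast
    have "Ps ! 0 \<subseteq> Ps ! i" using sorted_wrt_nth_less[OF sorted, of 0 i] i len by (cases "i = 0") auto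
    then have vars: "mvar j \<in> Ps ! i" if "j \<notin> V" for j using V[OF that] by blast
    have pr: "prime_id (Ps ! i)" "prime_id (Ps ! Suc i)" using prime i len by auto
    have d: "y - restrict_vars V y \<in> Ps ! i"
      by (rule diff_restrict_vars[OF prime_id_subspace[OF pr(1)] vars])
    then have "restrict_vars V y \<notin> Ps ! i"
      using y(2) rmod.subspace_add[OF prime_id_subspace[OF pr(1)] d, of "restrict_vars V y"] by auto
    moreover have "y - restrict_vars V y \<in> Ps ! Suc i" using d step[OF i] by blast
    from rmod.subspace_diff[OF prime_id_subspace[OF pr(2)] y(1) this]
    have "restrict_vars V y \<in> Ps ! Suc i" by simp
    ultimately show ?thesis using restrict_vars_in by blast
  qed
  then obtain y where y: "\<And>i. i < r \<Longrightarrow> y i \<in> polys_in V \<and> y i \<in> Ps ! Suc i - Ps ! i" by metis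
  define ys where "ys = map y [0..<l]"
  have lr: "l \<le> r" using r by (simp add: l_def)
  have "set ys \<subseteq> polys_in V" using y lr by (auto simp: ys_def)
  then obtain N c where c: "\<exists>es\<in>exponents N (length ys). c es \<noteq> 0"
    "(\<Sum>es\<in>exponents N (length ys). mconst (c es) * power_product ys es) = 0"
    using algebraically_dependent[OF fin, of ys] by (auto simp: ys_def l_def)
  have "(\<Sum>es\<in>exponents N (length ys). mconst (c es) * power_product ys es) \<notin> take (Suc l) Ps ! 0"
  proof (rule no_relation_along_prime_chain[OF _ _ _ c(1)])
    show "length (take (Suc l) Ps) = Suc (length ys)" using lr len by (simp add: ys_def)
    show "prime_id Q" if "Q \<in> set (take (Suc l) Ps)" for Q
      using that prime set_take_subset[of "Suc l" Ps] by blast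
    show "take (Suc l) Ps ! i \<subseteq> take (Suc l) Ps ! Suc i \<and>
        ys ! i \<in> take (Suc l) Ps ! Suc i - take (Suc l) Ps ! i" if "i < length ys" for i
      using that y[of i] step[of i] lr by (auto simp: ys_def)
  qed
  moreover have "prime_id (Ps ! 0)" using prime len by auto
  ultimately show False using c(2) rmod.subspace_0[OF prime_id_subspace] by auto
qed

section \<open>Regular sequences on Stanley-Reisner rings\<close>

definition esym :: "nat set \<Rightarrow> nat \<Rightarrow> ('k::field) mpolynomial" where
  "esym V j = (\<Sum>T | T \<subseteq> V \<and> card T = j. \<Prod>i\<in>T. mvar i)"

text \<open>Highest degree first, since \<open>esym V m\<close> becomes a single monomial once only
  \<open>m\<close> variables survive.\<close>

fun esyms :: "nat set \<Rightarrow> nat \<Rightarrow> ('k::field) mpolynomial list" where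
  "esyms V 0 = []"
| "esyms V (Suc m) = esym V (Suc m) # esyms V m"

lemma length_esyms: "length (esyms V m) = m"
  by (induction m) auto

lemma esym_in_ideal:
  assumes J: "rmod.subspace J" and V: "finite V" "\<And>i. i \<in> V \<Longrightarrow> mvar i \<in> J" and j: "j > 0"
  shows "esym V j \<in> J"
  unfolding esym_def
proof (rule rmod.subspace_sum[OF J])
  fix T assume T: "T \<in> {T. T \<subseteq> V \<and> card T = j}"
  then have "finite T" "T \<noteq> {}" using V(1) j finite_subset by auto
  then obtain i where i: "i \<in> T" "finite T" by blast
  then have "(\<Prod>i\<in>T. mvar i) = (\<Prod>i\<in>T - {i}. mvar i) * mvar i"
    by (simp add: prod.remove mult.commute)
  moreover have "i \<in> V" using T i by auto
  then have "(\<Prod>i\<in>T - {i}. mvar i) * mvar i \<in> J" by (intro rmod.subspace_scale[OF J] V(2))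
  ultimately show "(\<Prod>i\<in>T. mvar i) \<in> J" by metis
qed

lemma esyms_in_ideal:
  assumes "rmod.subspace J" "finite V" "\<And>i. i \<in> V \<Longrightarrow> mvar i \<in> J"
  shows "set (esyms V m) \<subseteq> J"
  using esym_in_ideal[OF assms] by (induction m) auto

lemma mvar_nonzerodivisor:
  "X \<subseteq> polys_in (- {i}) \<Longrightarrow> mvar i * r \<in> rmod.span X \<Longrightarrow> r \<in> rmod.span X"
  using uni_nonzerodivisor[of X i "[:0, 1:]" r] by (simp add: uni_X)

lemma prod_mvar_nonzerodivisor:
  assumes "finite T" "X \<subseteq> polys_in (- T)" "(\<Prod>i\<in>T. mvar i) * r \<in> rmod.span X"
  shows "r \<in> rmod.span X"
  using assms
proof (induction T rule: finite_induct)
  case (insert i T)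
  have "X \<subseteq> polys_in (- {i})" "X \<subseteq> polys_in (- T)"
    using insert.prems(1) polys_in_mono[of "- insert i T" "- {i}"] polys_in_mono[of "- insert i T" "- T"] by auto
  moreover have "mvar i * ((\<Prod>i\<in>T. mvar i) * r) \<in> rmod.span X"
    using insert by (simp add: mult.assoc)
  ultimately show ?case using insert.IH mvar_nonzerodivisor by blast
qed simp

lemma span_insert_cong:
  assumes J: "rmod.subspace J" and "a - b \<in> J"
  shows "rmod.span (insert a J) = rmod.span (insert b J)"
proof -
  have sub: "rmod.span (insert a J) \<subseteq> rmod.span (insert b J)" if "a - b \<in> J" for a b
  proof (rule rmod.span_minimal)
    have "a = (a - b) + b" by simp
    also have "\<dots> \<in> rmod.span (insert b J)"
      using that by (intro rmod.span_add rmod.span_base) auto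
    finally show "insert a J \<subseteq> rmod.span (insert b J)" by (auto intro: rmod.span_base)
  qed simp
  have "b - a \<in> J" using rmod.subspace_neg[OF J assms(2)] by simp
  then show ?thesis using sub assms(2) by blast
qed

lemma span_insert_member: "x \<in> rmod.span Y \<Longrightarrow> rmod.span (insert x Y) = rmod.span Y"
  using span_insert_span[of x Y] by (simp add: insert_absorb rmod.span_span)

lemma span_eq_UNIV: "1 \<in> rmod.span X \<Longrightarrow> rmod.span X = UNIV"
  using rmod.span_scale[of 1 X] by auto

text \<open>Modulo the variables outside \<open>W\<close>, the first element is the product of the variables in \<open>W\<close>;
  modulo this product the ring is filtered by the rings where one more variable is zero.\<close>

lemma weakly_regular_esyms:
  fixes X :: "('k::field) mpolynomial set"
  assumes "finite V" "W \<subseteq> V" "card W = m" "X \<subseteq> polys_in (- W)"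
    and "\<And>z. z \<in> V - W \<Longrightarrow> mvar z \<in> rmod.span X"
  shows "weakly_regular (rmod.span X) (esyms V m)"
  using assms
proof (induction m arbitrary: W X)
  case (Suc m)
  let ?J = "rmod.span X"
  let ?pr = "\<lambda>T. \<Prod>i\<in>T. (mvar i :: 'k mpolynomial)"
  have finW: "finite W" using Suc.prems finite_subset by blast
  have J: "rmod.subspace ?J" by simp
  have "esym V (Suc m) = (\<Sum>T\<in>{T. T \<subseteq> V \<and> card T = Suc m} - {W}. ?pr T) + ?pr W"
    unfolding esym_def using Suc.prems by (subst sum.remove[of _ W]) auto
  moreover have "(\<Sum>T\<in>{T. T \<subseteq> V \<and> card T = Suc m} - {W}. ?pr T) \<in> ?J"
  proof (rule rmod.span_sum)
    \<comment> \<open>As \<open>T\<close> has the size of \<open>W\<close> and differs from it, it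
      contains a variable that is zero modulo \<open>?J\<close>.\<close>
    fix T assume T: "T \<in> {T. T \<subseteq> V \<and> card T = Suc m} - {W}"
    then have "\<not> T \<subseteq> W" using card_subset_eq[OF finW, of T] Suc.prems by auto
    then obtain z where z: "z \<in> T" "z \<in> V - W" using T by auto
    have "finite T" using T Suc.prems(1) finite_subset by auto
    then have "?pr T = ?pr (T - {z}) * mvar z" using z by (simp add: prod.remove mult.commute)
    then show "?pr T \<in> ?J" using rmod.span_scale[OF Suc.prems(5)[OF z(2)]] by metis
  qed
  ultimately have cong: "esym V (Suc m) - ?pr W \<in> ?J" by simp
  have nzd: "r \<in> ?J" if "T \<subseteq> W" "?pr T * r \<in> ?J" for T r
    using that prod_mvar_nonzerodivisor[of T X r] finW finite_subset[of T W]
      Suc.prems(4) polys_in_mono[of "- W" "- T"] by blast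
  \<comment> \<open>The factors of the product over \<open>T\<close> are split off one at a time.
    For the ideal with \<open>x_i x_T\<close>, the colon by \<open>x_T\<close> sets
    \<open>x_i\<close> to zero and falls under the outer induction; adding \<open>x_T\<close> falls
    under the inner one. The empty product gives the unit ideal.\<close>
  have filt: "weakly_regular (rmod.span (insert (?pr T) ?J)) (esyms V m)" if "T \<subseteq> W" for T
  proof -
    have "finite T" using that finW finite_subset by blast
    then show ?thesis using that
    proof (induction T rule: finite_induct)
      case empty
      have "rmod.span (insert 1 ?J) = UNIV" by (intro span_eq_UNIV rmod.span_base) auto
      then show ?case by (simp add: weakly_regular_UNIV)
    next
      case (insert i T)
      let ?K = "rmod.span (insert (?pr (insert i T)) ?J)"
      have pr: "?pr (insert i T) = mvar i * ?pr T" using insert.hyps by simp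
      have "{r. ?pr T * r \<in> ?K} = rmod.span (insert (mvar i) X)"
      proof (rule Set.set_eqI)
        fix r
        have "r \<in> {r. ?pr T * r \<in> ?K} \<longleftrightarrow> (\<exists>k. ?pr T * r - k * (mvar i * ?pr T) \<in> ?J)"
          by (simp only: mem_Collect_eq in_span_insert_subspace[OF J] pr)
        also have "\<dots> \<longleftrightarrow> (\<exists>k. ?pr T * (r - k * mvar i) \<in> ?J)"
          by (simp add: algebra_simps)
        also have "\<dots> \<longleftrightarrow> (\<exists>k. r - k * mvar i \<in> ?J)"
          using nzd[of T] insert.prems rmod.span_scale by blast
        also have "\<dots> \<longleftrightarrow> r \<in> rmod.span (insert (mvar i) X)"
          by (simp only: rmod.span_breakdown_eq)
        finally show "r \<in> {r. ?pr T * r \<in> ?K} \<longleftrightarrow> r \<in> rmod.span (insert (mvar i) X)" .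
      qed
      moreover have "weakly_regular (rmod.span (insert (mvar i) X)) (esyms V m)"
      proof (rule Suc.IH[OF Suc.prems(1)])
        show "W - {i} \<subseteq> V" using Suc.prems(2) by auto
        show "card (W - {i}) = m" using insert.prems Suc.prems(3) finW by simp
        show "insert (mvar i) X \<subseteq> polys_in (- (W - {i}))"
          using order_trans[OF Suc.prems(4) polys_in_mono[of "- W" "- (W - {i})"]] mvar_in[of i "- (W - {i})"]
          by auto
        show "mvar z \<in> rmod.span (insert (mvar i) X)" if "z \<in> V - (W - {i})" for z
          using that Suc.prems(5)[of z] rmod.span_mono[of X "insert (mvar i) X"]
          by (cases "z = i") (auto intro: rmod.span_base)
      qed
      moreover have "rmod.span (insert (?pr T) ?K) = rmod.span (insert (?pr T) ?J)"
      proof -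
        have "?pr (insert i T) \<in> rmod.span (insert (?pr T) ?J)"
          unfolding pr by (intro rmod.span_scale rmod.span_base) simp
        then have "rmod.span (insert (?pr (insert i T)) (insert (?pr T) ?J)) = rmod.span (insert (?pr T) ?J)"
          by (rule span_insert_member)
        then show ?thesis
          unfolding span_insert_span[of "?pr T" "insert (?pr (insert i T)) ?J"] by (subst insert_commute)
      qed
      ultimately show ?case
        using insert.IH insert.prems weakly_regular_colon_sum[of ?K "?pr T" "esyms V m"]
        by (simp only: rmod.subspace_span insert_subset simp_thms)
    qed
  qed
  show ?case unfolding esyms.simps
  proof (rule weakly_regular_ConsI)
    fix r assume r: "esym V (Suc m) * r \<in> ?J"
    from rmod.span_diff[OF r rmod.span_scale[OF cong, of r]] have "?pr W * r \<in> ?J"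
      by (simp add: algebra_simps)
    then show "r \<in> ?J" using nzd by blast
  next
    show "weakly_regular (rmod.span (insert (esym V (Suc m)) ?J)) (esyms V m)"
      using filt[of W] span_insert_cong[OF J cong] by simp
  qed
qed simp

text \<open>For \<open>i\<close> in \<open>F\<close> the variable \<open>x_i\<close> is free and
  \<open>f_i(x_i)\<close> is regular. Otherwise \<open>x_i\<close> is zero and
  \<open>f_i(x_i)\<close> is congruent to the unit \<open>f_i(0)\<close>, so the quotient becomes
  zero and the rest of the list is trivially regular. Hence \<open>zs\<close> has to be examined
  only when \<open>us\<close> lies in \<open>F\<close>.\<close>

lemma weakly_regular_unis_append:
  fixes X :: "('k::field) mpolynomial set"
  assumes "distinct us" "X \<subseteq> polys_in (- (set us \<inter> F))"
    and "\<And>z. z \<notin> F \<Longrightarrow> mvar z \<in> rmod.span X"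
    and "\<And>i. i \<in> set us \<Longrightarrow> coeff (f i) 0 \<noteq> 0"
    and "set us \<subseteq> F \<Longrightarrow> weakly_regular (rmod.span (X \<union> (\<lambda>i. uni (f i) i) ` set us)) zs"
  shows "weakly_regular (rmod.span X) (map (\<lambda>i. uni (f i) i) us @ zs)"
  using assms
proof (induction us arbitrary: X)
  case (Cons i us)
  let ?y = "uni (f i) i"
  have fi: "coeff (f i) 0 \<noteq> 0" using Cons.prems(4) by simp
  have "weakly_regular (rmod.span X) (?y # (map (\<lambda>i. uni (f i) i) us @ zs))"
  proof (cases "i \<in> F")
    case True
    have Xi: "X \<subseteq> polys_in (- {i})"
      using Cons.prems(2) True polys_in_mono[of "- (set (i # us) \<inter> F)" "- {i}"] by auto
    have "f i \<noteq> 0" using fi by auto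
    note nzd = uni_nonzerodivisor[OF Xi this]
    have "weakly_regular (rmod.span (insert ?y X)) (map (\<lambda>i. uni (f i) i) us @ zs)"
    proof (rule Cons.IH)
      show "distinct us" using Cons.prems(1) by simp
      show "insert ?y X \<subseteq> polys_in (- (set us \<inter> F))"
        using Cons.prems(1,2) polys_in_mono[of "- (set (i # us) \<inter> F)" "- (set us \<inter> F)"]
          uni_in[of i "- (set us \<inter> F)"] by auto
      show "mvar z \<in> rmod.span (insert ?y X)" if "z \<notin> F" for z
        using Cons.prems(3)[OF that] rmod.span_mono[of X "insert ?y X"] by auto
      show "coeff (f j) 0 \<noteq> 0" if "j \<in> set us" for j using that Cons.prems(4) by simp
      assume "set us \<subseteq> F"
      then show "weakly_regular (rmod.span (insert ?y X \<union> (\<lambda>i. uni (f i) i) ` set us)) zs"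
        using Cons.prems(5) True by simp
    qed
    then show ?thesis using nzd by (intro weakly_regular_ConsI) (simp_all add: span_insert_span)
  next
    case False
    obtain g where f: "f i = pCons (coeff (f i) 0) g" by (metis coeff_pCons_0 pCons_cases)
    have x: "mvar i \<in> rmod.span X" by (rule Cons.prems(3)[OF False])
    have "?y = mconst (coeff (f i) 0) + mvar i * uni g i" by (subst f) (simp add: uni_pCons)
    then have y: "?y - mconst (coeff (f i) 0) \<in> rmod.span X"
      using rmod.span_scale[OF x, of "uni g i"] by (simp add: mult.commute)
    have inv: "r \<in> rmod.span Y" if "mconst (coeff (f i) 0) * r \<in> rmod.span Y" for r Y
      using rmod.span_scale[OF that, of "mconst (inverse (coeff (f i) 0))"] mconst_inverse[OF fi]
      by (simp add: mult.assoc[symmetric])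
    have "r \<in> rmod.span X" if r: "?y * r \<in> rmod.span X" for r
    proof (rule inv)
      show "mconst (coeff (f i) 0) * r \<in> rmod.span X"
        using rmod.span_diff[OF r rmod.span_scale[OF y, of r]] by (simp add: algebra_simps)
    qed
    moreover have "rmod.span (insert ?y (rmod.span X)) = UNIV"
      unfolding span_insert_cong[OF rmod.subspace_span y]
      by (rule span_eq_UNIV, rule inv, rule rmod.span_base) simp
    ultimately show ?thesis by (intro weakly_regular_ConsI) (simp_all add: weakly_regular_UNIV)
  qed
  then show ?case by simp
qed simp

text \<open>The list depends on \<open>F\<close> only through \<open>card F\<close>, so one list
  serves all faces of this size. When \<open>us\<close> lies in \<open>F\<close>, exactly
  \<open>card F - length us\<close> variables survive, as the list of \<open>esyms\<close>
  requires.\<close>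

lemma weakly_regular_face:
  fixes f :: "nat \<Rightarrow> ('k::field) poly"
  assumes F: "finite F" "F \<subseteq> V \<union> set us" and V: "finite V" "V \<inter> set us = {}"
    and us: "distinct us" "\<And>i. i \<in> set us \<Longrightarrow> coeff (f i) 0 \<noteq> 0"
  shows "weakly_regular (rmod.span (mvar ` (- F))) (map (\<lambda>i. uni (f i) i) us @ esyms V (card F - length us))"
proof (rule weakly_regular_unis_append[OF us(1) _ _ us(2)])
  show "mvar ` (- F) \<subseteq> (polys_in (- (set us \<inter> F)) :: 'k mpolynomial set)"
    by (auto intro!: mvar_in)
  show "mvar z \<in> rmod.span (mvar ` (- F) :: 'k mpolynomial set)" if "z \<notin> F" for z
    using that by (intro rmod.span_base) auto
  assume sub: "set us \<subseteq> F"
  show "weakly_regular (rmod.span (mvar ` (- F) \<union> (\<lambda>i. uni (f i) i) ` set us)) (esyms V (card F - length us))"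
  proof (rule weakly_regular_esyms[OF V(1)])
    show "F - set us \<subseteq> V" using F by auto
    show "card (F - set us) = card F - length us"
      using sub us(1) by (simp add: card_Diff_subset distinct_card)
    show "mvar ` (- F) \<union> (\<lambda>i. uni (f i) i) ` set us \<subseteq> polys_in (- (F - set us))"
      by (auto intro!: mvar_in uni_in)
    show "mvar z \<in> rmod.span (mvar ` (- F) \<union> (\<lambda>i. uni (f i) i) ` set us)" if "z \<in> V - (F - set us)" for z
      using that V(2) by (intro rmod.span_base) auto
  qed
qed

text \<open>Ideals \<open>J\<close> such that the quotient is an iterated extension of polynomial rings in \<open>d\<close> of the
  variables \<open>x\<^sub>1, \<dots>, x\<^sub>n\<close>.\<close>

inductive face_filtered :: "nat \<Rightarrow> nat \<Rightarrow> ('k::field) mpolynomial set \<Rightarrow> bool" for n d where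
  unit: "face_filtered n d UNIV"
| face: "F \<subseteq> {1..n} \<Longrightarrow> card F = d \<Longrightarrow> face_filtered n d (rmod.span (mvar ` (- F)))"
| extension: "rmod.subspace J \<Longrightarrow> face_filtered n d {r. g * r \<in> J} \<Longrightarrow>
    face_filtered n d (rmod.span (insert g J)) \<Longrightarrow> face_filtered n d J"

lemma weakly_regular_face_filtered:
  assumes "face_filtered n d J" and V: "{1..n} \<subseteq> V \<union> set us" "finite V" "V \<inter> set us = {}"
    and us: "distinct us" "\<And>i. i \<in> set us \<Longrightarrow> coeff (f i) 0 \<noteq> 0"
  shows "weakly_regular J (map (\<lambda>i. uni (f i) i) us @ esyms V (d - length us))"
  using assms(1)
proof induction
  case unit
  show ?case by (rule weakly_regular_UNIV)
next
  case (face F)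
  then show ?case
    using weakly_regular_face[of F V us f] V us finite_subset[of F "{1..n}"] by blast
next
  case (extension J g)
  show ?case by (rule weakly_regular_colon_sum[OF extension.hyps(1) extension.IH])
qed

section \<open>Quotients of the polynomial ring as records\<close>

text \<open>A ring given as a record is reached by a surjection from the polynomial type. Its ideals
  become ideals containing the kernel \<open>K\<close>, and the algebra takes place in the
  type.\<close>

locale quotient_map = cring R for R (structure) +
  fixes \<psi> :: "('k::field) mpolynomial \<Rightarrow> 'a" and K :: "'k mpolynomial set"
  assumes psi_add: "\<psi> (a + b) = \<psi> a \<oplus> \<psi> b" and psi_mult: "\<psi> (a * b) = \<psi> a \<otimes> \<psi> b"
    and psi_one: "\<psi> 1 = \<one>" and range_psi: "range \<psi> = carrier R"
    and kernel: "\<psi> a = \<zero> \<longleftrightarrow> a \<in> K"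
begin

lemma psi_closed [simp]: "\<psi> a \<in> carrier R"
  using range_psi by auto

lemma psi_zero: "\<psi> 0 = \<zero>"
  using psi_add[of 0 0] by (metis add.l_cancel_one' add_0 psi_closed)

lemma psi_minus: "\<psi> (- a) = \<ominus> \<psi> a"
  using psi_add[of "- a" a] psi_zero by (intro minus_equality[symmetric]) auto

lemma psi_eq_iff: "\<psi> a = \<psi> b \<longleftrightarrow> a - b \<in> K"
proof -
  have "\<psi> (a - b) = \<psi> a \<ominus> \<psi> b"
    using psi_add[of a "- b"] by (simp add: psi_minus a_minus_def)
  then show ?thesis using kernel[of "a - b"] by (simp add: r_right_minus_eq)
qed

lemma subspace_kernel: "rmod.subspace K"
proof (rule rmod.subspaceI)
  show "0 \<in> K" using kernel psi_zero by blast
  show "x + y \<in> K" if "x \<in> K" "y \<in> K" for x y using that by (simp flip: kernel add: psi_add)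
  show "c * x \<in> K" if "x \<in> K" for c x using that by (simp flip: kernel add: psi_mult)
qed

lemma subspace_vimage_ideal:
  assumes "ideal I R"
  shows "rmod.subspace (\<psi> -` I)" "K \<subseteq> \<psi> -` I"
proof -
  interpret I: ideal I R by fact
  show "rmod.subspace (\<psi> -` I)"
    by (rule rmod.subspaceI) (auto simp: psi_zero psi_add psi_mult I.I_l_closed)
  show "K \<subseteq> \<psi> -` I" using I.zero_closed by (auto simp flip: kernel)
qed

lemma psi_vimage: "I \<subseteq> carrier R \<Longrightarrow> \<psi> ` (\<psi> -` I) = I"
  using range_psi by auto

lemma psi_in_image_iff: "rmod.subspace J \<Longrightarrow> K \<subseteq> J \<Longrightarrow> \<psi> a \<in> \<psi> ` J \<longleftrightarrow> a \<in> J"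
  by (auto simp: psi_eq_iff) (metis add.commute diff_add_cancel rmod.subspace_add subsetD)

lemma ideal_image:
  assumes J: "rmod.subspace J"
  shows "ideal (\<psi> ` J) R"
proof (rule idealI[OF ring_axioms])
  show "subgroup (\<psi> ` J) (add_monoid R)"
  proof (rule add.subgroupI)
    show "\<psi> ` J \<noteq> {}" using rmod.subspace_0[OF J] by auto
    show "\<ominus> a \<in> \<psi> ` J" if "a \<in> \<psi> ` J" for a
      using that rmod.subspace_neg[OF J] by (auto simp flip: psi_minus)
    show "a \<oplus> b \<in> \<psi> ` J" if "a \<in> \<psi> ` J" "b \<in> \<psi> ` J" for a b
      using that rmod.subspace_add[OF J] by (auto simp flip: psi_add)
  qed auto
  fix a x assume "a \<in> \<psi> ` J" "x \<in> carrier R"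
  then obtain b y where eq: "a = \<psi> b" "b \<in> J" "x = \<psi> y" unfolding range_psi[symmetric] by blast
  show "x \<otimes> a \<in> \<psi> ` J" using eq rmod.subspace_scale[OF J eq(2)] by (simp flip: psi_mult)
  show "a \<otimes> x \<in> \<psi> ` J" using eq rmod.subspace_scale[OF J eq(2)]
    by (simp flip: psi_mult add: mult.commute[of b])
qed

lemma genideal_image: "genideal R (\<psi> ` X) = \<psi> ` rmod.span (X \<union> K)"
proof
  have "\<psi> ` X \<subseteq> \<psi> ` rmod.span (X \<union> K)" by (auto intro: rmod.span_base)
  then show "genideal R (\<psi> ` X) \<subseteq> \<psi> ` rmod.span (X \<union> K)"
    by (intro genideal_minimal ideal_image) auto
  have "ideal (genideal R (\<psi> ` X)) R" by (intro genideal_ideal) auto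
  note V = subspace_vimage_ideal[OF this]
  have "X \<subseteq> \<psi> -` genideal R (\<psi> ` X)" using genideal_self[of "\<psi> ` X"] by fastforce
  then have "rmod.span (X \<union> K) \<subseteq> \<psi> -` genideal R (\<psi> ` X)"
    using V by (intro rmod.span_minimal) auto
  then show "\<psi> ` rmod.span (X \<union> K) \<subseteq> genideal R (\<psi> ` X)" by auto
qed

lemma prime_id_vimage:
  assumes "primeideal I R"
  shows "prime_id (\<psi> -` I)"
proof -
  interpret I: primeideal I R by fact
  have "\<one> \<notin> I" using I.one_imp_carrier I.I_notcarr by auto
  then show ?thesis
    using subspace_vimage_ideal(1)[OF I.is_ideal] I.I_prime
    by (auto simp: prime_id_def psi_one psi_mult)
qed

lemma primeideal_image:
  assumes J: "prime_id J" "K \<subseteq> J"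
  shows "primeideal (\<psi> ` J) R"
proof (rule primeidealI[OF ideal_image[OF prime_id_subspace[OF J(1)]] is_cring])
  note iff = psi_in_image_iff[OF prime_id_subspace[OF J(1)] J(2)]
  have "\<psi> 1 \<notin> \<psi> ` J" using iff prime_id_one[OF J(1)] by blast
  then show "carrier R \<noteq> \<psi> ` J" by auto
  fix a b assume ab: "a \<in> carrier R" "b \<in> carrier R" "a \<otimes> b \<in> \<psi> ` J"
  then obtain a' b' where "a = \<psi> a'" "b = \<psi> b'" using range_psi by blast
  then show "a \<in> \<psi> ` J \<or> b \<in> \<psi> ` J"
    using ab(3) J(1) by (simp add: iff prime_id_mult_iff flip: psi_mult)
qed

lemma maximal_vimage:
  assumes "maximalideal I R"
  shows "prime_id (\<psi> -` I)" "a \<notin> \<psi> -` I \<Longrightarrow> \<exists>b. b * a - 1 \<in> \<psi> -` I"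
proof -
  interpret I: maximalideal I R by fact
  show "prime_id (\<psi> -` I)" by (rule prime_id_vimage[OF maximalideal_prime[OF assms]])
  note V = subspace_vimage_ideal[OF I.is_ideal]
  assume a: "a \<notin> \<psi> -` I"
  let ?J = "\<psi> ` rmod.span (insert a (\<psi> -` I))"
  have "I = \<psi> ` (\<psi> -` I)" using I.a_subset psi_vimage by simp
  also have "\<dots> \<subseteq> ?J" by (auto intro: rmod.span_base)
  finally have "?J = I \<or> ?J = carrier R" by (intro I.I_maximal ideal_image) auto
  moreover have "\<psi> a \<in> ?J" by (auto intro: rmod.span_base)
  ultimately have "\<psi> 1 \<in> ?J" using a by auto
  then have "1 \<in> rmod.span (insert a (\<psi> -` I))"
    using V(2) by (subst (asm) psi_in_image_iff) (auto intro: rmod.span_base)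
  then obtain k where "1 - k * a \<in> \<psi> -` I" by (auto simp: in_span_insert_subspace[OF V(1)])
  from rmod.subspace_neg[OF V(1) this] show "\<exists>b. b * a - 1 \<in> \<psi> -` I" by (intro exI[of _ k]) simp
qed

lemma regular_seq_map_iff:
  "regular_seq R (map \<psi> ys) \<longleftrightarrow> weakly_regular K ys \<and> 1 \<notin> rmod.span (set ys \<union> K)"
proof -
  have in_iff: "\<psi> a \<in> genideal R (\<psi> ` X) \<longleftrightarrow> a \<in> rmod.span (X \<union> K)" for a X
    unfolding genideal_image by (rule psi_in_image_iff) (auto intro: rmod.span_base)
  have take: "set (take i (map \<psi> ys)) = \<psi> ` set (take i ys)" for i
    by (simp add: take_map)
  have "genideal R (set (map \<psi> ys)) \<noteq> carrier R \<longleftrightarrow> 1 \<notin> rmod.span (set ys \<union> K)"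
  proof -
    have "ideal (genideal R (\<psi> ` set ys)) R" by (intro genideal_ideal) auto
    then have "genideal R (\<psi> ` set ys) = carrier R \<longleftrightarrow> \<one> \<in> genideal R (\<psi> ` set ys)"
      using ideal.one_imp_carrier by blast
    then show ?thesis using in_iff[of 1 "set ys"] by (simp add: psi_one)
  qed
  moreover have "(\<forall>r\<in>carrier R. map \<psi> ys ! i \<otimes> r \<in> genideal R (set (take i (map \<psi> ys))) \<longrightarrow>
        r \<in> genideal R (set (take i (map \<psi> ys)))) \<longleftrightarrow>
      (\<forall>r. ys ! i * r \<in> rmod.span (set (take i ys) \<union> K) \<longrightarrow> r \<in> rmod.span (set (take i ys) \<union> K))"
    if "i < length ys" for i
    using that unfolding take range_psi[symmetric] by (simp add: in_iff flip: psi_mult)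
  moreover have "set (map \<psi> ys) \<subseteq> carrier R" by auto
  ultimately show ?thesis
    unfolding regular_seq_def weakly_regular_iff_nth[OF subspace_kernel] by simp
qed

text \<open>Setting the variables outside \<open>V\<close> to zero preserves classes modulo
  \<open>K\<close>. So an ideal is generated by generators of its trace on
  \<open>polys_in V\<close>, which the Hilbert basis theorem provides.\<close>

lemma noetherian_quotient:
  assumes V: "finite V" "\<And>i. i \<notin> V \<Longrightarrow> mvar i \<in> K"
  shows "noetherian_ring R"
proof (rule noetherian_ringI)
  fix I assume I: "ideal I R"
  note J = subspace_vimage_ideal[OF I]
  let ?J = "\<psi> -` I \<inter> polys_in V"
  have "ideal_in (polys_in V) ?J"
    unfolding ideal_in_def
  proof (intro conjI ballI)
    note S = subring_ofD[OF subring_of_polys_in]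
    show "?J \<subseteq> polys_in V" by simp
    show "0 \<in> ?J" using rmod.subspace_0[OF J(1)] S(2) by blast
    show "x + y \<in> ?J" if "x \<in> ?J" "y \<in> ?J" for x y
      using that by (intro IntI rmod.subspace_add[OF J(1)] S(3)) (blast+)
    show "a * x \<in> ?J" if "a \<in> polys_in V" "x \<in> ?J" for a x
      using that by (intro IntI rmod.subspace_scale[OF J(1)] S(4)) (blast+)
  qed
  then obtain X where X: "X \<subseteq> ?J" "finite X" "?J \<subseteq> combinations (polys_in V) X"
    using noetherian_polys_in[OF V(1)] by (auto simp: noetherian_subring_def)
  interpret I: ideal I R by fact
  have "I = genideal R (\<psi> ` X)"
  proof
    show "genideal R (\<psi> ` X) \<subseteq> I" using X(1) by (intro genideal_minimal I) auto
    show "I \<subseteq> genideal R (\<psi> ` X)"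
    proof
      fix y assume y: "y \<in> I"
      then obtain a where a: "y = \<psi> a" using range_psi I.a_subset by blast
      let ?b = "restrict_vars V a"
      have d: "a - ?b \<in> K" by (rule diff_restrict_vars[OF subspace_kernel V(2)])
      then have eq: "\<psi> ?b = y" using a psi_eq_iff[of a ?b] by simp
      then have "?b \<in> ?J" using y restrict_vars_in by auto
      then obtain u where u: "?b = (\<Sum>x\<in>X. u x * x)" using X(3) by (auto simp: combinations_def)
      have "?b \<in> rmod.span (X \<union> K)"
        unfolding u by (intro rmod.span_sum rmod.span_scale rmod.span_base) auto
      then show "y \<in> genideal R (\<psi> ` X)" unfolding genideal_image using eq by auto
    qed
  qed
  then show "\<exists>A\<subseteq>carrier R. finite A \<and> I = genideal R A" using X(2) by (intro exI[of _ "\<psi> ` X"]) auto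
qed

text \<open>The hypothesis \<open>faces\<close> acts twice: at the bottom of a prime chain it bounds
  the number of variables that remain, hence the height; at \<open>M\<close> it gives the list
  \<open>ys\<close> the exact length \<open>d\<close>.\<close>

theorem cohen_macaulay_quotient:
  assumes filt: "face_filtered n d K" and V: "\<And>i. i \<notin> {1..n} \<Longrightarrow> mvar i \<in> K"
    and faces: "\<And>M. prime_id M \<Longrightarrow> K \<subseteq> M \<Longrightarrow> card {i \<in> {1..n}. mvar i \<notin> M} \<le> d"
  shows "cohen_macaulay_ring R"
  unfolding cohen_macaulay_ring_def
proof (intro conjI allI impI is_cring)
  show "noetherian_ring R" using noetherian_quotient[of "{1..n}"] V by auto
  fix M assume M: "maximalideal M R"
  let ?M = "\<psi> -` M"
  interpret M: maximalideal M R by fact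
  have KM: "K \<subseteq> ?M" by (rule subspace_vimage_ideal[OF M.is_ideal])
  note pM = maximal_vimage(1)[OF M] and max = maximal_vimage(2)[OF M]
  have Mc: "M \<subseteq> carrier R" by (rule M.a_subset)
  note Ms = prime_id_subspace[OF pM]
  have VM: "mvar i \<in> ?M" if "i \<notin> {1..n}" for i using V[OF that] KM by blast
  have prime_le: "prime_height R M \<le> enat d"
    unfolding prime_height_def
  proof (rule Sup_least, clarify)
    fix r Ps assume len: "length Ps = Suc r" and sorted: "sorted_wrt (\<subset>) Ps"
      and pr: "\<forall>Q\<in>set Ps. primeideal Q R"
    let ?Qs = "map (\<lambda>Q. \<psi> -` Q) Ps"
    \<comment> \<open>The variables outside \<open>?F\<close> lie in the smallest prime, hence in
      every prime of the chain.\<close>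
    let ?F = "{i \<in> {1..n}. mvar i \<notin> ?Qs ! 0}"
    have car: "Q \<subseteq> carrier R" if "Q \<in> set Ps" for Q
      using pr that by (auto dest!: primeideal.axioms(1) ideal.axioms(1) additive_subgroup.a_subset)
    have pQ: "prime_id Q" "K \<subseteq> Q" if Q: "Q \<in> set ?Qs" for Q
    proof -
      obtain A where "A \<in> set Ps" "Q = \<psi> -` A" using Q by auto
      then show "prime_id Q" "K \<subseteq> Q"
        using pr prime_id_vimage subspace_vimage_ideal(2)[OF primeideal.axioms(1)] by blast+
    qed
    have "sorted_wrt (\<subset>) ?Qs"
      unfolding sorted_wrt_map
    proof (rule sorted_wrt_mono_rel[OF _ sorted])
      fix A B assume AB: "A \<in> set Ps" "B \<in> set Ps" "A \<subset> B"
      then obtain b where "b \<in> B" "b \<notin> A" by blast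
      moreover obtain b' where "b = \<psi> b'" using calculation car[OF AB(2)] range_psi by blast
      ultimately show "\<psi> -` A \<subset> \<psi> -` B" using AB(3) by auto
    qed
    then have "r \<le> card ?F"
    proof (rule prime_chain_length[rotated 2])
      show "mvar i \<in> ?Qs ! 0" if "i \<notin> ?F" for i
        using that V pQ(2)[of "?Qs ! 0"] len by (cases "i \<in> {1..n}") auto
    qed (use len pQ in auto)
    also have "\<dots> \<le> d" using pQ[of "?Qs ! 0"] len by (intro faces) auto
    finally show "enat r \<le> enat d" by simp
  qed
  have depth_ge: "enat d \<le> ideal_depth R M"
  proof -
    define U where "U = {i \<in> {1..n}. mvar i \<notin> ?M}"
    define us where "us = sorted_list_of_set U"
    have finU: "finite U" by (simp add: U_def)
    have us: "set us = U" "distinct us" "length us = card U" using finU by (simp_all add: us_def)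
    have "\<exists>f. coeff f 0 \<noteq> 0 \<and> uni f i \<in> ?M" if "i \<in> U" for i
    proof -
      have "\<exists>f. f \<noteq> 0 \<and> uni f i \<in> ?M"
        by (rule uni_in_maximal[OF pM max finite_atLeastAtMost VM])
      then obtain f where "f \<noteq> 0" "uni f i \<in> ?M" by blast
      moreover have "mvar i \<notin> ?M" using \<open>i \<in> U\<close> unfolding U_def by blast
      ultimately show ?thesis using uni_in_maximal_nonzero_const[OF pM] by metis
    qed
    then obtain f where f: "\<And>i. i \<in> U \<Longrightarrow> coeff (f i) 0 \<noteq> 0" "\<And>i. i \<in> U \<Longrightarrow> uni (f i) i \<in> ?M"
      by metis
    let ?V = "{1..n} - U"
    define ys where "ys = map (\<lambda>i. uni (f i) i) us @ esyms ?V (d - length us)"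
    have wr: "weakly_regular K ys"
      unfolding ys_def using f(1) us by (intro weakly_regular_face_filtered[OF filt]) auto
    have ysM: "set ys \<subseteq> ?M"
      unfolding ys_def using f(2) us esyms_in_ideal[OF Ms, of ?V] by (auto simp: U_def)
    then have "rmod.span (set ys \<union> K) \<subseteq> ?M" using KM by (intro rmod.span_minimal Ms) auto
    then have "regular_seq R (map \<psi> ys)"
      using wr prime_id_one[OF pM] by (auto simp: regular_seq_map_iff)
    moreover have "card U \<le> d" unfolding U_def by (rule faces[OF pM KM])
    then have "length (map \<psi> ys) = d" by (simp add: ys_def length_esyms us)
    moreover have "set (map \<psi> ys) \<subseteq> M" using ysM by auto
    ultimately show ?thesis unfolding ideal_depth_def by (intro Sup_upper) blast
  qed
  have depth_le: "ideal_depth R M \<le> prime_height R M"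
    unfolding ideal_depth_def
  proof (rule Sup_least, clarify)
    fix xs assume xs: "set xs \<subseteq> M" "regular_seq R xs"
    have "\<exists>ys. xs = map \<psi> ys"
      using xs(1) Mc range_psi by (intro ex_map_conv[THEN iffD2]) blast
    then obtain ys where ys: "xs = map \<psi> ys" by blast
    have "weakly_regular K ys" using xs(2) unfolding ys regular_seq_map_iff by blast
    moreover have "set ys \<subseteq> ?M" using xs(1) ys by auto
    ultimately obtain Ps where Ps: "length Ps = Suc (length ys)" "last Ps = ?M" "sorted_wrt (\<subset>) Ps"
      "\<forall>Q\<in>set Ps. prime_id Q \<and> K \<subseteq> Q"
      using prime_chain_of_weakly_regular[OF subspace_kernel _ pM KM] by metis
    let ?Qs = "map ((`) \<psi>) Ps"
    have "length ?Qs = Suc (length xs)" using Ps ys by simp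
    moreover have "last ?Qs = M" using Ps(1,2) psi_vimage[OF Mc] by (subst last_map) auto
    moreover have "sorted_wrt (\<subset>) ?Qs"
      unfolding sorted_wrt_map
    proof (rule sorted_wrt_mono_rel[OF _ Ps(3)])
      fix A B assume AB: "A \<in> set Ps" "B \<in> set Ps" "A \<subset> B"
      then obtain b where b: "b \<in> B" "b \<notin> A" by blast
      then have "\<psi> b \<notin> \<psi> ` A" using Ps(4) AB(1) psi_in_image_iff prime_id_subspace by blast
      then show "\<psi> ` A \<subset> \<psi> ` B" using AB(3) b(1) by blast
    qed
    moreover have "\<forall>Q\<in>set ?Qs. primeideal Q R" using Ps(4) primeideal_image by auto
    ultimately show "enat (length xs) \<le> prime_height R M"
      unfolding prime_height_def by (intro Sup_upper) blast
  qed
  show "ideal_depth R M = prime_height R M"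
    using prime_le depth_ge depth_le by (meson order_antisym order_trans)
qed

end

section \<open>Complexes of monotone paths\<close>

text \<open>\<open>paths \<phi> i j\<close> are the images under \<open>\<phi>\<close> of the cell sets
  \<open>{(0, a\<^sub>0), \<dots>, (i - 1, a\<^sub>i\<^sub>-\<^sub>1)}\<close> with \<open>0 \<le> a\<^sub>0 \<le> \<dots> \<le> a\<^sub>i\<^sub>-\<^sub>1 < j\<close>.
  For injective \<open>\<phi>\<close> the corresponding monomials generate a polarization of the \<open>i\<close>-th power of the
  maximal ideal in \<open>j\<close> variables.\<close>

fun paths :: "(nat \<Rightarrow> nat \<Rightarrow> nat) \<Rightarrow> nat \<Rightarrow> nat \<Rightarrow> nat set set" where
  "paths \<phi> 0 j = {{}}"
| "paths \<phi> (Suc i) 0 = {}"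
| "paths \<phi> (Suc i) (Suc j) = insert (\<phi> i j) ` paths \<phi> i (Suc j) \<union> paths \<phi> (Suc i) j"

definition cells :: "(nat \<Rightarrow> nat \<Rightarrow> nat) \<Rightarrow> nat \<Rightarrow> nat \<Rightarrow> nat set" where
  "cells \<phi> i j = {\<phi> a b |a b. a < i \<and> b < j}"

definition diagonal :: "(nat \<Rightarrow> nat \<Rightarrow> nat) \<Rightarrow> nat \<Rightarrow> nat \<Rightarrow> bool" where
  "diagonal \<phi> i j \<longleftrightarrow> (\<forall>a<i. \<forall>b<j. \<forall>a'<i. \<forall>b'<j. \<phi> a b = \<phi> a' b' \<longrightarrow> a + b = a' + b')"

text \<open>The vertex set is a separate parameter because the recursion for the face numbers
  removes the corner from it.\<close>

definition path_complex :: "(nat \<Rightarrow> nat \<Rightarrow> nat) \<Rightarrow> nat \<Rightarrow> nat \<Rightarrow> nat set \<Rightarrow> nat set set" where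
  "path_complex \<phi> i j V = {F. F \<subseteq> V \<and> (\<forall>G\<in>paths \<phi> i j. \<not> G \<subseteq> F)}"

abbreviation (input) flipped :: "(nat \<Rightarrow> nat \<Rightarrow> nat) \<Rightarrow> nat \<Rightarrow> nat \<Rightarrow> nat" where
  "flipped \<phi> \<equiv> \<lambda>a b. \<phi> b a"

lemma cells_intro: "a < i \<Longrightarrow> b < j \<Longrightarrow> \<phi> a b \<in> cells \<phi> i j"
  by (auto simp: cells_def)

lemma diagonalD:
  "diagonal \<phi> i j \<Longrightarrow> \<phi> a b = \<phi> a' b' \<Longrightarrow> a < i \<Longrightarrow> b < j \<Longrightarrow> a' < i \<Longrightarrow> b' < j \<Longrightarrow> a + b = a' + b'"
  unfolding diagonal_def by blast

lemma diagonalI: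
  "(\<And>a b a' b'. \<phi> a b = \<phi> a' b' \<Longrightarrow> a < i \<Longrightarrow> b < j \<Longrightarrow> a' < i \<Longrightarrow> b' < j \<Longrightarrow> a + b = a' + b')
    \<Longrightarrow> diagonal \<phi> i j"
  unfolding diagonal_def by blast

lemma cells_flipped: "cells (flipped \<phi>) j i = cells \<phi> i j"
  by (auto simp: cells_def)

lemma diagonal_flipped: "diagonal \<phi> i j \<Longrightarrow> diagonal (flipped \<phi>) j i"
  by (rule diagonalI) (use diagonalD[of \<phi> i j] in \<open>metis add.commute\<close>)

lemma cells_mono: "i \<le> i' \<Longrightarrow> j \<le> j' \<Longrightarrow> cells \<phi> i j \<subseteq> cells \<phi> i' j'"
  by (fastforce simp: cells_def)

lemma diagonal_mono: "diagonal \<phi> i' j' \<Longrightarrow> i \<le> i' \<Longrightarrow> j \<le> j' \<Longrightarrow> diagonal \<phi> i j"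
  by (rule diagonalI, erule diagonalD) auto

lemma paths_subset_cells: "G \<in> paths \<phi> i j \<Longrightarrow> G \<subseteq> cells \<phi> i j"
proof (induction \<phi> i j arbitrary: G rule: paths.induct)
  case (3 \<phi> i j)
  have v: "\<phi> i j \<in> cells \<phi> (Suc i) (Suc j)" by (auto simp: cells_def)
  have sub: "cells \<phi> i (Suc j) \<subseteq> cells \<phi> (Suc i) (Suc j)" "cells \<phi> (Suc i) j \<subseteq> cells \<phi> (Suc i) (Suc j)"
    by (intro cells_mono; simp)+
  from 3(3) consider H where "H \<in> paths \<phi> i (Suc j)" "G = insert (\<phi> i j) H" | "G \<in> paths \<phi> (Suc i) j"
    by auto
  then show ?case
  proof cases
    case 1
    then show ?thesis using 3(1)[OF 1(1)] v sub by blast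
  next
    case 2
    then show ?thesis using 3(2)[OF 2] sub by blast
  qed
qed auto

text \<open>The corner is the only cell on its antidiagonal.\<close>

lemma corner_notin_cells:
  assumes "diagonal \<phi> (Suc i) (Suc j)"
  shows "\<phi> i j \<notin> cells \<phi> i (Suc j)" "\<phi> i j \<notin> cells \<phi> (Suc i) j"
proof -
  have "i + j = a + b" if "\<phi> i j = \<phi> a b" "a \<le> i" "b \<le> j" for a b
    by (rule diagonalD[OF assms that(1)]) (use that in auto)
  then show "\<phi> i j \<notin> cells \<phi> i (Suc j)" "\<phi> i j \<notin> cells \<phi> (Suc i) j"
    by (fastforce simp: cells_def)+
qed

lemma card_path: "diagonal \<phi> i j \<Longrightarrow> G \<in> paths \<phi> i j \<Longrightarrow> finite G \<and> card G = i"
proof (induction \<phi> i j arbitrary: G rule: paths.induct)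
  case (3 \<phi> i j)
  have d: "diagonal \<phi> i (Suc j)" "diagonal \<phi> (Suc i) j" using diagonal_mono[OF 3(3)] by auto
  from 3(4) consider H where "H \<in> paths \<phi> i (Suc j)" "G = insert (\<phi> i j) H" | "G \<in> paths \<phi> (Suc i) j"
    by auto
  then show ?case
  proof cases
    case 1
    then have "\<phi> i j \<notin> H" using corner_notin_cells(1)[OF 3(3)] paths_subset_cells by blast
    then show ?thesis using 1 3(1)[OF d(1) 1(1)] by simp
  next
    case 2
    then show ?thesis using 3(2)[OF d(2)] by simp
  qed
qed auto

lemma paths_Suc_right: "paths \<phi> i j \<subseteq> paths \<phi> i (Suc j)"
  by (cases i) auto

text \<open>Omit the cell in the last row. This makes paths that avoid the corner redundant beside
  those of the grid with one row less.\<close>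

lemma paths_Suc_left: "G \<in> paths \<phi> (Suc i) j \<Longrightarrow> \<exists>H\<in>paths \<phi> i j. H \<subseteq> G"
proof (induction j)
  case (Suc j)
  then consider H where "H \<in> paths \<phi> i (Suc j)" "G = insert (\<phi> i j) H" | "G \<in> paths \<phi> (Suc i) j"
    by auto
  then show ?case
  proof cases
    case 2
    then show ?thesis using Suc.IH paths_Suc_right[of \<phi> i j] by blast
  qed auto
qed simp

lemma paths_nonempty: "paths \<phi> i (Suc j) \<noteq> {}"
  by (induction i) auto

text \<open>Needed to exclude cone points. In a grid with one row less a path is found and extended
  by the corner; the cells of the last row other than the corner lie in the grid with one column
  less; the corner itself extends any path.\<close>

lemma cells_covered: "Union (paths \<phi> i (Suc j)) = cells \<phi> i (Suc j)"
proof
  show "cells \<phi> i (Suc j) \<subseteq> Union (paths \<phi> i (Suc j))"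
  proof (induction "i + j" arbitrary: i j)
    case 0
    then show ?case by (auto simp: cells_def)
  next
    case (Suc k)
    show ?case
    proof
      fix v assume "v \<in> cells \<phi> i (Suc j)"
      then obtain a b where v: "v = \<phi> a b" "a < i" "b \<le> j" by (auto simp: cells_def less_Suc_eq_le)
      then obtain i' where i: "i = Suc i'" by (cases i) auto
      show "v \<in> Union (paths \<phi> i (Suc j))"
      proof (cases "a < i'")
        case True
        then have "v \<in> Union (paths \<phi> i' (Suc j))"
          using v Suc.hyps(1)[of i' j] Suc.hyps(2) i by (auto simp: cells_def less_Suc_eq_le)
        then show ?thesis using i by auto
      next
        case False
        then have a: "a = i'" using v i by simp
        show ?thesis
        proof (cases "b = j")
          case True
          then show ?thesis using v a i paths_nonempty[of \<phi> i' j] by auto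
        next
          case False
          then obtain j' where j: "j = Suc j'" "b \<le> j'" using v by (cases j) auto
          then have "v \<in> cells \<phi> i (Suc j')" using v cells_intro[of a i b "Suc j'" \<phi>] by simp
          then have "v \<in> Union (paths \<phi> i (Suc j'))"
            using Suc.hyps(1)[of i j'] Suc.hyps(2) j by auto
          then show ?thesis using i j by auto
        qed
      qed
    qed
  qed
qed (use paths_subset_cells in blast)

text \<open>If the corner is in \<open>F\<close>, the alternative with one column less is absorbed
  by that with one row less, and on the transposed side the corner is unusable; if it is not in
  \<open>F\<close>, the roles are exchanged. In the empty grid the empty path is both contained in
  \<open>F\<close> and disjoint from it, so that case is excluded.\<close>

lemma path_duality:
  "(i, j) \<noteq> (0, 0) \<Longrightarrow>
    (\<exists>G\<in>paths \<phi> i j. G \<subseteq> F) \<longleftrightarrow> \<not> (\<exists>H\<in>paths (flipped \<phi>) j i. H \<inter> F = {})"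
proof (induction \<phi> i j rule: paths.induct)
  case (1 \<phi> j)
  then obtain j' where "j = Suc j'" by (cases j) auto
  then show ?case by simp
next
  case (3 \<phi> i j)
  have "\<exists>H'\<in>paths (flipped \<phi>) j (Suc i). H' \<inter> F = {}"
    if "H \<in> paths (flipped \<phi>) (Suc j) i" "H \<inter> F = {}" for H
    using paths_Suc_left[OF that(1)] paths_Suc_right[of "flipped \<phi>" j i] that(2) by blast
  moreover have "(\<exists>G\<in>paths \<phi> (Suc i) (Suc j). G \<subseteq> F) \<longleftrightarrow>
      (\<phi> i j \<in> F \<and> (\<exists>G\<in>paths \<phi> i (Suc j). G \<subseteq> F)) \<or> (\<exists>G\<in>paths \<phi> (Suc i) j. G \<subseteq> F)"
    by (simp only: paths.simps bex_Un Set.bex_simps insert_subset)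
  moreover have "(\<exists>H\<in>paths (flipped \<phi>) (Suc j) (Suc i). H \<inter> F = {}) \<longleftrightarrow>
      (\<phi> i j \<notin> F \<and> (\<exists>H\<in>paths (flipped \<phi>) j (Suc i). H \<inter> F = {})) \<or>
      (\<exists>H\<in>paths (flipped \<phi>) (Suc j) i. H \<inter> F = {})"
    by (simp only: paths.simps bex_Un Set.bex_simps insert_disjoint)
  ultimately show ?case using 3 by auto
qed simp

lemma alexander_dual_path_complex:
  assumes "cells \<phi> i j \<subseteq> {1..n}" "(i, j) \<noteq> (0, 0)"
  shows "alexander_dual n (path_complex \<phi> i j {1..n}) = path_complex (flipped \<phi>) j i {1..n}"
proof -
  have "G \<subseteq> {1..n}" if "G \<in> paths \<phi> i j" for G
    using paths_subset_cells[OF that] assms(1) by blast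
  then have "(\<exists>G\<in>paths \<phi> i j. G \<subseteq> {1..n} - F) \<longleftrightarrow> (\<exists>G\<in>paths \<phi> i j. G \<inter> F = {})" for F
    by blast
  then have 1: "{1..n} - F \<notin> path_complex \<phi> i j {1..n} \<longleftrightarrow> (\<exists>G\<in>paths \<phi> i j. G \<inter> F = {})" for F
    by (simp add: path_complex_def)
  have ji: "(j, i) \<noteq> (0, 0)" using assms(2) by auto
  have 2: "(\<exists>G\<in>paths \<phi> i j. G \<inter> F = {}) \<longleftrightarrow> \<not> (\<exists>G\<in>paths (flipped \<phi>) j i. G \<subseteq> F)" for F
    unfolding path_duality[OF ji, of "flipped \<phi>" F] not_not by (rule refl)
  show ?thesis
    unfolding alexander_dual_def 1 2 unfolding path_complex_def by simp
qed

text \<open>By duality the complement of a face contains a transposed path, which has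
  \<open>j\<close> elements.\<close>

lemma card_path_complex_face:
  assumes "cells \<phi> i j \<subseteq> {1..n}" "(i, j) \<noteq> (0, 0)" "diagonal \<phi> i j" "F \<in> path_complex \<phi> i j {1..n}"
  shows "card F + j \<le> n"
proof -
  have "\<not> (\<exists>G\<in>paths \<phi> i j. G \<subseteq> F)" using assms(4) by (auto simp: path_complex_def)
  then obtain H where H: "H \<in> paths (flipped \<phi>) j i" "H \<inter> F = {}"
    unfolding path_duality[OF assms(2), of \<phi> F] by blast
  have "H \<subseteq> {1..n}" using paths_subset_cells[OF H(1)] assms(1) unfolding cells_flipped[of \<phi> j i] by blast
  moreover have "finite H" "card H = j" using card_path[OF diagonal_flipped[OF assms(3)] H(1)] by auto
  moreover have F: "F \<subseteq> {1..n}" "finite F" using assms(4) finite_subset[of F "{1..n}"] by (auto simp: path_complex_def)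
  ultimately have "card F + j = card (F \<union> H)" using H(2) card_Un_disjoint[of F H] by (simp add: Int_commute)
  also have "\<dots> \<le> card {1..n}" using F \<open>H \<subseteq> {1..n}\<close> by (intro card_mono) auto
  finally show ?thesis by simp
qed

section \<open>The Cohen-Macaulay property\<close>

definition mono_of :: "nat set \<Rightarrow> ('k::field) mpolynomial" where
  "mono_of G = (\<Prod>i\<in>G. mvar i)"

lemma mono_of_in: "G \<subseteq> V \<Longrightarrow> mono_of G \<in> polys_in V"
  unfolding mono_of_def by (intro subring_of_prod[OF subring_of_polys_in] mvar_in) auto

lemma mono_of_insert: "finite G \<Longrightarrow> v \<notin> G \<Longrightarrow> mono_of (insert v G) = mvar v * mono_of G"
  by (simp add: mono_of_def)

lemma mono_of_subset_in_span:
  assumes "finite H" "G \<subseteq> H" "mono_of G \<in> rmod.span X"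
  shows "mono_of H \<in> rmod.span X"
proof -
  have "mono_of H = mono_of (H - G) * mono_of G"
    unfolding mono_of_def using assms(1,2) by (rule prod.subset_diff[rotated])
  then show ?thesis using rmod.span_scale[OF assms(3)] by metis
qed

text \<open>\<open>Z\<close> holds the variables set to zero: corners killed in the recursion, and
  all indices outside \<open>{1..n}\<close>, which cuts the ring down to \<open>n\<close>
  variables.\<close>

definition path_ideal :: "(nat \<Rightarrow> nat \<Rightarrow> nat) \<Rightarrow> nat \<Rightarrow> nat \<Rightarrow> nat set \<Rightarrow> ('k::field) mpolynomial set" where
  "path_ideal \<phi> i j Z = rmod.span (mono_of ` paths \<phi> i j \<union> mvar ` Z)"

lemma path_ideal_mono_of: "G \<in> paths \<phi> i j \<Longrightarrow> mono_of G \<in> path_ideal \<phi> i j Z"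
  unfolding path_ideal_def by (intro rmod.span_base) auto

lemma path_ideal_mvar: "z \<in> Z \<Longrightarrow> mvar z \<in> path_ideal \<phi> i j Z"
  unfolding path_ideal_def by (intro rmod.span_base) auto

lemma subspace_path_ideal [simp]: "rmod.subspace (path_ideal \<phi> i j Z)"
  by (simp add: path_ideal_def)

lemma path_ideal_subset:
  assumes "rmod.subspace J" "\<And>G. G \<in> paths \<phi> i j \<Longrightarrow> mono_of G \<in> J" "\<And>z. z \<in> Z \<Longrightarrow> mvar z \<in> J"
  shows "path_ideal \<phi> i j Z \<subseteq> J"
  unfolding path_ideal_def using assms by (intro rmod.span_minimal) auto

text \<open>The ideal is \<open>x_v L + L'\<close> with \<open>L' \<subseteq> L\<close>, where
  \<open>v\<close> is the corner, \<open>L\<close> belongs to one row less and \<open>L'\<close> to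
  one column less. So it lies in \<open>L\<close>, modulo which \<open>x_v\<close> is a
  nonzerodivisor because no generator of \<open>L\<close> involves it.\<close>

lemma path_ideal_colon:
  fixes \<phi> :: "nat \<Rightarrow> nat \<Rightarrow> nat"
  assumes diag: "diagonal \<phi> (Suc i) (Suc j)" and Z: "\<phi> i j \<notin> Z"
  shows "{r. mvar (\<phi> i j) * r \<in> path_ideal \<phi> (Suc i) (Suc j) Z}
    = (path_ideal \<phi> i (Suc j) Z :: ('k::field) mpolynomial set)"
proof -
  let ?v = "\<phi> i j"
  let ?J = "path_ideal \<phi> (Suc i) (Suc j) Z :: 'k mpolynomial set"
  let ?L = "path_ideal \<phi> i (Suc j) Z :: 'k mpolynomial set"
  have d: "diagonal \<phi> i (Suc j)" "diagonal \<phi> (Suc i) j" using diagonal_mono[OF diag] by auto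
  have G: "finite G" "?v \<notin> G" if "G \<in> paths \<phi> i (Suc j)" for G
    using card_path[OF d(1) that] paths_subset_cells[OF that] corner_notin_cells(1)[OF diag] by auto
  have x_mono: "mono_of (insert ?v G) = mvar ?v * mono_of G" if "G \<in> paths \<phi> i (Suc j)" for G
    using G[OF that] by (rule mono_of_insert)
  have J0s: "rmod.subspace ?L" and Js: "rmod.subspace ?J" by simp_all
  have "?J \<subseteq> ?L"
  proof (rule path_ideal_subset[OF J0s])
    fix G assume "G \<in> paths \<phi> (Suc i) (Suc j)"
    then consider H where "H \<in> paths \<phi> i (Suc j)" "G = insert ?v H" | "G \<in> paths \<phi> (Suc i) j" by auto
    then show "mono_of G \<in> ?L"
    proof cases
      case 1
      then show ?thesis using rmod.subspace_scale[OF J0s path_ideal_mono_of] x_mono by metis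
    next
      case 2
      obtain H where H: "H \<in> paths \<phi> i j" "H \<subseteq> G" using paths_Suc_left[OF 2] by blast
      have "H \<in> paths \<phi> i (Suc j)" using H(1) paths_Suc_right by blast
      then have "mono_of H \<in> ?L" by (rule path_ideal_mono_of)
      then show ?thesis unfolding path_ideal_def
        using card_path[OF d(2) 2] H(2) by (intro mono_of_subset_in_span[of G H]) auto
    qed
  qed (rule path_ideal_mvar)
  moreover have "?L \<subseteq> {r. mvar ?v * r \<in> ?J}"
  proof (rule path_ideal_subset[OF subspace_colon[OF Js]])
    fix G assume G: "G \<in> paths \<phi> i (Suc j)"
    then have "insert ?v G \<in> paths \<phi> (Suc i) (Suc j)" by simp
    then have "mono_of (insert ?v G) \<in> ?J" by (rule path_ideal_mono_of)
    then show "mono_of G \<in> {r. mvar ?v * r \<in> ?J}" unfolding x_mono[OF G] mem_Collect_eq .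
  next
    show "mvar z \<in> {r. mvar ?v * r \<in> ?J}" if "z \<in> Z" for z
      using rmod.subspace_scale[OF Js path_ideal_mvar[OF that]] by simp
  qed
  moreover have "mono_of ` paths \<phi> i (Suc j) \<union> mvar ` Z \<subseteq> (polys_in (- {?v}) :: 'k mpolynomial set)"
    using G(2) Z by (auto intro!: mono_of_in mvar_in)
  then have "r \<in> ?L" if "mvar ?v * r \<in> ?L" for r
    using that unfolding path_ideal_def by (rule mvar_nonzerodivisor)
  ultimately show ?thesis by blast
qed

text \<open>Paths through the corner become redundant once its variable is in the ideal.\<close>

lemma path_ideal_sum:
  assumes diag: "diagonal \<phi> (Suc i) (Suc j)"
  shows "rmod.span (insert (mvar (\<phi> i j)) (path_ideal \<phi> (Suc i) (Suc j) Z))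
    = (path_ideal \<phi> (Suc i) j (insert (\<phi> i j) Z) :: ('k::field) mpolynomial set)"
proof -
  let ?v = "\<phi> i j"
  have d: "diagonal \<phi> i (Suc j)" using diagonal_mono[OF diag] by auto
  have "mono_of (insert ?v G) \<in> rmod.span (mono_of ` paths \<phi> (Suc i) j \<union> mvar ` insert ?v Z :: 'k mpolynomial set)"
    if "G \<in> paths \<phi> i (Suc j)" for G
  proof (rule mono_of_subset_in_span)
    show "finite (insert ?v G)" using card_path[OF d that] by simp
    show "mono_of {?v} \<in> rmod.span (mono_of ` paths \<phi> (Suc i) j \<union> mvar ` insert ?v Z :: 'k mpolynomial set)"
      by (intro rmod.span_base) (auto simp: mono_of_def)
  qed auto
  then show ?thesis
    unfolding path_ideal_def span_insert_span
    by (intro rmod.span_eq[THEN iffD2] conjI subsetI) (auto intro: rmod.span_base)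
qed

text \<open>The invariant \<open>card (- Z) = d + j\<close> balances the recursion: one row less
  changes neither side, and setting the corner to zero costs one variable and one column. Without
  columns exactly \<open>d\<close> variables remain; without rows the ideal is the whole
  ring.\<close>

lemma face_filtered_path_ideal:
  assumes "diagonal \<phi> i j" "cells \<phi> i j \<subseteq> {1..n}" "cells \<phi> i j \<inter> Z = {}"
    "- {1..n} \<subseteq> Z" "card (- Z) = d + j"
  shows "face_filtered n d (path_ideal \<phi> i j Z :: ('k::field) mpolynomial set)"
  using assms
proof (induction \<phi> i j arbitrary: Z rule: paths.induct)
  case (1 \<phi> j)
  have "path_ideal \<phi> 0 j Z = (UNIV :: 'k mpolynomial set)"
    unfolding path_ideal_def by (intro span_eq_UNIV rmod.span_base) (simp add: mono_of_def)
  then show ?case by (simp add: face_filtered.unit)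
next
  case (2 \<phi> i)
  have "face_filtered n d (rmod.span (mvar ` (- (- Z))) :: 'k mpolynomial set)"
    using 2 by (intro face_filtered.face) auto
  then show ?case by (simp add: path_ideal_def)
next
  case (3 \<phi> i j)
  let ?v = "\<phi> i j"
  have v: "?v \<in> cells \<phi> (Suc i) (Suc j)" by (auto simp: cells_def)
  then have vZ: "?v \<notin> Z" using 3 by blast
  have sub: "cells \<phi> i (Suc j) \<subseteq> cells \<phi> (Suc i) (Suc j)" "cells \<phi> (Suc i) j \<subseteq> cells \<phi> (Suc i) (Suc j)"
    by (intro cells_mono; simp)+
  have d: "diagonal \<phi> i (Suc j)" "diagonal \<phi> (Suc i) j" using diagonal_mono[OF 3(3)] by auto
  note fresh = corner_notin_cells[OF 3(3)]
  have "- Z \<subseteq> {1..n}" using 3(6) by blast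
  then have fin: "finite (- Z)" by (rule finite_subset) simp
  have "face_filtered n d (path_ideal \<phi> i (Suc j) Z :: 'k mpolynomial set)"
    using 3 d sub by (intro 3(1)) auto
  moreover have "face_filtered n d (path_ideal \<phi> (Suc i) j (insert ?v Z) :: 'k mpolynomial set)"
  proof (rule 3(2)[OF d(2)])
    have "- insert ?v Z = - Z - {?v}" by auto
    then show "card (- insert ?v Z) = d + j" using 3(7) vZ fin by simp
  qed (use 3 sub fresh in auto)
  ultimately show ?case
    using face_filtered.extension[of "path_ideal \<phi> (Suc i) (Suc j) Z" n d "mvar ?v"]
    unfolding path_ideal_colon[OF 3(3) vZ] path_ideal_sum[OF 3(3)] by simp
qed

lemma cring_mpoly_ring: "cring (mpoly_ring n :: ('k::field) mpolynomial ring)"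
proof -
  note D = subring_ofD[OF subring_of_polys_in[of "{1..n}"]]
  show ?thesis
  proof (rule cringI)
    show "abelian_group (mpoly_ring n :: 'k mpolynomial ring)"
      by (rule abelian_groupI)
        (auto simp: mpoly_ring_def polys_in_def[symmetric] D add_ac simp del: One_nat_def
          intro!: bexI[of _ "- x" for x])
    show "comm_monoid (mpoly_ring n :: 'k mpolynomial ring)"
      by (rule comm_monoidI) (auto simp: mpoly_ring_def polys_in_def[symmetric] D mult_ac simp del: One_nat_def)
  qed (auto simp: mpoly_ring_def algebra_simps)
qed

text \<open>Variables beyond \<open>n\<close> are set to zero before passing to cosets. The
  Stanley-Reisner ideal has all nonfaces as generators, but every nonface contains a path, so the
  paths suffice.\<close>

lemma stanley_reisner_quotient_map:
  assumes cells: "cells \<phi> i j \<subseteq> {1..n}" and diag: "diagonal \<phi> i j"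
  defines "R \<equiv> (stanley_reisner_ring n (path_complex \<phi> i j {1..n}) :: ('k::field) mpolynomial set ring)"
  shows "\<exists>\<psi>. quotient_map R \<psi> (path_ideal \<phi> i j (- {1..n}) :: 'k mpolynomial set)"
proof -
  let ?S = "mpoly_ring n :: 'k mpolynomial ring"
  let ?J = "path_ideal \<phi> i j (- {1..n}) :: 'k mpolynomial set"
  let ?\<rho> = "restrict_vars {1..n} :: 'k mpolynomial \<Rightarrow> _"
  let ?nonfaces = "{F. F \<subseteq> {1..n} \<and> F \<notin> path_complex \<phi> i j {1..n}}"
  interpret S: cring ?S by (rule cring_mpoly_ring)
  have Sc: "carrier ?S = polys_in {1..n}" by (simp add: mpoly_ring_def polys_in_def)
  have Sops: "mult ?S = (*)" "one ?S = 1" "zero ?S = 0" "add ?S = (+)" by (simp_all add: mpoly_ring_def)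
  define I where "I = (stanley_reisner_ideal n (path_complex \<phi> i j {1..n}) :: 'k mpolynomial set)"
  have I_gen: "I = genideal ?S (mono_of ` ?nonfaces)"
    unfolding I_def stanley_reisner_ideal_def mono_of_def by (rule arg_cong[of _ _ "genideal ?S"]) auto
  have gens_in: "mono_of ` ?nonfaces \<subseteq> carrier ?S" unfolding Sc by (auto intro!: mono_of_in)
  have I: "ideal I ?S" unfolding I_gen by (rule S.genideal_ideal[OF gens_in])
  interpret I: ideal I ?S by (rule I)
  have Js: "rmod.subspace ?J" by simp
  have I_J: "I \<subseteq> ?J"
  proof -
    have "ideal (?J \<inter> carrier ?S) ?S"
    proof (rule idealI[OF S.ring_axioms])
      show "subgroup (?J \<inter> carrier ?S) (add_monoid ?S)"
      proof (rule S.add.subgroupI)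
        show "?J \<inter> carrier ?S \<noteq> {}" using rmod.subspace_0[OF Js] S.zero_closed by (auto simp: Sops)
        fix a assume a: "a \<in> ?J \<inter> carrier ?S"
        have "\<ominus>\<^bsub>?S\<^esub> a = - a"
          using a subring_ofD(5)[OF subring_of_polys_in]
          by (intro S.minus_equality) (auto simp: Sops Sc)
        then show "\<ominus>\<^bsub>?S\<^esub> a \<in> ?J \<inter> carrier ?S"
          using a rmod.subspace_neg[OF Js] S.a_inv_closed by (metis IntD1 IntD2 IntI)
      next
        fix a b assume "a \<in> ?J \<inter> carrier ?S" "b \<in> ?J \<inter> carrier ?S"
        then show "a \<oplus>\<^bsub>?S\<^esub> b \<in> ?J \<inter> carrier ?S"
          using rmod.subspace_add[OF Js] S.a_closed by (auto simp: Sops)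
      qed auto
      fix a x assume "a \<in> ?J \<inter> carrier ?S" "x \<in> carrier ?S"
      then show "x \<otimes>\<^bsub>?S\<^esub> a \<in> ?J \<inter> carrier ?S" "a \<otimes>\<^bsub>?S\<^esub> x \<in> ?J \<inter> carrier ?S"
        using rmod.subspace_scale[OF Js, of a x] S.m_closed[of x a] by (auto simp: Sops mult.commute[of a])
    qed
    moreover have "mono_of F \<in> ?J" if F: "F \<in> ?nonfaces" for F
    proof -
      obtain G where G: "G \<in> paths \<phi> i j" "G \<subseteq> F" using F by (auto simp: path_complex_def)
      have "finite F" using F finite_subset[of F "{1..n}"] by auto
      then show ?thesis using path_ideal_mono_of[OF G(1)] unfolding path_ideal_def
        by (rule mono_of_subset_in_span[OF _ G(2)])
    qed
    ultimately show ?thesis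
      unfolding I_gen using S.genideal_minimal[of "?J \<inter> carrier ?S" "mono_of ` ?nonfaces"] gens_in by blast
  qed
  have kernel: "?\<rho> a \<in> I \<longleftrightarrow> a \<in> ?J" for a
  proof
    have d: "a - ?\<rho> a \<in> ?J" by (rule diff_restrict_vars[OF Js]) (auto intro: path_ideal_mvar)
    assume "?\<rho> a \<in> I"
    then have "(a - ?\<rho> a) + ?\<rho> a \<in> ?J" using I_J d by (intro rmod.subspace_add[OF Js]) auto
    then show "a \<in> ?J" by simp
  next
    have sub: "rmod.subspace {a. ?\<rho> a \<in> I}"
    proof (rule rmod.subspaceI)
      show "0 \<in> {a. ?\<rho> a \<in> I}" using I.zero_closed by (simp add: restrict_vars_simps Sops)
      show "x + y \<in> {a. ?\<rho> a \<in> I}" if "x \<in> {a. ?\<rho> a \<in> I}" "y \<in> {a. ?\<rho> a \<in> I}" for x y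
        using I.a_closed that by (simp add: restrict_vars_simps Sops)
      show "c * x \<in> {a. ?\<rho> a \<in> I}" if "x \<in> {a. ?\<rho> a \<in> I}" for c x
        using I.I_l_closed[of "?\<rho> x" "?\<rho> c"] that restrict_vars_in by (auto simp: restrict_vars_simps Sops Sc)
    qed
    have "?J \<subseteq> {a. ?\<rho> a \<in> I}"
    proof (rule path_ideal_subset[OF sub])
      fix G assume "G \<in> paths \<phi> i j"
      moreover from this have "G \<subseteq> {1..n}" using paths_subset_cells cells by blast
      ultimately have G: "G \<subseteq> {1..n}" "G \<in> ?nonfaces" by (auto simp: path_complex_def)
      have "mono_of G \<in> I" using S.genideal_self[OF gens_in] G(2) unfolding I_gen by blast
      then show "mono_of G \<in> {a. ?\<rho> a \<in> I}" by (simp only: mem_Collect_eq restrict_vars_ident[OF mono_of_in[OF G(1)]])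
    next
      fix z assume "z \<in> - {1..n}"
      then have "?\<rho> (mvar z) = 0" by (auto simp: restrict_vars_simps)
      then show "mvar z \<in> {a. ?\<rho> a \<in> I}" using I.zero_closed by (simp add: Sops)
    qed
    then show "a \<in> ?J \<Longrightarrow> ?\<rho> a \<in> I" by blast
  qed
  have R: "R = ?S Quot I" by (simp add: R_def stanley_reisner_ring_def I_def)
  interpret R: cring R unfolding R by (rule I.quotient_is_cring[OF S.is_cring])
  have hom: "(+>\<^bsub>?S\<^esub>) I \<in> ring_hom ?S R" unfolding R by (rule I.rcos_ring_hom)
  have \<rho>c: "?\<rho> a \<in> carrier ?S" for a unfolding Sc by (rule restrict_vars_in)
  let ?\<psi> = "\<lambda>a. I +>\<^bsub>?S\<^esub> ?\<rho> a"
  have "quotient_map R ?\<psi> ?J"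
  proof
    fix a b
    show "?\<psi> (a + b) = ?\<psi> a \<oplus>\<^bsub>R\<^esub> ?\<psi> b"
      using ring_hom_add[OF hom \<rho>c \<rho>c, of a b] by (simp add: restrict_vars_simps Sops)
    show "?\<psi> (a * b) = ?\<psi> a \<otimes>\<^bsub>R\<^esub> ?\<psi> b"
      using ring_hom_mult[OF hom \<rho>c \<rho>c, of a b] by (simp add: restrict_vars_simps Sops)
    show "?\<psi> 1 = \<one>\<^bsub>R\<^esub>" using ring_hom_one[OF hom] by (simp add: restrict_vars_simps Sops)
    have "carrier R = (+>\<^bsub>?S\<^esub>) I ` carrier ?S"
      by (auto simp: R FactRing_def A_RCOSETS_def')
    also have "\<dots> = range ?\<psi>"
    proof -
      have "carrier ?S = range ?\<rho>" using \<rho>c restrict_vars_ident unfolding Sc by (metis (no_types, lifting) image_subsetI rangeI subsetI subset_antisym)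
      then show ?thesis by (simp add: image_image)
    qed
    finally show "range ?\<psi> = carrier R" by simp
    have "\<zero>\<^bsub>R\<^esub> = I" by (simp add: R FactRing_def)
    then show "?\<psi> a = \<zero>\<^bsub>R\<^esub> \<longleftrightarrow> a \<in> ?J"
      using I.rcos_const_imp_mem[OF \<rho>c] S.a_rcos_zero[OF I] kernel by metis
  qed
  then show ?thesis by blast
qed

theorem cohen_macaulay_path_complex:
  assumes cells: "cells \<phi> i j \<subseteq> {1..n}" and diag: "diagonal \<phi> i j" and ij: "i > 0" "j > 0"
  shows "cohen_macaulay_complex TYPE('k::field) n (path_complex \<phi> i j {1..n})"
proof -
  let ?J = "path_ideal \<phi> i j (- {1..n}) :: 'k mpolynomial set"
  let ?R = "stanley_reisner_ring n (path_complex \<phi> i j {1..n}) :: 'k mpolynomial set ring"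
  obtain \<psi> where "quotient_map ?R \<psi> ?J"
    using stanley_reisner_quotient_map[OF cells diag] by blast
  then interpret quotient_map ?R \<psi> ?J .
  have faces: "card U + j \<le> n" if "U \<in> path_complex \<phi> i j {1..n}" for U
    using card_path_complex_face[OF cells _ diag that] ij by simp
  have "{} \<in> path_complex \<phi> i j {1..n}"
    using card_path[OF diag] ij by (fastforce simp: path_complex_def)
  then have "j \<le> n" using faces by fastforce
  have "cohen_macaulay_ring ?R"
  proof (rule cohen_macaulay_quotient)
    show "face_filtered n (n - j) ?J"
      using cells diag \<open>j \<le> n\<close> by (intro face_filtered_path_ideal) auto
    show "mvar i \<in> ?J" if "i \<notin> {1..n}" for i using that by (intro path_ideal_mvar) auto
    fix M assume M: "prime_id M" "?J \<subseteq> M"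
    \<comment> \<open>A prime containing the monomial of a path contains one of its variables, so
      the variables outside \<open>M\<close> form a face.\<close>
    have "{i \<in> {1..n}. mvar i \<notin> M} \<in> path_complex \<phi> i j {1..n}"
    proof -
      have "\<not> G \<subseteq> {i \<in> {1..n}. mvar i \<notin> M}" if G: "G \<in> paths \<phi> i j" for G
      proof
        assume sub: "G \<subseteq> {i \<in> {1..n}. mvar i \<notin> M}"
        have "mono_of G \<in> M" using path_ideal_mono_of[OF G] M(2) by blast
        then show False
          using sub card_path[OF diag G] prime_id_prod_iff[OF _ M(1)] unfolding mono_of_def by blast
      qed
      then show ?thesis by (auto simp: path_complex_def)
    qed
    from faces[OF this] show "card {i \<in> {1..n}. mvar i \<notin> M} \<le> n - j" by simp
  qed
  then show ?thesis by (simp add: cohen_macaulay_complex_def)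
qed

section \<open>Face numbers\<close>

abbreviation X :: "int poly" where "X \<equiv> [:0, 1:]"

definition face_poly :: "nat set set \<Rightarrow> int poly" where
  "face_poly \<Delta> = (\<Sum>F\<in>\<Delta>. X ^ card F)"

lemma face_poly_Pow: "finite V \<Longrightarrow> face_poly (Pow V) = [:1, 1:] ^ card V"
proof (induction V rule: finite_induct)
  case (insert v V)
  have inj: "inj_on (insert v) (Pow V)" using insert.hyps(2) by (auto simp: inj_on_def)
  have "face_poly (Pow (insert v V)) = face_poly (Pow V) + (\<Sum>F\<in>insert v ` Pow V. X ^ card F)"
    unfolding face_poly_def Pow_insert using insert.hyps by (intro sum.union_disjoint) auto
  also have "(\<Sum>F\<in>insert v ` Pow V. X ^ card F) = (\<Sum>F\<in>Pow V. X * X ^ card F)"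
    unfolding sum.reindex[OF inj] comp_def
  proof (rule sum.cong)
    fix F assume F: "F \<in> Pow V"
    then have "finite F" "v \<notin> F" using insert.hyps finite_subset[of F V] by auto
    then show "X ^ card (insert v F) = X * X ^ card F" by simp
  qed simp
  also have "\<dots> = X * face_poly (Pow V)" by (simp add: face_poly_def sum_distrib_left)
  also have "face_poly (Pow V) + X * face_poly (Pow V) = [:1, 1:] * face_poly (Pow V)"
    by simp
  finally show ?case using insert by simp
qed (simp add: face_poly_def)

lemma binomial_poly: "(\<Sum>l<Suc i. of_nat (i choose l) * X ^ l) = [:1, 1:] ^ i"
proof -
  have "[:1, 1:] = X + 1" by (simp add: one_pCons)
  then show ?thesis by (simp only: binomial_ring lessThan_Suc_atMost power_one mult_1_right)
qed

lemma pascal_sum: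
  fixes x :: "'a::comm_ring_1"
  shows "(\<Sum>l<Suc i. of_nat (k choose l) * x ^ l) + x * (\<Sum>l<i. of_nat (k choose l) * x ^ l)
    = (\<Sum>l<Suc i. of_nat (Suc k choose l) * x ^ l)"
proof -
  have "(\<Sum>l<i. of_nat (Suc k choose Suc l) * x ^ Suc l)
      = (\<Sum>l<i. of_nat (k choose Suc l) * x ^ Suc l) + x * (\<Sum>l<i. of_nat (k choose l) * x ^ l)"
    by (simp add: sum_distrib_left sum.distrib[symmetric] algebra_simps)
  then show ?thesis
    unfolding sum.lessThan_Suc_shift by simp
qed

text \<open>Faces without the corner form the complex with one column less; faces with it correspond
  to that with one row less. Both have one vertex and one antidiagonal fewer, so the exponent of
  \<open>[:1, 1:]\<close> stays the same and the truncated binomial sums combine by Pascal's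
  rule.\<close>

lemma face_poly_path_complex:
  assumes "diagonal \<phi> i j" "cells \<phi> i j \<subseteq> V" "finite V" "i + j \<le> Suc (card V)" "i + j > 0"
  shows "face_poly (path_complex \<phi> i j V)
    = [:1, 1:] ^ (Suc (card V) - (i + j)) * (\<Sum>l<i. of_nat (i + j - 1 choose l) * X ^ l)"
  using assms
proof (induction \<phi> i j arbitrary: V rule: paths.induct)
  \<comment> \<open>The empty path excludes every set, even the empty one, so both sides are
    0.\<close>
  case (1 \<phi> j)
  then show ?case by (simp add: path_complex_def face_poly_def)
next
  case (2 \<phi> i)
  have "path_complex \<phi> (Suc i) 0 V = Pow V" by (auto simp: path_complex_def)
  then have "face_poly (path_complex \<phi> (Suc i) 0 V) = [:1, 1:] ^ card V"
    using face_poly_Pow 2 by simp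
  also have "\<dots> = [:1, 1:] ^ (card V - i) * [:1, 1:] ^ i"
    using 2 by (simp flip: power_add)
  finally show ?case using binomial_poly[of i] by simp
next
  case (3 \<phi> i j)
  let ?v = "\<phi> i j" and ?W = "V - {\<phi> i j}"
  have v: "?v \<in> V" using 3(4) by (auto simp: cells_def)
  have sub: "cells \<phi> i (Suc j) \<subseteq> ?W" "cells \<phi> (Suc i) j \<subseteq> ?W"
    using corner_notin_cells[OF 3(3)] 3(4) cells_mono[of i "Suc i" "Suc j" "Suc j" \<phi>]
      cells_mono[of "Suc i" "Suc i" j "Suc j" \<phi>] by auto
  have d: "diagonal \<phi> i (Suc j)" "diagonal \<phi> (Suc i) j" using diagonal_mono[OF 3(3)] by auto
  have vG: "?v \<notin> G" if "G \<in> paths \<phi> i (Suc j) \<or> G \<in> paths \<phi> (Suc i) j" for G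
    using that paths_subset_cells[of G] corner_notin_cells[OF 3(3)] by blast
  have split: "path_complex \<phi> (Suc i) (Suc j) V
      = path_complex \<phi> (Suc i) j ?W \<union> insert ?v ` path_complex \<phi> i (Suc j) ?W"
  proof (rule Set.set_eqI)
    fix F
    show "F \<in> path_complex \<phi> (Suc i) (Suc j) V \<longleftrightarrow>
        F \<in> path_complex \<phi> (Suc i) j ?W \<union> insert ?v ` path_complex \<phi> i (Suc j) ?W"
    proof (cases "?v \<in> F")
      case True
      have "F \<in> insert ?v ` path_complex \<phi> i (Suc j) ?W \<longleftrightarrow> F - {?v} \<in> path_complex \<phi> i (Suc j) ?W"
      proof
        assume "F \<in> insert ?v ` path_complex \<phi> i (Suc j) ?W"
        then obtain F' where F': "F = insert ?v F'" "F' \<in> path_complex \<phi> i (Suc j) ?W" by blast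
        then have "F - {?v} = F'" by (auto simp: path_complex_def)
        then show "F - {?v} \<in> path_complex \<phi> i (Suc j) ?W" using F' by simp
      next
        assume "F - {?v} \<in> path_complex \<phi> i (Suc j) ?W"
        then show "F \<in> insert ?v ` path_complex \<phi> i (Suc j) ?W"
          using True by (intro image_eqI[of _ _ "F - {?v}"]) auto
      qed
      also have "\<dots> \<longleftrightarrow> F \<subseteq> V \<and> (\<forall>G\<in>paths \<phi> i (Suc j). \<not> G \<subseteq> F)"
      proof -
        have "G \<subseteq> F - {?v} \<longleftrightarrow> G \<subseteq> F" if "G \<in> paths \<phi> i (Suc j)" for G using vG that by blast
        moreover have "F - {?v} \<subseteq> ?W \<longleftrightarrow> F \<subseteq> V" using v by blast
        ultimately show ?thesis by (simp add: path_complex_def)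
      qed
      also have "\<dots> \<longleftrightarrow> F \<in> path_complex \<phi> (Suc i) (Suc j) V"
      proof -
        \<comment> \<open>Paths avoiding the corner impose nothing new on \<open>F\<close>, as each
          contains a path with one row less.\<close>
        have "\<exists>H\<in>paths \<phi> i (Suc j). H \<subseteq> F" if "G \<in> paths \<phi> (Suc i) j" "G \<subseteq> F" for G
          using paths_Suc_left[OF that(1)] paths_Suc_right[of \<phi> i j] that(2) by blast
        then have "(\<forall>G\<in>paths \<phi> i (Suc j). \<not> G \<subseteq> F) \<longrightarrow> (\<forall>G\<in>paths \<phi> (Suc i) j. \<not> G \<subseteq> F)"
          by metis
        moreover have "(\<forall>G\<in>paths \<phi> (Suc i) (Suc j). \<not> G \<subseteq> F) \<longleftrightarrow>
            (\<forall>G\<in>paths \<phi> i (Suc j). \<not> G \<subseteq> F) \<and> (\<forall>G\<in>paths \<phi> (Suc i) j. \<not> G \<subseteq> F)"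
          using True by (simp only: paths.simps ball_Un Set.ball_simps ball_triv insert_subset simp_thms)
        ultimately show ?thesis by (simp only: path_complex_def mem_Collect_eq) metis
      qed
      moreover have "F \<notin> path_complex \<phi> (Suc i) j ?W" using True unfolding path_complex_def by blast
      ultimately show ?thesis by blast
    next
      case False
      have "(\<forall>G\<in>paths \<phi> (Suc i) (Suc j). \<not> G \<subseteq> F) \<longleftrightarrow> (\<forall>G\<in>paths \<phi> (Suc i) j. \<not> G \<subseteq> F)"
        using False by (simp only: paths.simps ball_Un Set.ball_simps ball_triv insert_subset simp_thms)
      moreover have "F \<subseteq> V \<longleftrightarrow> F \<subseteq> ?W" using False by blast
      moreover have "F \<notin> insert ?v ` path_complex \<phi> i (Suc j) ?W" using False by blast
      ultimately show ?thesis by (simp add: path_complex_def)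
    qed
  qed
  have fin: "finite (path_complex \<phi> a b ?W)" for a b
    by (rule finite_subset[of _ "Pow ?W"]) (use 3(5) in \<open>auto simp: path_complex_def\<close>)
  have inj: "inj_on (insert ?v) (path_complex \<phi> i (Suc j) ?W)"
    by (auto simp: inj_on_def path_complex_def)
  have "face_poly (path_complex \<phi> (Suc i) (Suc j) V)
      = face_poly (path_complex \<phi> (Suc i) j ?W) + (\<Sum>F\<in>insert ?v ` path_complex \<phi> i (Suc j) ?W. X ^ card F)"
    unfolding face_poly_def split using fin by (intro sum.union_disjoint) (auto simp: path_complex_def)
  also have "(\<Sum>F\<in>insert ?v ` path_complex \<phi> i (Suc j) ?W. X ^ card F)
      = (\<Sum>F\<in>path_complex \<phi> i (Suc j) ?W. X * X ^ card F)"
    unfolding sum.reindex[OF inj] comp_def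
  proof (rule sum.cong)
    fix F assume F: "F \<in> path_complex \<phi> i (Suc j) ?W"
    then have "finite F" "?v \<notin> F" using 3(5) finite_subset[of F V] unfolding path_complex_def by auto
    then show "X ^ card (insert ?v F) = X * X ^ card F" by simp
  qed simp
  also have "\<dots> = X * face_poly (path_complex \<phi> i (Suc j) ?W)"
    by (simp add: face_poly_def sum_distrib_left)
  finally have rec: "face_poly (path_complex \<phi> (Suc i) (Suc j) V)
      = face_poly (path_complex \<phi> (Suc i) j ?W) + X * face_poly (path_complex \<phi> i (Suc j) ?W)" .
  have card: "card V = Suc (card ?W)" using card_Suc_Diff1[OF 3(5) v] by (rule sym)
  let ?b = "[:1, 1:] ^ (card ?W - (i + j)) :: int poly"
  have "face_poly (path_complex \<phi> i (Suc j) ?W) = ?b * (\<Sum>l<i. of_nat (i + j choose l) * X ^ l)"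
    using 3(1)[OF d(1) sub(1)] 3(5,6) card by simp
  moreover have "face_poly (path_complex \<phi> (Suc i) j ?W) = ?b * (\<Sum>l<Suc i. of_nat (i + j choose l) * X ^ l)"
    using 3(2)[OF d(2) sub(2)] 3(5,6) card by simp
  ultimately have "face_poly (path_complex \<phi> (Suc i) (Suc j) V)
      = ?b * ((\<Sum>l<Suc i. of_nat (i + j choose l) * X ^ l) + X * (\<Sum>l<i. of_nat (i + j choose l) * X ^ l))"
    unfolding rec by (simp only: distrib_left mult.left_commute)
  then show ?case unfolding pascal_sum using card by simp
qed

lemma f_polynomial_eq_face_poly:
  assumes "\<Delta> \<subseteq> Pow {1..n}" "{} \<in> \<Delta>"
  shows "f_polynomial n \<Delta> = face_poly \<Delta>"
proof -
  have fin: "finite \<Delta>" by (rule finite_subset[OF assms(1)]) simp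
  have le: "card F \<le> n" if "F \<in> \<Delta>" for F
    using card_mono[of "{1..n}" F] that assms(1) by auto
  have empty: "{F \<in> \<Delta>. card F = 0} = {{}}"
    using assms finite_subset[of _ "{1..n}"] by auto
  have "face_poly \<Delta> = (\<Sum>k\<le>n. \<Sum>F\<in>{F \<in> \<Delta>. card F = k}. X ^ card F)"
    unfolding face_poly_def using fin le by (intro sum.group[symmetric]) auto
  also have "\<dots> = (\<Sum>k\<le>n. of_nat (card {F \<in> \<Delta>. card F = k}) * X ^ k)"
    by (intro sum.cong) simp_all
  also have "\<dots> = of_nat (card {F \<in> \<Delta>. card F = 0}) * X ^ 0
      + (\<Sum>k<n. of_nat (card {F \<in> \<Delta>. card F = Suc k}) * X ^ Suc k)"
    unfolding lessThan_Suc_atMost[symmetric] by (rule sum.lessThan_Suc_shift)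
  also have "\<dots> = f_polynomial n \<Delta>"
    unfolding empty f_polynomial_def face_number_def by simp
  finally show ?thesis ..
qed

section \<open>Labellings of the grid\<close>

text \<open>Start from one cell on each of the \<open>i + j - 1\<close> antidiagonals, add cells until \<open>n\<close> are
  reached, and identify every other cell with the chosen one on its antidiagonal.\<close>

lemma exists_diagonal_labelling:
  assumes ij: "i > 0" "j > 0" and n: "i + j \<le> Suc n" "n \<le> i * j"
  shows "\<exists>\<phi>. diagonal \<phi> i j \<and> cells \<phi> i j = {1..n}"
proof -
  let ?G = "{..<i} \<times> {..<j}"
  define \<delta> where "\<delta> p = fst p + snd p" for p :: "nat \<times> nat"
  \<comment> \<open>Down the first column, then along the last row: one cell on each
    antidiagonal.\<close>
  define \<sigma> where "\<sigma> d = (if d < i then (d, 0) else (i - 1, d - (i - 1)))" for d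
  have \<sigma>: "\<sigma> d \<in> ?G" "\<delta> (\<sigma> d) = d" if "d < i + j - 1" for d
    using that ij by (auto simp: \<sigma>_def \<delta>_def)
  have \<delta>: "\<delta> p < i + j - 1" if "p \<in> ?G" for p using that by (auto simp: \<delta>_def)
  have inj: "inj_on \<sigma> {..<i + j - 1}" by (rule inj_on_inverseI[of _ \<delta>]) (use \<sigma> in auto)
  have "\<sigma> ` {..<i + j - 1} \<subseteq> ?G" by (intro image_subsetI \<sigma>(1)) simp
  moreover have "card (\<sigma> ` {..<i + j - 1}) \<le> n" using card_image[OF inj] n by simp
  moreover have "n \<le> card ?G" using n by (simp add: card_cartesian_product)
  \<comment> \<open>Both bounds on \<open>n\<close> act here: \<open>C\<close> contains the
    \<open>i + j - 1\<close> chosen cells and fits into the grid.\<close>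
  ultimately obtain C where C: "\<sigma> ` {..<i + j - 1} \<subseteq> C" "C \<subseteq> ?G" "card C = n"
    using exists_subset_between[of "\<sigma> ` {..<i + j - 1}" n ?G] by auto
  define \<rho> where "\<rho> p = (if p \<in> C then p else \<sigma> (\<delta> p))" for p
  have \<rho>: "\<rho> p \<in> C" "\<delta> (\<rho> p) = \<delta> p" if "p \<in> ?G" for p
    using \<delta>[OF that] \<sigma>(2) C(1) by (auto simp: \<rho>_def)
  have "finite C" using C(2) by (rule finite_subset) simp
  then obtain h where h: "bij_betw h C {1..n}"
    using finite_same_card_bij[of C "{1..n}"] C(3) by auto
  have "diagonal (\<lambda>a b. h (\<rho> (a, b))) i j"
  proof (rule diagonalI)
    fix a b a' b' assume eq: "h (\<rho> (a, b)) = h (\<rho> (a', b'))" and "a < i" "b < j" "a' < i" "b' < j"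
    then have G: "(a, b) \<in> ?G" "(a', b') \<in> ?G" by auto
    have "\<rho> (a, b) = \<rho> (a', b')"
      using eq \<rho>(1)[OF G(1)] \<rho>(1)[OF G(2)] h by (auto simp: bij_betw_def inj_on_def)
    then show "a + b = a' + b'" using \<rho>(2)[OF G(1)] \<rho>(2)[OF G(2)] by (simp add: \<delta>_def)
  qed
  moreover have "cells (\<lambda>a b. h (\<rho> (a, b))) i j = {1..n}"
  proof -
    have "cells (\<lambda>a b. h (\<rho> (a, b))) i j = h ` \<rho> ` ?G"
      by (fastforce simp: cells_def image_iff)
    also have "\<rho> ` ?G = C"
    proof
      show "\<rho> ` ?G \<subseteq> C" by (intro image_subsetI \<rho>(1))
      show "C \<subseteq> \<rho> ` ?G"
      proof
        fix p assume "p \<in> C"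
        then have "p = \<rho> p" "p \<in> ?G" using C(2) by (auto simp: \<rho>_def)
        then show "p \<in> \<rho> ` ?G" by (rule image_eqI)
      qed
    qed
    finally show ?thesis using h by (simp add: bij_betw_def)
  qed
  ultimately show ?thesis by blast
qed

theorem theorem4p7:
  fixes n c s :: nat
  assumes "c < s" and "s \<le> n" and "n \<le> (c + 1) * (s - c)"
  shows "\<exists>\<Delta>. bi_cohen_macaulay TYPE('k::field) n \<Delta> \<and> has_type \<Delta> n c s \<and> \<not> is_cone n \<Delta>"
proof -
  \<comment> \<open>A grid with \<open>c + 1\<close> rows and \<open>e\<close> columns has
    \<open>s\<close> antidiagonals, and its paths have \<open>c + 1\<close> elements; this produces
    both invariants.\<close>
  define e where "e = s - c"
  have e: "e > 0" "s = c + e" using assms(1) by (auto simp: e_def)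
  obtain \<phi> where diag: "diagonal \<phi> (Suc c) e" and cells: "cells \<phi> (Suc c) e = {1..n}"
    using exists_diagonal_labelling[of "Suc c" e n] assms e by auto
  let ?\<Delta> = "path_complex \<phi> (Suc c) e {1..n}"
  have path: "G \<subseteq> {1..n}" "finite G" "card G = Suc c" if "G \<in> paths \<phi> (Suc c) e" for G
    using paths_subset_cells[OF that] card_path[OF diag that] cells by auto
  have small: "F \<in> ?\<Delta>" if "F \<subseteq> {1..n}" "card F \<le> c" for F
  proof -
    have "\<not> G \<subseteq> F" if "G \<in> paths \<phi> (Suc c) e" for G
      using card_mono[of F G] path(3)[OF that] \<open>card F \<le> c\<close> finite_subset[OF \<open>F \<subseteq> {1..n}\<close>] by auto
    then show ?thesis using that(1) by (auto simp: path_complex_def)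
  qed
  obtain e' where e': "e = Suc e'" using e(1) by (cases e) auto
  have "bi_cohen_macaulay TYPE('k) n ?\<Delta>"
    unfolding bi_cohen_macaulay_def
  proof (intro conjI)
    show "simplicial_complex n ?\<Delta>" by (auto simp: simplicial_complex_def path_complex_def)
    show "cohen_macaulay_complex TYPE('k) n ?\<Delta>"
      using cells diag e by (intro cohen_macaulay_path_complex) auto
    have "alexander_dual n ?\<Delta> = path_complex (flipped \<phi>) e (Suc c) {1..n}"
      using cells by (intro alexander_dual_path_complex) auto
    moreover have "cells (flipped \<phi>) e (Suc c) \<subseteq> {1..n}"
      using cells unfolding cells_flipped[of \<phi> e "Suc c"] by simp
    from cohen_macaulay_path_complex[OF this diagonal_flipped[OF diag] e(1) zero_less_Suc]
    have "cohen_macaulay_complex TYPE('k) n (path_complex (flipped \<phi>) e (Suc c) {1..n})" .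
    ultimately show "cohen_macaulay_complex TYPE('k) n (alexander_dual n ?\<Delta>)" by (simp only:)
  qed
  moreover have "has_type ?\<Delta> n c s"
    unfolding has_type_def
  proof (intro conjI allI impI)
    show "s \<le> n" "c \<le> n" using assms by auto
    show "F \<in> ?\<Delta>" if "F \<subseteq> {1..n}" "card F = c" for F using that small by simp
    show "\<not> (\<forall>F\<subseteq>{1..n}. card F = r \<longrightarrow> F \<in> ?\<Delta>)" if r: "c < r \<and> r \<le> n" for r
    proof -
      obtain G where G: "G \<in> paths \<phi> (Suc c) e" using paths_nonempty[of \<phi> "Suc c" e'] e' by blast
      obtain F where F: "G \<subseteq> F" "F \<subseteq> {1..n}" "card F = r"
        using exists_subset_between[of G r "{1..n}"] path[OF G] r by auto
      then have "F \<notin> ?\<Delta>" using G by (auto simp: path_complex_def)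
      then show ?thesis using F by blast
    qed
    have "{} \<in> ?\<Delta>" by (rule small) auto
    moreover have "?\<Delta> \<subseteq> Pow {1..n}" by (auto simp: path_complex_def)
    ultimately have "f_polynomial n ?\<Delta> = face_poly ?\<Delta>" by (intro f_polynomial_eq_face_poly)
    also have "\<dots> = [:1, 1:] ^ (n - s) * (\<Sum>l<Suc c. of_nat (s choose l) * X ^ l)"
      using face_poly_path_complex[OF diag, of "{1..n}"] cells e(2) assms(2) by simp
    finally show "f_polynomial n ?\<Delta> = [:1, 1:] ^ (n - s) * (\<Sum>j\<le>c. of_nat (s choose j) * [:0, 1:] ^ j)"
      by (simp only: lessThan_Suc_atMost)
  qed
  moreover have "\<not> is_cone n ?\<Delta>"
  proof
    assume "is_cone n ?\<Delta>"
    then obtain i where i: "i \<in> {1..n}" "\<And>F. F \<in> ?\<Delta> \<Longrightarrow> insert i F \<in> ?\<Delta>" by (auto simp: is_cone_def)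
    then obtain G where G: "G \<in> paths \<phi> (Suc c) e" "i \<in> G"
      using cells cells_covered[of \<phi> "Suc c" e'] e' by blast
    \<comment> \<open>Without \<open>i\<close> the path has only \<open>c\<close> elements and is a
      face; a cone point \<open>i\<close> would make \<open>G\<close> a face as well.\<close>
    have "G - {i} \<in> ?\<Delta>" using path[OF G(1)] G(2) by (intro small) auto
    then have "G \<in> ?\<Delta>" using i(2)[of "G - {i}"] G(2) by (simp add: insert_absorb)
    then show False using G(1) by (auto simp: path_complex_def)
  qed
  ultimately show ?thesis by blast
qed

end
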